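(* For a spatially compact, timelike Cauchy complete, globally hyperbolic KS-Lorentzian length space $X$, the space $(\mathcal{C}_X,d_J)$ is a complete geodesic metric space.
   Context: An extended time separation function on a set $X$ is a map $\ell:X\times X\to\{-\infty\}\cup[0,\infty]$ with $\ell(x,x)\ge0$ and $\ell(x,y)+\ell(y,z)\le\ell(x,z)$ (convention $-\infty+\infty=-\infty$). Put $d=\max(0,\ell)$ (Lorentzian distance); $x\le y$ iff $\ell(x,y)\ge0$; $x\ll y$ iff $d(x,y)>0$; $J^+(x)=\{y:x\le y\}$, $J^-(x)=\{y:y\le x\}$, $I^+(x)=\{y:x\ll y\}$, $I^-(x)=\{y:y\ll x\}$, $J^\pm(K)=\bigcup_{x\in K}J^\pm(x)$. A KS-Lorentzian pre-length space is such a pair $(X,\ell)$ together with a metric $\rho$ on $X$ such that (for the induced topology) all $I^\pm(x)$ are open and $d$ is lower semicontinuous. Globally hyperbolic: $\le$ is antisymmetric and closed in $X\times X$, and $J^+(K)\cap J^-(K)$ is compact for all compact $K$. Curves are maps from intervals $I\subset\mathbb{R}$ to $X$ that are locally Lipschitz with respect to $\rho$; $\gamma$ is causal (timelike) if $t<s$ implies $\gamma(t)\le\gamma(s)$ ($\gamma(t)\ll\gamma(s)$). $L(\gamma)=\inf\sum_i d(\gamma(t_i),\gamma(t_{i+1}))$ over partitions of $[a,b]$. A KS-Lorentzian pre-length space is a KS-Lorentzian length space if: (1) every point has a neighborhood $U$ such that $p_n,q_n\in U$, $p_n\le q_n$, $p_n\to p\in\overline U$, $q_n\to q\in\overline U$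 imply $p\le q$; (2) any $x\le y$ (resp. $x\ll y$) can be connected by a causal (resp. timelike) curve; (3) every $x$ has an open neighborhood $\Omega_x$ such that (a) for some $C>0$ all causal curves in $\Omega_x$ have $\rho$-arclength at most $C$, (b) $I^\pm(y)\cap\Omega_x\ne\emptyset$ for all $y\in\Omega_x$, and there is a continuous $\omega_x:\Omega_x\times\Omega_x\to[0,\infty)$ making $\Omega_x$ with the restrictions of $\rho,\ll,\le$ a KS-Lorentzian pre-length space with Lorentzian distance $\omega_x$, (c) for all $p\le q$, $p\ne q$ in $\Omega_x$ there is a causal curve $\gamma_{p,q}$ in $\Omega_x$ from $p$ to $q$ of maximal length among causal curves from $p$ to $q$ in $\Omega_x$, with $L(\gamma_{p,q})=\omega_x(p,q)\le d(p,q)$; (4) for $x\ll y$, $d(x,y)$ is the supremum of the lengths of causal curves from $x$ to $y$. A causal curve $\gamma:I\to X$ is future extendible if there exist an order-preserving homeomorphism $\varphi:I\to\hat I$ onto an interval, an interval $\tilde I\supset\hat I$ containing some $t$ with $t>s$ for all $s\in\hat I$, and a causal curve $\tilde\gamma:\tilde I\to X$ with $\tilde\gamma|_{\hat I}=\gamma\circ\varphi^{-1}$; otherwise future inextendible. Past versions are analogous; inextendible means both. A timelike curve is inextendible if it is so as a causal curve. A Cauchy set is a subset of $X$ intersected exactly once by every inextendible timelike curve; $\mathcal{C}_X$ is the set of Cauchy sets. $X$ is spatially compact if it contains a Cauchy set and all its Cauchy sets are compact. $d_J(A,B)=\sup_{x\in A,y\in B}(d(x,y)+d(y,x))$. Timelike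 Cauchy complete: every sequence $(x_j)$ in $X$ converges in $X$ provided that either $x_j\ll x_{j+1}$ for all $j$ and $\sup_k d(x_j,x_{j+k})\to0$ as $j\to\infty$, or $x_{j+1}\ll x_j$ for all $j$ and $\sup_k d(x_{j+k},x_j)\to0$ as $j\to\infty$. A metric space $(Y,\delta)$ is geodesic if any two points $p,q$ can be connected by a curve of length $\delta(p,q)$. *)

theory Defs
  imports "HOL-Analysis.Analysis"
begin

section \<open>Extended time separation functions\<close>

text \<open>On \<open>ereal\<close> one has \<open>- \<infinity> + \<infinity> = \<infinity>\<close>, whereas the reverse triangle
  inequality is meant with \<open>- \<infinity> + \<infinity> = - \<infinity>\<close>.\<close>

definition add_sep :: "ereal \<Rightarrow> ereal \<Rightarrow> ereal" where
  "add_sep a b = (if a = - \<infinity> \<or> b = - \<infinity> then - \<infinity> else a + b)"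

definition time_separation_on :: "'a set \<Rightarrow> ('a \<Rightarrow> 'a \<Rightarrow> ereal) \<Rightarrow> bool" where
  "time_separation_on S l \<longleftrightarrow>
     (\<forall>x\<in>S. \<forall>y\<in>S. l x y = - \<infinity> \<or> 0 \<le> l x y) \<and>
     (\<forall>x\<in>S. 0 \<le> l x x) \<and>
     (\<forall>x\<in>S. \<forall>y\<in>S. \<forall>z\<in>S. add_sep (l x y) (l y z) \<le> l x z)"

definition lor_dist :: "('a \<Rightarrow> 'a \<Rightarrow> ereal) \<Rightarrow> 'a \<Rightarrow> 'a \<Rightarrow> ereal" where
  "lor_dist l x y = max 0 (l x y)"

definition causal_le :: "('a \<Rightarrow> 'a \<Rightarrow> ereal) \<Rightarrow> 'a \<Rightarrow> 'a \<Rightarrow> bool" where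
  "causal_le l x y \<longleftrightarrow> 0 \<le> l x y"

definition chron_less :: "('a \<Rightarrow> 'a \<Rightarrow> ereal) \<Rightarrow> 'a \<Rightarrow> 'a \<Rightarrow> bool" where
  "chron_less l x y \<longleftrightarrow> 0 < lor_dist l x y"

definition J_plus :: "('a \<Rightarrow> 'a \<Rightarrow> ereal) \<Rightarrow> 'a set \<Rightarrow> 'a set" where
  "J_plus l K = (\<Union>x\<in>K. {y. causal_le l x y})"

definition J_minus :: "('a \<Rightarrow> 'a \<Rightarrow> ereal) \<Rightarrow> 'a set \<Rightarrow> 'a set" where
  "J_minus l K = (\<Union>x\<in>K. {y. causal_le l y x})"

definition I_plus :: "('a \<Rightarrow> 'a \<Rightarrow> ereal) \<Rightarrow> 'a \<Rightarrow> 'a set" where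
  "I_plus l x = {y. chron_less l x y}"

definition I_minus :: "('a \<Rightarrow> 'a \<Rightarrow> ereal) \<Rightarrow> 'a \<Rightarrow> 'a set" where
  "I_minus l x = {y. chron_less l y x}"

text \<open>The metric is that of the class \<open>metric_space\<close>. The carrier \<open>S\<close> is needed because a length
  space carries such structures on open subsets; openness and semicontinuity refer to the subspace
  topology of \<open>S\<close>.\<close>

definition KS_pre_length_space_on :: "'a::metric_space set \<Rightarrow> ('a \<Rightarrow> 'a \<Rightarrow> ereal) \<Rightarrow> bool" where
  "KS_pre_length_space_on S l \<longleftrightarrow>
     time_separation_on S l \<and>
     (\<forall>x\<in>S. openin (top_of_set S) (S \<inter> I_plus l x) \<and> openin (top_of_set S) (S \<inter> I_minus l x)) \<and>
     (\<forall>c. openin (top_of_set (S \<times> S)) {(x, y). x \<in> S \<and> y \<in> S \<and> c < lor_dist l x y})"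

definition globally_hyperbolic :: "('a::metric_space \<Rightarrow> 'a \<Rightarrow> ereal) \<Rightarrow> bool" where
  "globally_hyperbolic l \<longleftrightarrow>
     (\<forall>x y. causal_le l x y \<and> causal_le l y x \<longrightarrow> x = y) \<and>
     closed {(x, y). causal_le l x y} \<and>
     (\<forall>K. compact K \<longrightarrow> compact (J_plus l K \<inter> J_minus l K))"

section \<open>Curves\<close>

text \<open>Curves are taken with respect to a carrier \<open>Y\<close> and a distance function \<open>\<delta>\<close>, since they are used
  both in \<open>X\<close> and in its space of Cauchy sets.\<close>

definition curve_in :: "'b set \<Rightarrow> ('b \<Rightarrow> 'b \<Rightarrow> real) \<Rightarrow> real set \<Rightarrow> (real \<Rightarrow> 'b) \<Rightarrow> bool" where
  "curve_in Y \<delta> I \<gamma> \<longleftrightarrow>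
     is_interval I \<and> I \<noteq> {} \<and> \<gamma> ` I \<subseteq> Y \<and>
     (\<forall>t\<in>I. \<exists>e>0. \<exists>C. \<forall>s\<in>I \<inter> ball t e. \<forall>u\<in>I \<inter> ball t e. \<delta> (\<gamma> s) (\<gamma> u) \<le> C * \<bar>s - u\<bar>)"

definition arclength :: "('b \<Rightarrow> 'b \<Rightarrow> real) \<Rightarrow> real set \<Rightarrow> (real \<Rightarrow> 'b) \<Rightarrow> ereal" where
  "arclength \<delta> I \<gamma> =
     Sup {ereal (\<Sum>i<n. \<delta> (\<gamma> (t i)) (\<gamma> (t (Suc i)))) | (n::nat) t.
            (\<forall>i\<le>n. t i \<in> I) \<and> (\<forall>i<n. t i < t (Suc i))}"

definition causal_curve ::
    "('a::metric_space \<Rightarrow> 'a \<Rightarrow> ereal) \<Rightarrow> real set \<Rightarrow> (real \<Rightarrow> 'a) \<Rightarrow> bool" where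
  "causal_curve l I \<gamma> \<longleftrightarrow>
     curve_in UNIV dist I \<gamma> \<and> (\<forall>t\<in>I. \<forall>s\<in>I. t < s \<longrightarrow> causal_le l (\<gamma> t) (\<gamma> s))"

definition timelike_curve ::
    "('a::metric_space \<Rightarrow> 'a \<Rightarrow> ereal) \<Rightarrow> real set \<Rightarrow> (real \<Rightarrow> 'a) \<Rightarrow> bool" where
  "timelike_curve l I \<gamma> \<longleftrightarrow>
     curve_in UNIV dist I \<gamma> \<and> (\<forall>t\<in>I. \<forall>s\<in>I. t < s \<longrightarrow> chron_less l (\<gamma> t) (\<gamma> s))"

definition causal_curve_from_to ::
    "('a::metric_space \<Rightarrow> 'a \<Rightarrow> ereal) \<Rightarrow> real \<Rightarrow> real \<Rightarrow> (real \<Rightarrow> 'a) \<Rightarrow> 'a \<Rightarrow> 'a \<Rightarrow> bool" where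
  "causal_curve_from_to l a b \<gamma> p q \<longleftrightarrow>
     a < b \<and> causal_curve l {a..b} \<gamma> \<and> \<gamma> a = p \<and> \<gamma> b = q"

definition timelike_curve_from_to ::
    "('a::metric_space \<Rightarrow> 'a \<Rightarrow> ereal) \<Rightarrow> real \<Rightarrow> real \<Rightarrow> (real \<Rightarrow> 'a) \<Rightarrow> 'a \<Rightarrow> 'a \<Rightarrow> bool" where
  "timelike_curve_from_to l a b \<gamma> p q \<longleftrightarrow>
     a < b \<and> timelike_curve l {a..b} \<gamma> \<and> \<gamma> a = p \<and> \<gamma> b = q"

definition lor_length ::
    "('a \<Rightarrow> 'a \<Rightarrow> ereal) \<Rightarrow> real \<Rightarrow> real \<Rightarrow> (real \<Rightarrow> 'a) \<Rightarrow> ereal" where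
  "lor_length l a b \<gamma> =
     Inf {(\<Sum>i<n. lor_dist l (\<gamma> (t i)) (\<gamma> (t (Suc i)))) | (n::nat) t.
            t 0 = a \<and> t n = b \<and> (\<forall>i<n. t i < t (Suc i))}"

section \<open>Length spaces\<close>

definition locally_causally_closed :: "('a::metric_space \<Rightarrow> 'a \<Rightarrow> ereal) \<Rightarrow> bool" where
  "locally_causally_closed l \<longleftrightarrow>
     (\<forall>x. \<exists>U. x \<in> interior U \<and>
        (\<forall>p q p' q'. (\<forall>n::nat. p n \<in> U \<and> q n \<in> U \<and> causal_le l (p n) (q n)) \<and>
            p' \<in> closure U \<and> q' \<in> closure U \<and> p \<longlonglongrightarrow> p' \<and> q \<longlonglongrightarrow> q' \<longrightarrow> causal_le l p' q'))"

definition causally_path_connected :: "('a::metric_space \<Rightarrow> 'a \<Rightarrow> ereal) \<Rightarrow> bool" where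
  "causally_path_connected l \<longleftrightarrow>
     (\<forall>x y. causal_le l x y \<longrightarrow> (\<exists>a b \<gamma>. causal_curve_from_to l a b \<gamma> x y)) \<and>
     (\<forall>x y. chron_less l x y \<longrightarrow> (\<exists>a b \<gamma>. timelike_curve_from_to l a b \<gamma> x y))"

text \<open>The time separation function \<open>l'\<close> below is determined by \<open>\<omega>\<close> and the restricted relation
  \<open>\<le>\<close>: it is the structure on \<open>\<Omega>\<close> with the restrictions of the metric, of \<open>\<lless>\<close> and of \<open>\<le>\<close>, and with
  Lorentzian distance \<open>\<omega>\<close>. In general \<open>\<omega>\<close> is not the restriction of the Lorentzian distance
  of \<open>l\<close>.\<close>

definition localizing_nbhd :: "('a::metric_space \<Rightarrow> 'a \<Rightarrow> ereal) \<Rightarrow> 'a set \<Rightarrow> bool" where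
  "localizing_nbhd l \<Omega> \<longleftrightarrow>
     (\<exists>C>0. \<forall>I \<gamma>. causal_curve l I \<gamma> \<and> \<gamma> ` I \<subseteq> \<Omega> \<longrightarrow> arclength dist I \<gamma> \<le> ereal C) \<and>
     (\<forall>y\<in>\<Omega>. I_plus l y \<inter> \<Omega> \<noteq> {} \<and> I_minus l y \<inter> \<Omega> \<noteq> {}) \<and>
     (\<exists>\<omega> :: 'a \<Rightarrow> 'a \<Rightarrow> real.
        continuous_on (\<Omega> \<times> \<Omega>) (\<lambda>(p, q). \<omega> p q) \<and>
        (\<forall>p\<in>\<Omega>. \<forall>q\<in>\<Omega>. 0 \<le> \<omega> p q) \<and>
        (\<exists>l'. KS_pre_length_space_on \<Omega> l' \<and>
           (\<forall>p\<in>\<Omega>. \<forall>q\<in>\<Omega>. (causal_le l' p q \<longleftrightarrow> causal_le l p q) \<and>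
                              (chron_less l' p q \<longleftrightarrow> chron_less l p q) \<and>
                              lor_dist l' p q = ereal (\<omega> p q))) \<and>
        (\<forall>p\<in>\<Omega>. \<forall>q\<in>\<Omega>. causal_le l p q \<and> p \<noteq> q \<longrightarrow>
           (\<exists>a b \<gamma>. causal_curve_from_to l a b \<gamma> p q \<and> \<gamma> ` {a..b} \<subseteq> \<Omega> \<and>
              (\<forall>a' b' \<gamma>'. causal_curve_from_to l a' b' \<gamma>' p q \<and> \<gamma>' ` {a'..b'} \<subseteq> \<Omega> \<longrightarrow>
                 lor_length l a' b' \<gamma>' \<le> lor_length l a b \<gamma>) \<and>
              lor_length l a b \<gamma> = ereal (\<omega> p q) \<and> ereal (\<omega> p q) \<le> lor_dist l p q)))"

definition KS_length_space :: "('a::metric_space \<Rightarrow> 'a \<Rightarrow> ereal) \<Rightarrow> bool" where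
  "KS_length_space l \<longleftrightarrow>
     KS_pre_length_space_on UNIV l \<and>
     locally_causally_closed l \<and>
     causally_path_connected l \<and>
     (\<forall>x. \<exists>\<Omega>. open \<Omega> \<and> x \<in> \<Omega> \<and> localizing_nbhd l \<Omega>) \<and>
     (\<forall>x y. chron_less l x y \<longrightarrow>
        lor_dist l x y = Sup {lor_length l a b \<gamma> | a b \<gamma>. causal_curve_from_to l a b \<gamma> x y})"

section \<open>Cauchy sets\<close>

definition future_extendible ::
    "('a::metric_space \<Rightarrow> 'a \<Rightarrow> ereal) \<Rightarrow> real set \<Rightarrow> (real \<Rightarrow> 'a) \<Rightarrow> bool" where
  "future_extendible l I \<gamma> \<longleftrightarrow>
     (\<exists>\<phi> \<psi> I' I'' \<gamma>'. is_interval I' \<and> homeomorphism I I' \<phi> \<psi> \<and> strict_mono_on I \<phi> \<and>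
        is_interval I'' \<and> I' \<subseteq> I'' \<and> (\<exists>t\<in>I''. \<forall>s\<in>I'. s < t) \<and>
        causal_curve l I'' \<gamma>' \<and> (\<forall>s\<in>I'. \<gamma>' s = \<gamma> (\<psi> s)))"

definition past_extendible ::
    "('a::metric_space \<Rightarrow> 'a \<Rightarrow> ereal) \<Rightarrow> real set \<Rightarrow> (real \<Rightarrow> 'a) \<Rightarrow> bool" where
  "past_extendible l I \<gamma> \<longleftrightarrow>
     (\<exists>\<phi> \<psi> I' I'' \<gamma>'. is_interval I' \<and> homeomorphism I I' \<phi> \<psi> \<and> strict_mono_on I \<phi> \<and>
        is_interval I'' \<and> I' \<subseteq> I'' \<and> (\<exists>t\<in>I''. \<forall>s\<in>I'. t < s) \<and>
        causal_curve l I'' \<gamma>' \<and> (\<forall>s\<in>I'. \<gamma>' s = \<gamma> (\<psi> s)))"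

definition inextendible ::
    "('a::metric_space \<Rightarrow> 'a \<Rightarrow> ereal) \<Rightarrow> real set \<Rightarrow> (real \<Rightarrow> 'a) \<Rightarrow> bool" where
  "inextendible l I \<gamma> \<longleftrightarrow> \<not> future_extendible l I \<gamma> \<and> \<not> past_extendible l I \<gamma>"

definition cauchy_sets :: "('a::metric_space \<Rightarrow> 'a \<Rightarrow> ereal) \<Rightarrow> 'a set set" where
  "cauchy_sets l =
     {S. \<forall>I \<gamma>. timelike_curve l I \<gamma> \<and> inextendible l I \<gamma> \<longrightarrow> (\<exists>!t. t \<in> I \<and> \<gamma> t \<in> S)}"

definition spatially_compact :: "('a::metric_space \<Rightarrow> 'a \<Rightarrow> ereal) \<Rightarrow> bool" where
  "spatially_compact l \<longleftrightarrow> cauchy_sets l \<noteq> {} \<and> (\<forall>S\<in>cauchy_sets l. compact S)"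

definition timelike_cauchy_complete :: "('a::metric_space \<Rightarrow> 'a \<Rightarrow> ereal) \<Rightarrow> bool" where
  "timelike_cauchy_complete l \<longleftrightarrow>
     (\<forall>x :: nat \<Rightarrow> 'a.
        ((\<forall>j. chron_less l (x j) (x (Suc j))) \<and>
           (\<lambda>j. SUP k. lor_dist l (x j) (x (j + k))) \<longlonglongrightarrow> 0) \<or>
        ((\<forall>j. chron_less l (x (Suc j)) (x j)) \<and>
           (\<lambda>j. SUP k. lor_dist l (x (j + k)) (x j)) \<longlonglongrightarrow> 0)
        \<longrightarrow> convergent x)"

definition d_J :: "('a \<Rightarrow> 'a \<Rightarrow> ereal) \<Rightarrow> 'a set \<Rightarrow> 'a set \<Rightarrow> ereal" where
  "d_J l A B = (SUP (x, y)\<in>A \<times> B. lor_dist l x y + lor_dist l y x)"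

section \<open>Geodesic metric spaces\<close>

definition geodesic_metric :: "'b set \<Rightarrow> ('b \<Rightarrow> 'b \<Rightarrow> real) \<Rightarrow> bool" where
  "geodesic_metric Y \<delta> \<longleftrightarrow>
     (\<forall>p\<in>Y. \<forall>q\<in>Y. \<exists>a b \<gamma>. a \<le> b \<and> curve_in Y \<delta> {a..b} \<gamma> \<and> \<gamma> a = p \<and> \<gamma> b = q \<and>
        arclength \<delta> {a..b} \<gamma> = ereal (\<delta> p q))"

end

theory Submission
  imports Defs
begin

text \<open>Points \<open>x \<lless> y\<close> lie on a common inextendible timelike curve, obtained by greedily prolonging a chain
  so that it cannot converge. Hence a Cauchy set \<open>A\<close> splits the space into its chronological past,
  itself and its chronological future, and \<open>A\<close> is the future boundary of a closed past set.
  Conversely, the future boundary of a closed past set is a Cauchy set as soon as every inextendible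
  timelike curve both meets and leaves the past set. Geodesics and limits are therefore built on the
  level of past sets: with \<open>D = d_J(A, B)\<close>, the sets of points \<open>x\<close> in the past of \<open>A\<close> or of \<open>B\<close> with
  \<open>d(A, x) \<le> s\<close> and \<open>d(B, x) \<le> D - s\<close> give a geodesic, and if \<open>d_J(A\<^sub>n, A\<^sub>m) \<le> \<delta>\<^sub>n\<close> for \<open>m \<ge> n\<close> with
  \<open>\<delta>\<^sub>n \<rightarrow> 0\<close>, then \<open>{x. \<forall>n. d(A\<^sub>n, x) \<le> \<delta>\<^sub>n}\<close> gives the limit of \<open>A\<^sub>n\<close>. There timelike Cauchy completeness
  is what prevents the points where an inextendible timelike curve meets the \<open>A\<^sub>n\<close> from escaping to an
  end of the curve. Finiteness of \<open>d_J\<close> follows by covering a compact causal diamond by finitely many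
  order convex neighbourhoods in which causal curves have bounded length.\<close>

section \<open>Curves and arclength\<close>

text \<open>Since \<open>d\<close> is only lower semicontinuous, its level sets need not be closed.
  What can be used are the closed sublevel sets \<open>{x. d a x \<le> c}\<close>, which contain
  with a point everything chronologically before it. The constructions therefore combine such
  bounds, and the estimates between edges run backwards: if a point of an edge is too far before
  another point, it is pushed slightly out of its past set, some defining bound then fails strictly,
  and the reverse triangle inequality carries this failure to the later point, where the bounds are
  under control. A second obstacle is that curves are locally Lipschitz while the metric is assumed
  neither complete nor locally compact. Prolonging a curve to a limit point is thus more than
  continuity: the curve must be reparametrized near its end, which is where the bounds on arclength
  in small neighbourhoods enter. Conversely, inextendibility is read off from divergent sequences of
  points on the curve. Lengths of causal curves serve to bound \<open>d\<close> from above, in the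
  finiteness of \<open>d_J\<close> and in its triangle inequality.\<close>

lemma curve_inD:
  assumes "curve_in Y \<delta> I \<gamma>" "t \<in> I"
  obtains e C where "0 < e"
    "\<And>s u. \<lbrakk>s \<in> I; u \<in> I; \<bar>s - t\<bar> < e; \<bar>u - t\<bar> < e\<rbrakk> \<Longrightarrow> \<delta> (\<gamma> s) (\<gamma> u) \<le> C * \<bar>s - u\<bar>"
proof -
  obtain e C where "0 < e"
    and *: "\<forall>s\<in>I \<inter> ball t e. \<forall>u\<in>I \<inter> ball t e. \<delta> (\<gamma> s) (\<gamma> u) \<le> C * \<bar>s - u\<bar>"
    using assms unfolding curve_in_def by blast
  show thesis
    by (rule that[OF \<open>0 < e\<close>, of C])
      (use * in \<open>auto simp: dist_real_def abs_minus_commute\<close>)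
qed

lemma curve_inI:
  assumes "is_interval I" "I \<noteq> {}" "\<gamma> ` I \<subseteq> Y"
    and "\<And>t. t \<in> I \<Longrightarrow> \<exists>e>0. \<exists>C. \<forall>s\<in>I. \<forall>u\<in>I. \<bar>s - t\<bar> < e \<longrightarrow> \<bar>u - t\<bar> < e \<longrightarrow>
           \<delta> (\<gamma> s) (\<gamma> u) \<le> C * \<bar>s - u\<bar>"
  shows "curve_in Y \<delta> I \<gamma>"
  unfolding curve_in_def
proof (intro conjI ballI assms)
  fix t assume "t \<in> I"
  then obtain e C where "e > 0" and
    *: "\<forall>s\<in>I. \<forall>u\<in>I. \<bar>s - t\<bar> < e \<longrightarrow> \<bar>u - t\<bar> < e \<longrightarrow> \<delta> (\<gamma> s) (\<gamma> u) \<le> C * \<bar>s - u\<bar>"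
    using assms(4) by blast
  then show "\<exists>e>0. \<exists>C. \<forall>s\<in>I \<inter> ball t e. \<forall>u\<in>I \<inter> ball t e. \<delta> (\<gamma> s) (\<gamma> u) \<le> C * \<bar>s - u\<bar>"
    by (intro exI[of _ e] conjI exI[of _ C]) (auto simp: dist_real_def abs_minus_commute)
qed

lemma curve_in_lipschitzI:
  fixes \<gamma> :: "real \<Rightarrow> 'b::metric_space"
  assumes "is_interval I" "I \<noteq> {}"
    and "\<And>t. t \<in> I \<Longrightarrow> \<exists>e>0. \<exists>C. C-lipschitz_on (I \<inter> ball t e) \<gamma>"
  shows "curve_in UNIV dist I \<gamma>"
proof (rule curve_inI)
  fix t assume "t \<in> I"
  then obtain e C where "e > 0" "C-lipschitz_on (I \<inter> ball t e) \<gamma>"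
    using assms(3) by blast
  then show "\<exists>e>0. \<exists>C. \<forall>s\<in>I. \<forall>u\<in>I. \<bar>s - t\<bar> < e \<longrightarrow> \<bar>u - t\<bar> < e \<longrightarrow>
           dist (\<gamma> s) (\<gamma> u) \<le> C * \<bar>s - u\<bar>"
    by (intro exI[of _ e] conjI exI[of _ C])
      (auto simp: lipschitz_on_def dist_real_def abs_minus_commute)
qed (use assms in auto)

lemma curve_in_subset:
  assumes "curve_in Y \<delta> I \<gamma>" "J \<subseteq> I" "J \<noteq> {}" "is_interval J"
  shows "curve_in Y \<delta> J \<gamma>"
proof (rule curve_inI)
  fix t assume "t \<in> J"
  then have "t \<in> I" using assms by blast
  from curve_inD[OF assms(1) this] obtain e C where "0 < e"
    and *: "\<And>s u. \<lbrakk>s \<in> I; u \<in> I; \<bar>s - t\<bar> < e; \<bar>u - t\<bar> < e\<rbrakk> \<Longrightarrow> \<delta> (\<gamma> s) (\<gamma> u) \<le> C * \<bar>s - u\<bar>"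
    by blast
  then show "\<exists>e>0. \<exists>C. \<forall>s\<in>J. \<forall>u\<in>J. \<bar>s - t\<bar> < e \<longrightarrow> \<bar>u - t\<bar> < e \<longrightarrow>
           \<delta> (\<gamma> s) (\<gamma> u) \<le> C * \<bar>s - u\<bar>"
    using assms(2) by (meson subsetD)
qed (use assms in \<open>auto simp: curve_in_def\<close>)

lemma curve_in_continuous_on:
  fixes \<gamma> :: "real \<Rightarrow> 'b::metric_space"
  assumes "curve_in UNIV dist I \<gamma>"
  shows "continuous_on I \<gamma>"
  unfolding continuous_on_iff
proof (intro ballI allI impI)
  fix t and \<epsilon> :: real assume "t \<in> I" "\<epsilon> > 0"
  from curve_inD[OF assms \<open>t \<in> I\<close>] obtain e C where "0 < e"
    and *: "\<And>s u. \<lbrakk>s \<in> I; u \<in> I; \<bar>s - t\<bar> < e; \<bar>u - t\<bar> < e\<rbrakk> \<Longrightarrow> dist (\<gamma> s) (\<gamma> u) \<le> C * \<bar>s - u\<bar>"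
    by blast
  define r where "r = min e (\<epsilon> / (\<bar>C\<bar> + 1))"
  have "r > 0" using \<open>\<epsilon> > 0\<close> \<open>0 < e\<close> by (auto simp: r_def)
  moreover have "dist (\<gamma> s) (\<gamma> t) < \<epsilon>" if "s \<in> I" "dist s t < r" for s
  proof -
    have "dist (\<gamma> s) (\<gamma> t) \<le> C * \<bar>s - t\<bar>"
      using that \<open>t \<in> I\<close> \<open>0 < e\<close> by (intro *) (auto simp: r_def dist_real_def)
    also have "\<dots> \<le> (\<bar>C\<bar> + 1) * \<bar>s - t\<bar>" by (intro mult_right_mono) auto
    also have "\<dots> < \<epsilon>" using that by (auto simp: r_def dist_real_def field_simps)
    finally show ?thesis .
  qed
  ultimately show "\<exists>r>0. \<forall>s\<in>I. dist s t < r \<longrightarrow> dist (\<gamma> s) (\<gamma> t) < \<epsilon>" by blast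
qed

lemma curve_in_compact_lipschitz:
  fixes \<gamma> :: "real \<Rightarrow> 'b::metric_space"
  assumes "curve_in UNIV dist {a..b} \<gamma>"
  obtains L where "L-lipschitz_on {a..b} \<gamma>"
proof -
  \<comment> \<open>\<open>local_lipschitz\<close> speaks of a family of maps; the family here is
    constant, over the one-point time set \<open>{0}\<close>.\<close>
  have "local_lipschitz {0::real} {a..b} (\<lambda>_. \<gamma>)"
  proof (rule local_lipschitzI)
    fix t x :: real assume "x \<in> {a..b}"
    from curve_inD[OF assms this] obtain e C where "0 < e"
      and *: "\<And>s u. \<lbrakk>s \<in> {a..b}; u \<in> {a..b}; \<bar>s - x\<bar> < e; \<bar>u - x\<bar> < e\<rbrakk> \<Longrightarrow>
        dist (\<gamma> s) (\<gamma> u) \<le> C * \<bar>s - u\<bar>"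
      by blast
    have "\<bar>C\<bar>-lipschitz_on (cball x (e/2) \<inter> {a..b}) \<gamma>"
    proof (rule lipschitz_onI)
      fix s u assume "s \<in> cball x (e/2) \<inter> {a..b}" "u \<in> cball x (e/2) \<inter> {a..b}"
      then have "dist (\<gamma> s) (\<gamma> u) \<le> C * \<bar>s - u\<bar>"
        using \<open>0 < e\<close> by (intro *) (simp_all add: dist_real_def abs_real_def split: if_splits)
      also have "\<dots> \<le> \<bar>C\<bar> * dist s u"
        by (auto simp: dist_real_def intro!: mult_right_mono)
      finally show "dist (\<gamma> s) (\<gamma> u) \<le> \<bar>C\<bar> * dist s u" .
    qed auto
    then show "\<exists>u>0. \<exists>L. \<forall>t\<in>cball t u \<inter> {0}. L-lipschitz_on (cball x u \<inter> {a..b}) \<gamma>"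
      using \<open>0 < e\<close> by (intro exI[of _ "e/2"]) auto
  qed
  then obtain L where "\<And>t. t \<in> {0::real} \<Longrightarrow> L-lipschitz_on {a..b} \<gamma>"
    using local_lipschitz_compact_implies_lipschitz[OF _ compact_Icc compact_sing continuous_on_const]
    by blast
  then show thesis using that by blast
qed

lemma curve_in_reflect:
  assumes "curve_in Y \<delta> I \<gamma>"
  shows "curve_in Y \<delta> (uminus ` I) (\<lambda>t. \<gamma> (- t))"
proof (rule curve_inI)
  fix t assume "t \<in> uminus ` I"
  then have "- t \<in> I" by auto
  from curve_inD[OF assms this] obtain e C where "0 < e"
    and *: "\<And>s u. \<lbrakk>s \<in> I; u \<in> I; \<bar>s - (- t)\<bar> < e; \<bar>u - (- t)\<bar> < e\<rbrakk> \<Longrightarrow> \<delta> (\<gamma> s) (\<gamma> u) \<le> C * \<bar>s - u\<bar>"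
    by blast
  have "\<delta> (\<gamma> (- s)) (\<gamma> (- u)) \<le> C * \<bar>s - u\<bar>"
    if "s \<in> uminus ` I" "u \<in> uminus ` I" "\<bar>s - t\<bar> < e" "\<bar>u - t\<bar> < e" for s u
    using *[of "- s" "- u"] that by (auto simp: abs_minus_commute)
  then show "\<exists>e>0. \<exists>C. \<forall>s\<in>uminus ` I. \<forall>u\<in>uminus ` I. \<bar>s - t\<bar> < e \<longrightarrow> \<bar>u - t\<bar> < e \<longrightarrow>
           \<delta> (\<gamma> (- s)) (\<gamma> (- u)) \<le> C * \<bar>s - u\<bar>"
    using \<open>0 < e\<close> by blast
qed (use assms in \<open>auto simp: curve_in_def\<close>)

section \<open>Arclength and partitions\<close>

lemma refine_weak_partition:
  fixes u :: "nat \<Rightarrow> real" and \<delta> :: "'b \<Rightarrow> 'b \<Rightarrow> real"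
  assumes "\<And>x. \<delta> x x = 0"
  shows "\<lbrakk>\<forall>i\<le>n. u i \<in> J; \<forall>i<n. u i \<le> u (Suc i)\<rbrakk> \<Longrightarrow>
    \<exists>(m::nat) v. (\<forall>i\<le>m. v i \<in> J) \<and> (\<forall>i<m. v i < v (Suc i)) \<and> v m = u n \<and>
      (\<Sum>i<m. \<delta> (\<gamma> (v i)) (\<gamma> (v (Suc i)))) = (\<Sum>i<n. \<delta> (\<gamma> (u i)) (\<gamma> (u (Suc i))))"
proof (induction n)
  case 0
  then show ?case by (intro exI[of _ 0] exI[of _ u]) auto
next
  case (Suc n)
  then obtain m v where v: "\<forall>i\<le>m. v i \<in> J" "\<forall>i<m. v i < v (Suc i)" "v m = u n"
    "(\<Sum>i<m. \<delta> (\<gamma> (v i)) (\<gamma> (v (Suc i)))) = (\<Sum>i<n. \<delta> (\<gamma> (u i)) (\<gamma> (u (Suc i))))"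
    by auto
  \<comment> \<open>A repeated point adds \<open>\<delta> x x = 0\<close> and is dropped. The
    invariant \<open>v m = u n\<close> allows the next point to be attached.\<close>
  show ?case
  proof (cases "u n = u (Suc n)")
    case True
    then show ?thesis using v assms by (intro exI[of _ m] exI[of _ v]) auto
  next
    case False
    then have "u n < u (Suc n)" using Suc.prems(2) by (metis lessI order_le_less)
    have "(\<Sum>i<m. \<delta> (\<gamma> ((v(Suc m := u (Suc n))) i)) (\<gamma> ((v(Suc m := u (Suc n))) (Suc i)))) =
        (\<Sum>i<m. \<delta> (\<gamma> (v i)) (\<gamma> (v (Suc i))))"
      by (intro sum.cong) auto
    then show ?thesis
      using v \<open>u n < u (Suc n)\<close> Suc.prems(1)
      by (intro exI[of _ "Suc m"] exI[of _ "v(Suc m := u (Suc n))"])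
        (auto simp: le_Suc_eq less_Suc_eq)
  qed
qed

lemma arclength_upper:
  assumes "\<forall>i\<le>n. u i \<in> J" "\<forall>i<n. u i < u (Suc i)"
  shows "ereal (\<Sum>i<n. \<delta> (\<gamma> (u i)) (\<gamma> (u (Suc i)))) \<le> arclength \<delta> J \<gamma>"
  unfolding arclength_def by (rule Sup_upper) (use assms in blast)

lemma arclength_upper_weak:
  assumes "\<And>x. \<delta> x x = 0" "\<forall>i\<le>n. u i \<in> J" "\<forall>i<n. u i \<le> u (Suc i)"
  shows "ereal (\<Sum>i<n. \<delta> (\<gamma> (u i)) (\<gamma> (u (Suc i)))) \<le> arclength \<delta> J \<gamma>"
proof -
  obtain m v where v: "\<forall>i\<le>m. v i \<in> J" "\<forall>i<m. v i < v (Suc i)"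
    "(\<Sum>i<m. \<delta> (\<gamma> (v i)) (\<gamma> (v (Suc i)))) = (\<Sum>i<n. \<delta> (\<gamma> (u i)) (\<gamma> (u (Suc i))))"
    using refine_weak_partition[where \<gamma>=\<gamma> and \<delta>=\<delta>, OF assms] by blast
  show ?thesis using arclength_upper[OF v(1,2), of \<delta> \<gamma>] v(3) by simp
qed

lemma arclength_least:
  assumes "\<And>(n::nat) u. \<lbrakk>\<forall>i\<le>n. u i \<in> J; \<forall>i<n. u i < u (Suc i)\<rbrakk> \<Longrightarrow>
    ereal (\<Sum>i<n. \<delta> (\<gamma> (u i)) (\<gamma> (u (Suc i)))) \<le> c"
  shows "arclength \<delta> J \<gamma> \<le> c"
  unfolding arclength_def by (rule Sup_least) (use assms in blast)

lemma arclength_mono_set: "J \<subseteq> K \<Longrightarrow> arclength \<delta> J \<gamma> \<le> arclength \<delta> K \<gamma>"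
  by (intro arclength_least arclength_upper) auto

lemma arclength_nonneg: "J \<noteq> {} \<Longrightarrow> 0 \<le> arclength \<delta> J \<gamma>"
proof -
  assume "J \<noteq> {}"
  then obtain x where "x \<in> J" by blast
  then show ?thesis using arclength_upper[of 0 "\<lambda>_. x" J \<delta> \<gamma>] by (simp add: zero_ereal_def)
qed

text \<open>One inequality is enough, because reflecting twice gives the curve back.\<close>

lemma arclength_reflect:
  fixes \<gamma> :: "real \<Rightarrow> 'b::metric_space"
  shows "arclength dist (uminus ` J) (\<lambda>t. \<gamma> (- t)) \<le> arclength dist J \<gamma>"
proof (rule arclength_least)
  fix n :: nat and u :: "nat \<Rightarrow> real"
  assume u: "\<forall>i\<le>n. u i \<in> uminus ` J" "\<forall>i<n. u i < u (Suc i)"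
  define v where "v i = - u (n - i)" for i
  have "(\<Sum>i<n. dist (\<gamma> (v i)) (\<gamma> (v (Suc i)))) =
      (\<Sum>i<n. dist (\<gamma> (v (n - Suc i))) (\<gamma> (v (Suc (n - Suc i)))))"
    by (rule sum.nat_diff_reindex[symmetric])
  also have "\<dots> = (\<Sum>i<n. dist (\<gamma> (- u i)) (\<gamma> (- u (Suc i))))"
    by (intro sum.cong) (simp_all add: v_def dist_commute Suc_diff_Suc)
  finally have "(\<Sum>i<n. dist (\<gamma> (- u i)) (\<gamma> (- u (Suc i)))) =
      (\<Sum>i<n. dist (\<gamma> (v i)) (\<gamma> (v (Suc i))))" by simp
  moreover have "v i \<in> J" if "i \<le> n" for i
  proof -
    have "u (n - i) \<in> uminus ` J" using u(1) by simp
    then show ?thesis by (auto simp: v_def)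
  qed
  moreover have "v i < v (Suc i)" if "i < n" for i
    using u(2)[rule_format, of "n - Suc i"] that by (simp add: v_def Suc_diff_Suc)
  ultimately show "ereal (\<Sum>i<n. dist (\<gamma> (- u i)) (\<gamma> (- u (Suc i)))) \<le> arclength dist J \<gamma>"
    using arclength_upper[of n v J dist \<gamma>] by simp
qed

lemma arclength_append:
  fixes \<gamma> :: "real \<Rightarrow> 'b::metric_space"
  assumes "a \<le> s" "s \<le> t"
  shows "arclength dist {a..s} \<gamma> + ereal (dist (\<gamma> s) (\<gamma> t)) \<le> arclength dist {a..t} \<gamma>"
proof -
  \<comment> \<open>The distance is moved to the right, so that the supremum on the left can be
    bounded partition by partition.\<close>
  have "arclength dist {a..s} \<gamma> \<le> arclength dist {a..t} \<gamma> - ereal (dist (\<gamma> s) (\<gamma> t))"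
  proof (rule arclength_least)
    fix n :: nat and u :: "nat \<Rightarrow> real"
    assume u: "\<forall>i\<le>n. u i \<in> {a..s}" "\<forall>i<n. u i < u (Suc i)"
    \<comment> \<open>A partition of \<open>{a..s}\<close> may stop short of \<open>s\<close>, so
      both \<open>s\<close> and \<open>t\<close> are appended. As \<open>s\<close> may repeat
      \<open>u n\<close>, and \<open>t\<close> may repeat \<open>s\<close>, the result increases
      only weakly.\<close>
    define v where "v i = (if i \<le> n then u i else if i = Suc n then s else t)" for i
    have "(\<Sum>i<n. dist (\<gamma> (u i)) (\<gamma> (u (Suc i)))) = (\<Sum>i<n. dist (\<gamma> (v i)) (\<gamma> (v (Suc i))))"
      by (intro sum.cong) (simp_all add: v_def)
    then have "ereal ((\<Sum>i<n. dist (\<gamma> (u i)) (\<gamma> (u (Suc i)))) + dist (\<gamma> s) (\<gamma> t)) \<le> ereal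
        (\<Sum>i<Suc (Suc n). dist (\<gamma> (v i)) (\<gamma> (v (Suc i))))"
      by (simp add: v_def)
    also have "\<dots> \<le> arclength dist {a..t} \<gamma>"
    proof (rule arclength_upper_weak)
      show "\<forall>i\<le>Suc (Suc n). v i \<in> {a..t}"
        using u(1) assms by (force simp: v_def)
      have "v i \<le> v (Suc i)" if "i < Suc (Suc n)" for i
      proof -
        consider "i < n" | "i = n" | "i = Suc n" using \<open>i < Suc (Suc n)\<close> by force
        then show ?thesis
        proof cases
          case 1
          then show ?thesis using u(2) by (simp add: v_def less_imp_le)
        next
          case 2
          then show ?thesis using u(1) by (simp add: v_def)
        next
          case 3
          then show ?thesis using assms(2) by (simp add: v_def)
        qed
      qed
      then show "\<forall>i<Suc (Suc n). v i \<le> v (Suc i)" by blast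
    qed simp
    finally have "ereal ((\<Sum>i<n. dist (\<gamma> (u i)) (\<gamma> (u (Suc i)))) + dist (\<gamma> s) (\<gamma> t)) \<le>
        arclength dist {a..t} \<gamma>" .
    then show "ereal (\<Sum>i<n. dist (\<gamma> (u i)) (\<gamma> (u (Suc i)))) \<le>
        arclength dist {a..t} \<gamma> - ereal (dist (\<gamma> s) (\<gamma> t))"
      by (cases "arclength dist {a..t} \<gamma>") auto
  qed
  then show ?thesis by (cases "arclength dist {a..t} \<gamma>"; cases "arclength dist {a..s} \<gamma>") auto
qed

lemma arclength_lipschitz_extend:
  fixes \<gamma> :: "real \<Rightarrow> 'b::metric_space"
  assumes "a \<le> s" "s \<le> t"
    and L: "\<And>u v. \<lbrakk>u \<in> {s..t}; v \<in> {s..t}\<rbrakk> \<Longrightarrow> dist (\<gamma> u) (\<gamma> v) \<le> L * \<bar>u - v\<bar>"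
  shows "arclength dist {a..t} \<gamma> \<le> arclength dist {a..s} \<gamma> + ereal (L * (t - s))"
proof (rule arclength_least)
  fix n :: nat and u :: "nat \<Rightarrow> real"
  assume u: "\<forall>i\<le>n. u i \<in> {a..t}" "\<forall>i<n. u i < u (Suc i)"
  \<comment> \<open>Truncation at \<open>s\<close> splits every step: the part in \<open>v\<close>
    runs inside \<open>{a..s}\<close>, the part in \<open>w\<close> obeys the Lipschitz bound and
    telescopes. A step across \<open>s\<close> is split by the triangle inequality.\<close>
  define v where "v i = min (u i) s" for i
  define w where "w i = max (u i) s" for i
  have "(\<Sum>i<n. dist (\<gamma> (u i)) (\<gamma> (u (Suc i)))) \<le>
      (\<Sum>i<n. dist (\<gamma> (v i)) (\<gamma> (v (Suc i))) + L * (w (Suc i) - w i))"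
  proof (rule sum_mono)
    fix i assume "i \<in> {..<n}"
    then have i: "u i < u (Suc i)" "a \<le> u i" "u (Suc i) \<le> t" using u by auto
    consider "u (Suc i) \<le> s" | "s \<le> u i" | "u i < s" "s < u (Suc i)" by linarith
    then show "dist (\<gamma> (u i)) (\<gamma> (u (Suc i))) \<le>
      dist (\<gamma> (v i)) (\<gamma> (v (Suc i))) + L * (w (Suc i) - w i)"
    proof cases
      case 1 then show ?thesis using i by (simp add: v_def w_def)
    next
      case 2 then show ?thesis using i L[of "u i" "u (Suc i)"] by (simp add: v_def w_def)
    next
      case 3
      then show ?thesis
        using i L[of s "u (Suc i)"] dist_triangle[of "\<gamma> (u i)" "\<gamma> (u (Suc i))" "\<gamma> s"]
        by (simp add: v_def w_def)
    qed
  qed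
  also have "\<dots> = (\<Sum>i<n. dist (\<gamma> (v i)) (\<gamma> (v (Suc i)))) + L * (w n - w 0)"
    by (simp add: sum.distrib sum_lessThan_telescope flip: sum_distrib_left)
  also have "L * (w n - w 0) \<le> L * (t - s)"
  proof (cases "s < t")
    case True
    \<comment> \<open>The sign of \<open>L\<close> is not assumed: for \<open>s < t\<close> it
      follows from the Lipschitz bound, and for \<open>s = t\<close> both sides vanish.\<close>
    have "0 \<le> L * \<bar>s - t\<bar>" using L[of s t] assms by (smt (verit) atLeastAtMost_iff zero_le_dist)
    then have "0 \<le> L" using True by (simp add: zero_le_mult_iff)
    moreover have "w n - w 0 \<le> t - s" using u(1) assms(2) by (auto simp: w_def)
    ultimately show ?thesis by (rule mult_left_mono[rotated])
  next
    case False
    then show ?thesis using u(1) assms(2) by (auto simp: w_def max_def)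
  qed
  finally have "ereal (\<Sum>i<n. dist (\<gamma> (u i)) (\<gamma> (u (Suc i)))) \<le>
      ereal (\<Sum>i<n. dist (\<gamma> (v i)) (\<gamma> (v (Suc i)))) + ereal (L * (t - s))" by simp
  also have "ereal (\<Sum>i<n. dist (\<gamma> (v i)) (\<gamma> (v (Suc i)))) \<le> arclength dist {a..s} \<gamma>"
  proof (rule arclength_upper_weak)
    show "\<forall>i\<le>n. v i \<in> {a..s}" using u(1) assms(1) by (simp add: v_def)
    show "\<forall>i<n. v i \<le> v (Suc i)" using u(2) by (auto simp: v_def min_def less_imp_le)
  qed simp
  finally show "ereal (\<Sum>i<n. dist (\<gamma> (u i)) (\<gamma> (u (Suc i)))) \<le>
      arclength dist {a..s} \<gamma> + ereal (L * (t - s))" by (simp add: add_right_mono)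
qed

section \<open>Time reversal\<close>

lemma causal_curve_reflect:
  assumes "causal_curve l I \<gamma>"
  shows "causal_curve (\<lambda>x y. l y x) (uminus ` I) (\<lambda>t. \<gamma> (- t))"
  using assms curve_in_reflect[of UNIV dist I \<gamma>]
  by (auto simp: causal_curve_def causal_le_def)

lemma timelike_curve_reflect:
  assumes "timelike_curve l I \<gamma>"
  shows "timelike_curve (\<lambda>x y. l y x) (uminus ` I) (\<lambda>t. \<gamma> (- t))"
  using assms curve_in_reflect[of UNIV dist I \<gamma>]
  by (auto simp: timelike_curve_def chron_less_def lor_dist_def)

lemma homeomorphism_reflect:
  fixes I J :: "real set"
  assumes "homeomorphism I J \<phi> \<psi>"
  shows "homeomorphism (uminus ` I) (uminus ` J) (\<lambda>s. - \<phi> (- s)) (\<lambda>x. - \<psi> (- x))"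
proof -
  have "continuous_on (uminus ` A) (\<lambda>s. - f (- s))" if "continuous_on A f" for A and f :: "real \<Rightarrow> real"
    by (intro continuous_intros continuous_on_compose2[OF that]) auto
  then show ?thesis using assms by (auto simp: homeomorphism_def image_image)
qed

text \<open>Past and future extendibility share these data and differ only in the side on which the
  additional parameter lies.\<close>

lemma extension_reflect:
  fixes I I' I'' :: "real set" and \<phi> \<psi> :: "real \<Rightarrow> real"
  assumes "is_interval I'" "homeomorphism I I' \<phi> \<psi>" "strict_mono_on I \<phi>"
    and "is_interval I''" "I' \<subseteq> I''" "causal_curve l I'' \<gamma>'" "\<forall>s\<in>I'. \<gamma>' s = \<gamma> (\<psi> s)"
  shows "is_interval (uminus ` I')"
    "homeomorphism (uminus ` I) (uminus ` I') (\<lambda>s. - \<phi> (- s)) (\<lambda>x. - \<psi> (- x))"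
    "strict_mono_on (uminus ` I) (\<lambda>s. - \<phi> (- s))"
    "is_interval (uminus ` I'')" "uminus ` I' \<subseteq> uminus ` I''"
    "causal_curve (\<lambda>x y. l y x) (uminus ` I'') (\<lambda>t. \<gamma>' (- t))"
    "\<forall>s\<in>uminus ` I'. \<gamma>' (- s) = \<gamma> (- (- \<psi> (- s)))"
  using assms homeomorphism_reflect[OF assms(2)] causal_curve_reflect[OF assms(6)]
  by (auto simp: strict_mono_on_def)

lemma future_extendible_reflect:
  assumes "future_extendible l I \<gamma>"
  shows "past_extendible (\<lambda>x y. l y x) (uminus ` I) (\<lambda>t. \<gamma> (- t))"
proof -
  obtain \<phi> \<psi> I' I'' \<gamma>' t where
    *: "is_interval I'" "homeomorphism I I' \<phi> \<psi>" "strict_mono_on I \<phi>"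
      "is_interval I''" "I' \<subseteq> I''" "causal_curve l I'' \<gamma>'" "\<forall>s\<in>I'. \<gamma>' s = \<gamma> (\<psi> s)"
    and t: "t \<in> I''" "\<forall>s\<in>I'. s < t"
    using assms unfolding future_extendible_def by blast
  have "- t \<in> uminus ` I''" "\<forall>s\<in>uminus ` I'. - t < s"
    using t by auto
  then show ?thesis
    unfolding past_extendible_def using extension_reflect[OF *] by blast
qed

lemma past_extendible_reflect:
  assumes "past_extendible l I \<gamma>"
  shows "future_extendible (\<lambda>x y. l y x) (uminus ` I) (\<lambda>t. \<gamma> (- t))"
proof -
  obtain \<phi> \<psi> I' I'' \<gamma>' t where
    *: "is_interval I'" "homeomorphism I I' \<phi> \<psi>" "strict_mono_on I \<phi>"
      "is_interval I''" "I' \<subseteq> I''" "causal_curve l I'' \<gamma>'" "\<forall>s\<in>I'. \<gamma>' s = \<gamma> (\<psi> s)"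
    and t: "t \<in> I''" "\<forall>s\<in>I'. t < s"
    using assms unfolding past_extendible_def by blast
  have "- t \<in> uminus ` I''" "\<forall>s\<in>uminus ` I'. s < - t"
    using t by auto
  then show ?thesis
    unfolding future_extendible_def using extension_reflect[OF *] by blast
qed

section \<open>Inextendible timelike curves\<close>

text \<open>Consequences of the length space axioms in a form invariant under exchange of past and
  future. Irreflexivity of \<open>\<lless>\<close>, the existence of earlier and later points and
  \<open>bounded_arclength\<close> come from the localizing neighbourhoods.\<close>

locale lorentzian_space =
  fixes l :: "'a::metric_space \<Rightarrow> 'a \<Rightarrow> ereal"
  assumes separation: "time_separation_on UNIV l"
    and open_lor_dist: "open {(x, y). c < lor_dist l x y}"
    and chron_irrefl: "\<not> chron_less l x x"
    and ex_future: "\<exists>y. chron_less l x y"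
    and ex_past: "\<exists>y. chron_less l y x"
    and timelike_connected: "chron_less l x y \<Longrightarrow> \<exists>a b \<gamma>. timelike_curve_from_to l a b \<gamma> x y"
    and globally_hyperbolic: "globally_hyperbolic l"
    and bounded_arclength: "\<exists>\<Omega> C. open \<Omega> \<and> x \<in> \<Omega> \<and>
          (\<forall>I \<gamma>. causal_curve l I \<gamma> \<and> \<gamma> ` I \<subseteq> \<Omega> \<longrightarrow> arclength dist I \<gamma> \<le> ereal C)"
begin

abbreviation d :: "'a \<Rightarrow> 'a \<Rightarrow> ereal" where "d \<equiv> lor_dist l"
abbreviation causal (infix "\<preceq>" 50) where "x \<preceq> y \<equiv> causal_le l x y"
abbreviation chron (infix "\<lless>" 50) where "x \<lless> y \<equiv> chron_less l x y"

section \<open>Calculus of \<open>d\<close> and of the causal relations\<close>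

lemma d_nonneg [simp]: "0 \<le> d x y"
  by (simp add: lor_dist_def)

lemma chron_iff: "x \<lless> y \<longleftrightarrow> 0 < d x y"
  by (simp add: chron_less_def)

lemma not_chron_iff: "\<not> x \<lless> y \<longleftrightarrow> d x y = 0"
  using d_nonneg[of x y] unfolding chron_iff by (metis order_le_less order_less_irrefl)

lemma causal_refl [simp]: "x \<preceq> x"
  using separation by (auto simp: time_separation_on_def causal_le_def)

lemma chron_imp_causal: "x \<lless> y \<Longrightarrow> x \<preceq> y"
  by (auto simp: chron_less_def causal_le_def lor_dist_def max_def split: if_splits)

lemma d_causal: "x \<preceq> y \<Longrightarrow> d x y = l x y"
  by (auto simp: causal_le_def lor_dist_def max_def)

lemma l_triangle: "\<lbrakk>x \<preceq> y; y \<preceq> z\<rbrakk> \<Longrightarrow> l x y + l y z \<le> l x z"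
proof -
  assume "x \<preceq> y" "y \<preceq> z"
  then have "l x y \<noteq> - \<infinity>" "l y z \<noteq> - \<infinity>" by (auto simp: causal_le_def)
  moreover have "add_sep (l x y) (l y z) \<le> l x z"
    using separation by (auto simp: time_separation_on_def)
  ultimately show ?thesis by (simp add: add_sep_def)
qed

lemma causal_trans: "\<lbrakk>x \<preceq> y; y \<preceq> z\<rbrakk> \<Longrightarrow> x \<preceq> z"
  using l_triangle[of x y z] order_trans[OF add_nonneg_nonneg]
  unfolding causal_le_def by blast

lemma d_triangle: "\<lbrakk>x \<preceq> y; y \<preceq> z\<rbrakk> \<Longrightarrow> d x y + d y z \<le> d x z"
  using l_triangle[of x y z] causal_trans[of x y z] by (simp add: d_causal)

lemma d_mono_left: "\<lbrakk>x \<preceq> y; y \<preceq> z\<rbrakk> \<Longrightarrow> d y z \<le> d x z"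
  using order_trans[OF add_increasing[OF d_nonneg order_refl] d_triangle[of x y z]] by blast

lemma d_mono_right: "\<lbrakk>x \<preceq> y; y \<preceq> z\<rbrakk> \<Longrightarrow> d x y \<le> d x z"
  using order_trans[OF add_increasing2[OF d_nonneg order_refl] d_triangle[of x y z]] by blast

lemma chron_causal_trans: "\<lbrakk>x \<lless> y; y \<preceq> z\<rbrakk> \<Longrightarrow> x \<lless> z"
  using d_mono_right[of x y z] chron_imp_causal[of x y] by (auto simp: chron_iff)

lemma causal_chron_trans: "\<lbrakk>x \<preceq> y; y \<lless> z\<rbrakk> \<Longrightarrow> x \<lless> z"
  using d_mono_left[of x y z] chron_imp_causal[of y z] by (auto simp: chron_iff)

lemma chron_trans: "\<lbrakk>x \<lless> y; y \<lless> z\<rbrakk> \<Longrightarrow> x \<lless> z"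
  using chron_causal_trans chron_imp_causal by blast

lemma chron_asym: "x \<lless> y \<Longrightarrow> \<not> y \<lless> x"
  using chron_trans chron_irrefl by blast

lemma causal_antisym: "\<lbrakk>x \<preceq> y; y \<preceq> x\<rbrakk> \<Longrightarrow> x = y"
  using globally_hyperbolic by (auto simp: globally_hyperbolic_def)

lemma closed_causal: "closed {(x, y). x \<preceq> y}"
  using globally_hyperbolic by (auto simp: globally_hyperbolic_def)

lemma compact_diamond: "compact K \<Longrightarrow> compact (J_plus l K \<inter> J_minus l K)"
  using globally_hyperbolic by (auto simp: globally_hyperbolic_def)

lemma causal_limit:
  assumes "f \<longlonglongrightarrow> x" "g \<longlonglongrightarrow> y" "eventually (\<lambda>n::nat. f n \<preceq> g n) sequentially"
  shows "x \<preceq> y"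
proof -
  have "(x, y) \<in> {(x, y). x \<preceq> y}"
    by (rule Lim_in_closed_set[OF closed_causal _ trivial_limit_sequentially tendsto_Pair[OF assms(1,2)]])
      (use assms(3) in simp)
  then show ?thesis by simp
qed

lemma open_d_left: "open {x. c < d x y}"
proof -
  have "open ((\<lambda>x. (x, y)) -` {(x, y). c < d x y})"
    by (intro open_vimage open_lor_dist continuous_intros)
  then show ?thesis by (simp add: vimage_def)
qed

lemma open_d_right: "open {x. c < d y x}"
proof -
  have "open ((\<lambda>x. (y, x)) -` {(x, y). c < d x y})"
    by (intro open_vimage open_lor_dist continuous_intros)
  then show ?thesis by (simp add: vimage_def)
qed

text \<open>Allows one-sided arguments to be made for the future and transferred to the
  past.\<close>

lemma dual: "lorentzian_space (\<lambda>x y. l y x)"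
proof
  show "time_separation_on UNIV (\<lambda>x y. l y x)"
  proof -
    have "add_sep a b = add_sep b a" for a b
      by (auto simp: add_sep_def add.commute)
    moreover have "add_sep (l z y) (l y x) \<le> l z x" for x y z
      using separation by (auto simp: time_separation_on_def)
    ultimately have "add_sep (l y x) (l z y) \<le> l z x" for x y z by metis
    then show ?thesis using separation by (simp add: time_separation_on_def)
  qed
  show "open {(x, y). c < lor_dist (\<lambda>x y. l y x) x y}" for c
  proof -
    have "open ((\<lambda>p. (snd p, fst p)) -` {(x, y). c < d x y})"
      by (intro open_vimage open_lor_dist continuous_intros)
    then show ?thesis by (simp add: vimage_def lor_dist_def case_prod_unfold)
  qed
  show "\<not> chron_less (\<lambda>x y. l y x) x x" for x
    using chron_irrefl by (simp add: chron_less_def lor_dist_def)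
  show "\<exists>y. chron_less (\<lambda>x y. l y x) x y" for x
    using ex_past by (simp add: chron_less_def lor_dist_def)
  show "\<exists>y. chron_less (\<lambda>x y. l y x) y x" for x
    using ex_future by (simp add: chron_less_def lor_dist_def)
  show "\<exists>a b \<gamma>. timelike_curve_from_to (\<lambda>x y. l y x) a b \<gamma> x y"
    if "chron_less (\<lambda>x y. l y x) x y" for x y
  proof -
    have "y \<lless> x" using that by (simp add: chron_less_def lor_dist_def)
    then obtain a b \<gamma> where "timelike_curve_from_to l a b \<gamma> y x"
      using timelike_connected by blast
    then have "timelike_curve_from_to (\<lambda>x y. l y x) (- b) (- a) (\<lambda>t. \<gamma> (- t)) x y"
      using timelike_curve_reflect[of l "{a..b}" \<gamma>] by (auto simp: timelike_curve_from_to_def)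
    then show ?thesis by blast
  qed
  have "closed ((\<lambda>p. (snd p, fst p)) -` {(x, y). x \<preceq> y})"
    by (intro closed_vimage closed_causal continuous_intros)
  then have "closed {(x, y). causal_le (\<lambda>x y. l y x) x y}"
    by (simp add: vimage_def causal_le_def case_prod_unfold)
  moreover have "J_plus (\<lambda>x y. l y x) K \<inter> J_minus (\<lambda>x y. l y x) K = J_plus l K \<inter> J_minus l K" for K
    by (auto simp: J_plus_def J_minus_def causal_le_def)
  ultimately show "globally_hyperbolic (\<lambda>x y. l y x)"
    using causal_antisym compact_diamond by (auto simp: globally_hyperbolic_def causal_le_def)
  fix x
  obtain \<Omega> C where \<Omega>: "open \<Omega>" "x \<in> \<Omega>"
    "\<forall>I \<gamma>. causal_curve l I \<gamma> \<and> \<gamma> ` I \<subseteq> \<Omega> \<longrightarrow> arclength dist I \<gamma> \<le> ereal C"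
    using bounded_arclength[of x] by (elim exE conjE)
  have "arclength dist I \<gamma> \<le> ereal C"
    if "causal_curve (\<lambda>x y. l y x) I \<gamma>" "\<gamma> ` I \<subseteq> \<Omega>" for I \<gamma>
  proof -
    have "arclength dist I \<gamma> \<le> arclength dist (uminus ` I) (\<lambda>t. \<gamma> (- t))"
      using arclength_reflect[of "uminus ` I" "\<lambda>t. \<gamma> (- t)"] by (simp add: image_image)
    also have "\<dots> \<le> ereal C"
      using causal_curve_reflect[OF that(1)] that(2) by (intro \<Omega>(3)[rule_format]) auto
    finally show ?thesis .
  qed
  then show "\<exists>\<Omega> C. open \<Omega> \<and> x \<in> \<Omega> \<and>
      (\<forall>I \<gamma>. causal_curve (\<lambda>x y. l y x) I \<gamma> \<and> \<gamma> ` I \<subseteq> \<Omega> \<longrightarrow> arclength dist I \<gamma> \<le> ereal C)"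
    using \<Omega>(1,2) by blast
qed

section \<open>Timelike curves that cannot be prolonged\<close>

lemma causal_curve_if_timelike: "timelike_curve l I \<gamma> \<Longrightarrow> causal_curve l I \<gamma>"
  using chron_imp_causal by (auto simp: timelike_curve_def causal_curve_def)

lemma timelike_curve_continuous_on: "timelike_curve l I \<gamma> \<Longrightarrow> continuous_on I \<gamma>"
  by (simp add: timelike_curve_def curve_in_continuous_on)

lemma causal_curve_mono: "\<lbrakk>causal_curve l I \<gamma>; s \<in> I; t \<in> I; s \<le> t\<rbrakk> \<Longrightarrow> \<gamma> s \<preceq> \<gamma> t"
  by (auto simp: causal_curve_def order_le_less)

lemma timelike_curve_mono: "\<lbrakk>timelike_curve l I \<gamma>; s \<in> I; t \<in> I; s \<le> t\<rbrakk> \<Longrightarrow> \<gamma> s \<preceq> \<gamma> t"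
  using causal_curve_mono causal_curve_if_timelike by blast

text \<open>The normal form in which segments are later glued: a common parameter interval and one
  Lipschitz constant for the whole segment.\<close>

lemma timelike_unit_curve:
  assumes "x \<lless> y"
  obtains c L where "c 0 = x" "c 1 = y" "L-lipschitz_on {0..1::real} c"
    "\<And>s t. \<lbrakk>0 \<le> s; s < t; t \<le> 1\<rbrakk> \<Longrightarrow> c s \<lless> c t"
proof -
  obtain a b \<gamma> where "a < b" and \<gamma>: "timelike_curve l {a..b} \<gamma>" "\<gamma> a = x" "\<gamma> b = y"
    using timelike_connected[OF assms] by (auto simp: timelike_curve_from_to_def)
  obtain L where L: "L-lipschitz_on {a..b} \<gamma>"
    using curve_in_compact_lipschitz[of a b \<gamma>] \<gamma>(1) unfolding timelike_curve_def by blast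
  define h where "h s = a + s * (b - a)" for s
  have h: "h s \<in> {a..b}" if "s \<in> {0..1}" for s
  proof -
    have "s * (b - a) \<le> 1 * (b - a)" "0 \<le> s * (b - a)"
      using that \<open>a < b\<close> by (intro mult_right_mono mult_nonneg_nonneg; simp)+
    then show ?thesis by (simp add: h_def)
  qed
  have "(b - a)-lipschitz_on {0..1} h"
    using \<open>a < b\<close> by (intro lipschitz_onI) (auto simp: h_def dist_real_def abs_mult mult.commute simp flip: left_diff_distrib)
  moreover have "L-lipschitz_on (h ` {0..1}) \<gamma>"
    using lipschitz_on_subset[OF L] h by blast
  ultimately have "(L * (b - a))-lipschitz_on {0..1} (\<lambda>s. \<gamma> (h s))"
    by (rule lipschitz_on_compose2)
  moreover have "\<gamma> (h s) \<lless> \<gamma> (h t)" if "0 \<le> s" "s < t" "t \<le> 1" for s t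
    using \<gamma>(1) h[of s] h[of t] that \<open>a < b\<close> by (auto simp: timelike_curve_def h_def)
  ultimately show thesis
    by (intro that[of "\<lambda>s. \<gamma> (h s)"]) (use \<gamma> in \<open>auto simp: h_def\<close>)
qed

text \<open>\<open>ex_future\<close> yields a point that may be far away; a timelike curve towards
  it stays in \<open>U\<close> for a short while.\<close>

lemma chron_near:
  assumes "open U" "x \<in> U"
  obtains y where "x \<lless> y" "y \<in> U"
proof -
  obtain z where "x \<lless> z" using ex_future by blast
  then obtain c L where c: "c 0 = x" "c 1 = z" "L-lipschitz_on {0..1::real} c"
    "\<And>s t. \<lbrakk>0 \<le> s; s < t; t \<le> 1\<rbrakk> \<Longrightarrow> c s \<lless> c t"
    by (rule timelike_unit_curve) blast
  obtain r where "r > 0" "ball x r \<subseteq> U" using assms open_contains_ball by blast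
  have "continuous_on {0..1} c" using c(3) by (rule lipschitz_on_continuous_on)
  then obtain e where "e > 0" and "\<forall>s\<in>{0..1}. dist s 0 < e \<longrightarrow> dist (c s) (c 0) < r"
    using \<open>r > 0\<close> unfolding continuous_on_iff by (meson atLeastAtMost_iff order_refl zero_le_one)
  then have e: "c s \<in> U" if "s \<in> {0..1}" "dist s 0 < e" for s
  proof -
    have "dist (c s) x < r"
      using that \<open>\<forall>s\<in>{0..1}. dist s 0 < e \<longrightarrow> dist (c s) (c 0) < r\<close> c(1) by simp
    then show ?thesis using \<open>ball x r \<subseteq> U\<close> by (simp add: dist_commute subset_iff)
  qed
  show thesis
    by (rule that[of "c (min 1 (e/2))"]) (use c(1) c(4)[of 0 "min 1 (e/2)"] e \<open>e > 0\<close> in auto)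
qed

text \<open>The distances from \<open>x\<close> to points of its future may be unbounded, and their
  supremum need not be attained. Truncation at 1 makes the supremum finite; it is positive by
  irreflexivity, so some point exceeds half of it.\<close>

lemma greedy_step:
  obtains y where "x \<lless> y" "\<And>y'. x \<lless> y' \<Longrightarrow> min 1 (dist x y') \<le> 2 * min 1 (dist x y)"
proof -
  define R where "R = (\<lambda>y. min 1 (dist x y)) ` {y. x \<lless> y}"
  have bdd: "bdd_above R" unfolding R_def by (intro bdd_aboveI2[of _ _ 1]) auto
  obtain z where z: "x \<lless> z" using ex_future by blast
  then have "x \<noteq> z" using chron_irrefl by blast
  have "min 1 (dist x z) \<le> Sup R" using z bdd by (auto simp: R_def intro: cSup_upper)
  moreover have "min 1 (dist x z) > 0" using \<open>x \<noteq> z\<close> by simp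
  ultimately have "Sup R / 2 < Sup R" by linarith
  moreover have "R \<noteq> {}" using z by (auto simp: R_def)
  ultimately obtain r where "r \<in> R" "Sup R / 2 < r" using less_cSup_iff[OF _ bdd] by blast
  then obtain y where y: "x \<lless> y" "Sup R < 2 * min 1 (dist x y)" by (auto simp: R_def)
  have "min 1 (dist x y') \<le> 2 * min 1 (dist x y)" if "x \<lless> y'" for y'
  proof -
    have "min 1 (dist x y') \<le> Sup R" using that bdd by (auto simp: R_def intro: cSup_upper)
    then show ?thesis using y(2) by linarith
  qed
  then show thesis using that y(1) by blast
qed

text \<open>If the chain of greedy steps converged to \<open>p\<close>, its steps would shrink to 0.
  But any \<open>q\<close> in the future of \<open>p\<close> is also in the future of every
  \<open>z n\<close>, so the distance from \<open>z n\<close> to \<open>q\<close>, truncated at 1,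
  is at most twice the truncated step. In the limit this forces \<open>p = q\<close>.\<close>

lemma ex_divergent_chain:
  obtains z where "z 0 = x" "\<And>n::nat. z n \<lless> z (Suc n)" "\<not> convergent z"
proof -
  define Q where "Q x y \<longleftrightarrow> x \<lless> y \<and>
    (\<forall>y'. x \<lless> y' \<longrightarrow> min 1 (dist x y') \<le> 2 * min 1 (dist x y))" for x y
  have "\<exists>y. Q x y" for x
    by (rule greedy_step[of x]) (auto simp: Q_def)
  then obtain f where f: "\<And>x. Q x (f x)" by metis
  define z where "z n = (f ^^ n) x" for n
  have "Q (z n) (z (Suc n))" for n using f by (simp add: z_def)
  then have z: "\<And>n. z n \<lless> z (Suc n)"
    and greedy: "\<And>n y'. z n \<lless> y' \<Longrightarrow> min 1 (dist (z n) y') \<le> 2 * min 1 (dist (z n) (z (Suc n)))"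
    by (auto simp: Q_def)
  have z0: "z 0 = x" by (simp add: z_def)
  have mono: "z n \<preceq> z m" if "n \<le> m" for n m
    using that by (induction m rule: dec_induct) (use causal_trans chron_imp_causal z in auto)
  have "\<not> z \<longlonglongrightarrow> p" for p
  proof
    assume lim: "z \<longlonglongrightarrow> p"
    obtain q where q: "p \<lless> q" using ex_future by blast
    have "z n \<preceq> p" for n
      by (rule causal_limit[OF tendsto_const lim]) (use mono in \<open>auto intro: eventually_sequentiallyI\<close>)
    then have le: "min 1 (dist (z n) q) \<le> 2 * min 1 (dist (z n) (z (Suc n)))" for n
      using greedy causal_chron_trans q by blast
    have "(\<lambda>n. min 1 (dist (z n) q)) \<longlonglongrightarrow> min 1 (dist p q)"
      by (intro tendsto_intros lim)
    moreover have "(\<lambda>n. 2 * min 1 (dist (z n) (z (Suc n)))) \<longlonglongrightarrow> 2 * min 1 (dist p p)"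
      by (intro tendsto_intros lim LIMSEQ_Suc[OF lim])
    ultimately have "min 1 (dist p q) \<le> 2 * min 1 (dist p p)"
      by (rule LIMSEQ_le) (use le in blast)
    then show False using q chron_irrefl by (auto simp: min_def split: if_splits)
  qed
  then show thesis using that z0 z by (auto simp: convergent_def)
qed

text \<open>The new parameters \<open>\<phi> n\<close> increase and are bounded by \<open>t\<close>,
  so they converge to some \<open>\<beta>\<close> in \<open>I''\<close>, and the extension is
  continuous there. By contraposition, a divergent chain at the integers certifies
  inextendibility.\<close>

lemma future_extendible_imp_convergent:
  assumes "future_extendible l UNIV \<gamma>"
  shows "convergent (\<lambda>n::nat. \<gamma> (real n))"
proof -
  obtain \<phi> \<psi> I' I'' \<gamma>' t where
    *: "homeomorphism UNIV I' \<phi> \<psi>" "strict_mono_on UNIV \<phi>"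
      "is_interval I''" "I' \<subseteq> I''" "causal_curve l I'' \<gamma>'" "\<forall>s\<in>I'. \<gamma>' s = \<gamma> (\<psi> s)"
    and t: "t \<in> I''" "\<forall>s\<in>I'. s < t"
    using assms unfolding future_extendible_def by blast
  have \<phi>I': "\<phi> s \<in> I'" for s using *(1) by (auto simp: homeomorphism_def)
  have inc: "incseq (\<lambda>n. \<phi> (real n))"
    using *(2) by (intro incseq_SucI) (auto simp: strict_mono_on_def less_imp_le)
  obtain \<beta> where \<beta>: "(\<lambda>n. \<phi> (real n)) \<longlonglongrightarrow> \<beta>" "\<forall>n. \<phi> (real n) \<le> \<beta>"
    by (rule incseq_convergent[OF inc, of t]) (use \<phi>I' t(2) in \<open>auto intro: less_imp_le\<close>)
  have "\<beta> \<le> t"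
    by (rule LIMSEQ_le_const2[OF \<beta>(1)]) (use \<phi>I' t(2) in \<open>auto intro: less_imp_le\<close>)
  then have "\<beta> \<in> I''"
    using mem_is_interval_1_I[OF *(3) subsetD[OF *(4) \<phi>I'[of 0]] t(1)] \<beta>(2)[rule_format, of 0]
    by simp
  moreover have "continuous_on I'' \<gamma>'"
    using *(5) by (auto simp: causal_curve_def curve_in_continuous_on)
  moreover have "eventually (\<lambda>n. \<phi> (real n) \<in> I'') sequentially"
    using subsetD[OF *(4) \<phi>I'] by simp
  ultimately have "(\<lambda>n. \<gamma>' (\<phi> (real n))) \<longlonglongrightarrow> \<gamma>' \<beta>"
    by (intro continuous_on_tendsto_compose[OF _ \<beta>(1)])
  moreover have "\<gamma>' (\<phi> (real n)) = \<gamma> (real n)" for n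
    using *(1,6) \<phi>I' by (auto simp: homeomorphism_def)
  ultimately show ?thesis by (auto simp: convergent_def)
qed


text \<open>A divergent chain into the future of \<open>y\<close> and one into the past of
  \<open>x\<close> are joined to a chain indexed by the integers, whose consecutive points are
  linked by unit segments.\<close>

lemma inextendible_timelike_curve_through:
  assumes "x \<lless> y"
  obtains \<gamma> where "timelike_curve l UNIV \<gamma>" "inextendible l UNIV \<gamma>" "\<gamma> 0 = x" "\<gamma> 1 = y"
proof -
  interpret dual: lorentzian_space "\<lambda>x y. l y x" by (rule dual)
  have dual_chron: "dual.chron u v \<longleftrightarrow> v \<lless> u" for u v
    by (simp add: chron_less_def lor_dist_def)
  obtain f where f: "f 0 = y" "\<And>n::nat. f n \<lless> f (Suc n)" "\<not> convergent f"
    by (rule ex_divergent_chain[of y], rule that)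
  obtain g where g: "g 0 = x" "\<And>n::nat. g (Suc n) \<lless> g n" "\<not> convergent g"
    by (rule dual.ex_divergent_chain[of x, unfolded dual_chron], rule that)
  \<comment> \<open>The index 0 is \<open>x = g 0\<close> and the index 1 is \<open>y = f 0\<close>,
    hence the shift on the positive side only.\<close>
  define z :: "int \<Rightarrow> 'a" where "z i = (if i \<ge> 1 then f (nat (i - 1)) else g (nat (- i)))" for i
  have step: "z i \<lless> z (i + 1)" for i
  proof -
    consider "i \<ge> 1" | "i = 0" | "i \<le> -1" by linarith
    then show ?thesis
    proof cases
      case 1
      then have "nat i = Suc (nat (i - 1))" by simp
      then show ?thesis using f(2)[of "nat (i - 1)"] 1 by (simp add: z_def)
    next
      case 2
      then show ?thesis using f(1) g(1) assms by (simp add: z_def)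
    next
      case 3
      then have "nat (- i) = Suc (nat (- (i + 1)))" by simp
      then show ?thesis using g(2)[of "nat (- (i + 1))"] 3 by (simp add: z_def)
    qed
  qed
  have z_mono: "z i \<preceq> z j" if "i \<le> j" for i j
    using that by (induction j rule: int_ge_induct) (use causal_trans chron_imp_causal step in auto)
  have "\<exists>c L. c 0 = z i \<and> c 1 = z (i + 1) \<and> L-lipschitz_on {0..1::real} c \<and>
      (\<forall>s t. 0 \<le> s \<longrightarrow> s < t \<longrightarrow> t \<le> 1 \<longrightarrow> c s \<lless> c t)" for i
    by (rule timelike_unit_curve[OF step[of i]]) blast
  then obtain c L where c: "\<And>i. c i 0 = z i" "\<And>i. c i 1 = z (i + 1)"
    "\<And>i. (L i)-lipschitz_on {0..1::real} (c i)"
    "\<And>i s t. \<lbrakk>0 \<le> s; s < t; t \<le> 1\<rbrakk> \<Longrightarrow> c i s \<lless> c i t"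
    by metis
  define \<gamma> where "\<gamma> t = c \<lfloor>t\<rfloor> (t - real_of_int \<lfloor>t\<rfloor>)" for t
  have \<gamma>_int: "\<gamma> (real_of_int i) = z i" for i by (simp add: \<gamma>_def c(1))
  \<comment> \<open>The floor assigns the right endpoint to the next segment; both segments have the
    same value there, so closed segments may be used.\<close>
  have \<gamma>_seg: "\<gamma> t = c i (t - real_of_int i)" if "t \<in> {real_of_int i..real_of_int i + 1}" for i t
  proof (cases "t = real_of_int i + 1")
    case True
    then show ?thesis using \<gamma>_int[of "i + 1"] c(2) by simp
  next
    case False
    then have "\<lfloor>t\<rfloor> = i" using that by (intro floor_unique) auto
    then show ?thesis by (simp add: \<gamma>_def)
  qed
  have strict: "\<gamma> s \<lless> \<gamma> t" if "real_of_int i \<le> s" "s < t" "t \<le> real_of_int i + 1" for i s t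
    using that c(4)[of "s - real_of_int i" "t - real_of_int i" i] by (simp add: \<gamma>_seg[of _ i])
  have "timelike_curve l UNIV \<gamma>"
    unfolding timelike_curve_def
  proof (intro conjI ballI impI curve_in_lipschitzI)
    fix s t :: real assume "s < t"
    show "\<gamma> s \<lless> \<gamma> t"
    proof (cases "\<lfloor>s\<rfloor> = \<lfloor>t\<rfloor>")
      case True
      have "real_of_int \<lfloor>s\<rfloor> \<le> s" by simp
      moreover have "t \<le> real_of_int \<lfloor>s\<rfloor> + 1" unfolding True by linarith
      ultimately show ?thesis using strict \<open>s < t\<close> by blast
    next
      case False
      then have "\<lfloor>s\<rfloor> + 1 \<le> \<lfloor>t\<rfloor>" using floor_mono[of s t] \<open>s < t\<close> by linarith
      have "\<gamma> s \<lless> \<gamma> (real_of_int \<lfloor>s\<rfloor> + 1)"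
        by (rule strict[of "\<lfloor>s\<rfloor>"]) linarith+
      then have "\<gamma> s \<lless> z (\<lfloor>s\<rfloor> + 1)" using \<gamma>_int[of "\<lfloor>s\<rfloor> + 1"] by simp
      then have "\<gamma> s \<lless> z \<lfloor>t\<rfloor>"
        using z_mono[OF \<open>\<lfloor>s\<rfloor> + 1 \<le> \<lfloor>t\<rfloor>\<close>] by (rule chron_causal_trans)
      moreover have "z \<lfloor>t\<rfloor> \<preceq> \<gamma> t"
      proof (cases "t = real_of_int \<lfloor>t\<rfloor>")
        case True
        then show ?thesis using \<gamma>_int[of "\<lfloor>t\<rfloor>"] by (metis causal_refl)
      next
        case False
        then have "\<gamma> (real_of_int \<lfloor>t\<rfloor>) \<lless> \<gamma> t"
          by (intro strict[of "\<lfloor>t\<rfloor>"]) linarith+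
        then show ?thesis by (simp add: \<gamma>_int chron_imp_causal)
      qed
      ultimately show ?thesis by (rule chron_causal_trans)
    qed
  next
    fix t :: real
    define i where "i = \<lfloor>t\<rfloor>"
    \<comment> \<open>Three consecutive segments cover the ball of radius 1 about \<open>t\<close>,
      and the largest of their constants is valid on their union.\<close>
    define I where "I = {i - 1, i, i + 1}"
    define M where "M = Max (L ` I)"
    have M: "L j \<le> M" if "j \<in> I" for j
      using that by (auto simp: M_def I_def)
    have Lip: "M-lipschitz_on {real_of_int j..real_of_int j + 1} \<gamma>" if "j \<in> I" for j
    proof (rule lipschitz_on_mono[OF _ order_refl M[OF that]], rule lipschitz_onI)
      fix s u assume su: "s \<in> {real_of_int j..real_of_int j + 1}" "u \<in> {real_of_int j..real_of_int j + 1}"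
      have "dist (c j (s - real_of_int j)) (c j (u - real_of_int j)) \<le>
          L j * dist (s - real_of_int j) (u - real_of_int j)"
        by (rule lipschitz_onD[OF c(3)]) (use su in auto)
      then show "dist (\<gamma> s) (\<gamma> u) \<le> L j * dist s u"
        using su by (simp add: \<gamma>_seg[of _ j] dist_real_def)
    next
      show "0 \<le> L j" using c(3) by (rule lipschitz_on_nonneg)
    qed
    have "M-lipschitz_on {real_of_int i - 1..real_of_int i + 2} \<gamma>"
    proof (rule lipschitz_on_closed_Union[where I=I and U="\<lambda>j. {real_of_int j..real_of_int j + 1}"])
      show "0 \<le> M" using Lip[of i] by (auto simp: I_def intro: lipschitz_on_nonneg)
      show "{real_of_int i - 1..real_of_int i + 2} \<subseteq> (\<Union>j\<in>I. {real_of_int j..real_of_int j + 1})"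
        by (auto simp: I_def)
    qed (use Lip in \<open>auto simp: I_def\<close>)
    moreover have "UNIV \<inter> ball t 1 \<subseteq> {real_of_int i - 1..real_of_int i + 2}"
    proof
      fix s assume "s \<in> UNIV \<inter> ball t 1"
      then have "\<bar>t - s\<bar> < 1" by (simp add: dist_real_def)
      then show "s \<in> {real_of_int i - 1..real_of_int i + 2}"
        unfolding i_def atLeastAtMost_iff by linarith
    qed
    ultimately have "M-lipschitz_on (UNIV \<inter> ball t 1) \<gamma>" by (rule lipschitz_on_subset)
    then show "\<exists>e>0. \<exists>C. C-lipschitz_on (UNIV \<inter> ball t e) \<gamma>" by (intro exI[of _ 1]) auto
  qed auto
  moreover have "\<not> future_extendible l UNIV \<gamma>"
  proof
    assume "future_extendible l UNIV \<gamma>"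
    then have "convergent (\<lambda>n. \<gamma> (real (Suc n)))"
      using future_extendible_imp_convergent convergent_Suc_iff[of "\<lambda>n. \<gamma> (real n)"] by simp
    moreover have "\<gamma> (real (Suc n)) = f n" for n
      using \<gamma>_int[of "int (Suc n)"] by (simp add: z_def)
    ultimately show False using f(3) by simp
  qed
  moreover have "\<not> past_extendible l UNIV \<gamma>"
  proof
    assume "past_extendible l UNIV \<gamma>"
    then have "future_extendible (\<lambda>x y. l y x) UNIV (\<lambda>t. \<gamma> (- t))"
      using past_extendible_reflect[of l UNIV \<gamma>] by simp
    then have "convergent (\<lambda>n. \<gamma> (- real n))"
      by (rule dual.future_extendible_imp_convergent)
    moreover have "\<gamma> (- real n) = g n" for n
      using \<gamma>_int[of "- int n"] by (simp add: z_def)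
    ultimately show False using g(3) by simp
  qed
  moreover have "\<gamma> 0 = x" "\<gamma> 1 = y"
    using \<gamma>_int[of 0] \<gamma>_int[of 1] f(1) g(1) by (simp_all add: z_def)
  ultimately show thesis using that by (simp add: inextendible_def)
qed

section \<open>Sufficient conditions for extendibility\<close>

lemma future_extendible_if_max:
  assumes \<gamma>: "causal_curve l I \<gamma>" and b: "b \<in> I" "\<And>s. s \<in> I \<Longrightarrow> s \<le> b"
  shows "future_extendible l I \<gamma>"
proof -
  define I'' where "I'' = I \<union> {b..b + 1}"
  have I: "is_interval I" using \<gamma> by (auto simp: causal_curve_def curve_in_def)
  have min_I: "min s b \<in> I" if "s \<in> I''" for s
    using that b by (auto simp: I''_def min_def)
  have I'': "is_interval I''"
    unfolding is_interval_1
  proof (intro ballI allI impI)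
    fix x y z assume "x \<in> I''" "y \<in> I''" "x \<le> z \<and> z \<le> y"
    then have "x \<le> z" "z \<le> y" by auto
    show "z \<in> I''"
    proof (cases "z \<le> b")
      case True
      then have "z \<in> I"
        using \<open>x \<le> z\<close> by (intro mem_is_interval_1_I[OF I min_I[OF \<open>x \<in> I''\<close>] b(1)]) auto
      then show ?thesis by (simp add: I''_def)
    next
      case False
      then show ?thesis using \<open>y \<in> I''\<close> \<open>z \<le> y\<close> b(2)[of y] by (auto simp: I''_def)
    qed
  qed
  \<comment> \<open>The curve is continued by waiting at its endpoint: causal curves may be constant
    because \<open>\<preceq>\<close> is reflexive. The extension is required to be causal only, even
    for a timelike curve.\<close>
  have "causal_curve l I'' (\<lambda>t. \<gamma> (min t b))"
    unfolding causal_curve_def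
  proof (intro conjI ballI impI curve_inI)
    fix t assume "t \<in> I''"
    obtain e C where "0 < e"
      and *: "\<And>s u. \<lbrakk>s \<in> I; u \<in> I; \<bar>s - min t b\<bar> < e; \<bar>u - min t b\<bar> < e\<rbrakk> \<Longrightarrow>
        dist (\<gamma> s) (\<gamma> u) \<le> C * \<bar>s - u\<bar>"
      using curve_inD[of UNIV dist I \<gamma>] \<gamma> min_I[OF \<open>t \<in> I''\<close>] unfolding causal_curve_def by blast
    have "dist (\<gamma> (min s b)) (\<gamma> (min u b)) \<le> \<bar>C\<bar> * \<bar>s - u\<bar>"
      if "s \<in> I''" "u \<in> I''" "\<bar>s - t\<bar> < e" "\<bar>u - t\<bar> < e" for s u
    proof -
      have "dist (\<gamma> (min s b)) (\<gamma> (min u b)) \<le> C * \<bar>min s b - min u b\<bar>"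
        by (rule *[OF min_I[OF that(1)] min_I[OF that(2)]]) (use that in \<open>auto simp: min_def\<close>)
      also have "\<dots> \<le> \<bar>C\<bar> * \<bar>s - u\<bar>"
        by (intro mult_mono) (auto simp: min_def)
      finally show ?thesis .
    qed
    then show "\<exists>e>0. \<exists>C. \<forall>s\<in>I''. \<forall>u\<in>I''. \<bar>s - t\<bar> < e \<longrightarrow> \<bar>u - t\<bar> < e \<longrightarrow>
        dist (\<gamma> (min s b)) (\<gamma> (min u b)) \<le> C * \<bar>s - u\<bar>"
      using \<open>0 < e\<close> by blast
  next
    fix t s assume "t \<in> I''" "s \<in> I''" "t < s"
    then show "\<gamma> (min t b) \<preceq> \<gamma> (min s b)"
      by (intro causal_curve_mono[OF \<gamma>] min_I) auto
  qed (use I'' in \<open>auto simp: I''_def\<close>)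
  moreover have "homeomorphism I I id id" by (simp add: homeomorphism_def)
  moreover have "strict_mono_on I (id :: real \<Rightarrow> real)" by (simp add: strict_mono_on_def)
  moreover have "I \<subseteq> I''" by (simp add: I''_def)
  moreover have "b + 1 \<in> I''" "\<forall>s\<in>I. s < b + 1" using b(2) by (force simp: I''_def)+
  moreover have "\<forall>s\<in>I. \<gamma> (min s b) = \<gamma> (id s)" using b(2) by (simp add: min_absorb1)
  ultimately show ?thesis
    unfolding future_extendible_def using I I'' by blast
qed

text \<open>A form of strong causality inside a compact set. If it failed for all small
  \<open>r\<close>, points of \<open>K - \<Omega>\<close> between points tending to \<open>p\<close>
  would accumulate at some \<open>q\<close> outside \<open>\<Omega>\<close> with
  \<open>p \<preceq> q\<close> and \<open>q \<preceq> p\<close>, against antisymmetry.\<close>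

lemma locally_order_convex:
  assumes "compact K" "open \<Omega>" "p \<in> \<Omega>"
  obtains r where "r > 0"
    "\<And>x y z. \<lbrakk>x \<preceq> y; y \<preceq> z; dist x p \<le> r; dist z p \<le> r; y \<in> K\<rbrakk> \<Longrightarrow> y \<in> \<Omega>"
proof (rule ccontr)
  assume "\<not> thesis"
  then have "\<exists>x y z. x \<preceq> y \<and> y \<preceq> z \<and> dist x p \<le> 1 / Suc n \<and> dist z p \<le> 1 / Suc n \<and>
      y \<in> K - \<Omega>" for n
    using that[of "1 / Suc n"] by (metis DiffI of_nat_0_less_iff zero_less_Suc zero_less_divide_1_iff)
  then obtain x y z where xyz: "\<And>n. x n \<preceq> y n" "\<And>n. y n \<preceq> z n"
    "\<And>n. dist (x n) p \<le> 1 / Suc n" "\<And>n. dist (z n) p \<le> 1 / Suc n" "\<And>n. y n \<in> K - \<Omega>"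
    by metis
  have "compact (K - \<Omega>)" using assms by (intro compact_diff)
  then obtain q r where q: "q \<in> K - \<Omega>" "strict_mono r" "(y \<circ> r) \<longlonglongrightarrow> q"
    using xyz(5) unfolding compact_def by blast
  have lim: "w \<longlonglongrightarrow> p" if "\<And>n. dist (w n) p \<le> 1 / Suc n" for w :: "nat \<Rightarrow> 'a"
    by (rule metric_tendsto_imp_tendsto[OF LIMSEQ_inverse_real_of_nat])
      (use that in \<open>simp add: inverse_eq_divide\<close>)
  have "(x \<circ> r) \<longlonglongrightarrow> p" "(z \<circ> r) \<longlonglongrightarrow> p"
    using lim[of x] lim[of z] xyz q(2) by (auto intro: LIMSEQ_subseq_LIMSEQ)
  then have "p \<preceq> q" "q \<preceq> p"
    using causal_limit[of "x \<circ> r" p "y \<circ> r" q] causal_limit[of "y \<circ> r" q "z \<circ> r" p] q(3) xyz(1,2)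
    by auto
  then have "p = q" by (rule causal_antisym)
  then show False using q(1) assms(3) by simp
qed


text \<open>Near the limit point the curve has finite arclength; parametrizing it there by arclength makes
  it Lipschitz up to and including the limit point.\<close>

lemma future_extendible_if_convergent:
  fixes t :: "nat \<Rightarrow> real"
  assumes \<gamma>: "timelike_curve l I \<gamma>" and tI: "\<And>k. t k \<in> I" and t: "incseq t"
    and cofinal: "\<And>s. s \<in> I \<Longrightarrow> \<exists>k. s < t k" and lim: "(\<lambda>k. \<gamma> (t k)) \<longlonglongrightarrow> p"
  shows "future_extendible l I \<gamma>"
proof -
  have curve: "curve_in UNIV dist I \<gamma>" and I: "is_interval I"
    using \<gamma> by (auto simp: timelike_curve_def curve_in_def)
  have mono: "\<gamma> s \<preceq> \<gamma> u" if "s \<in> I" "u \<in> I" "s \<le> u" for s u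
    using timelike_curve_mono[OF \<gamma>] that by blast
  have ev: "eventually (\<lambda>k. s \<le> t k) sequentially" if s: "s \<in> I" for s
  proof -
    obtain k where "s < t k" using cofinal[OF s] by blast
    then show ?thesis
      by (intro eventually_sequentiallyI[of k]) (use t in \<open>force dest: incseqD\<close>)
  qed
  have le_p: "\<gamma> s \<preceq> p" if s: "s \<in> I" for s
    by (rule causal_limit[OF tendsto_const lim])
      (use mono[OF s tI] in \<open>auto intro: eventually_mono[OF ev[OF s]]\<close>)
  obtain \<Omega> C where \<Omega>: "open \<Omega>" "p \<in> \<Omega>"
    and C: "\<forall>I \<gamma>. causal_curve l I \<gamma> \<and> \<gamma> ` I \<subseteq> \<Omega> \<longrightarrow> arclength dist I \<gamma> \<le> ereal C"
    using bounded_arclength[of p] by (elim exE conjE)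
  \<comment> \<open>All points of the curve after \<open>\<gamma> (t 0)\<close> lie between it and
    \<open>p\<close>. Global hyperbolicity takes future and past of one compact set, here of the
    pair.\<close>
  define K where "K = J_plus l {\<gamma> (t 0), p} \<inter> J_minus l {\<gamma> (t 0), p}"
  have K: "compact K" unfolding K_def by (rule compact_diamond) simp
  obtain r where r: "r > 0"
    "\<And>x y z. \<lbrakk>x \<preceq> y; y \<preceq> z; dist x p \<le> r; dist z p \<le> r; y \<in> K\<rbrakk> \<Longrightarrow> y \<in> \<Omega>"
    by (rule locally_order_convex[OF K \<Omega>], rule that)
  have "eventually (\<lambda>k. dist (\<gamma> (t k)) p < r) sequentially"
    using lim \<open>r > 0\<close> by (rule tendstoD)
  then obtain k where k: "dist (\<gamma> (t k)) p < r"
    using eventually_happens trivial_limit_sequentially by blast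
  define a where "a = t k"
  have a: "a \<in> I" by (simp add: a_def tI)
  define Ia where "Ia = I \<inter> {a..}"
  have Ia: "is_interval Ia" "a \<in> Ia" "Ia \<subseteq> I"
    unfolding Ia_def using I a by (simp_all add: is_interval_Int is_interval_ci)
  have in_\<Omega>: "\<gamma> s \<in> \<Omega>" if "s \<in> Ia" for s
  proof (rule r(2))
    have s: "s \<in> I" "a \<le> s" using that by (auto simp: Ia_def)
    show "\<gamma> a \<preceq> \<gamma> s" "\<gamma> s \<preceq> p" using mono le_p a s by auto
    show "dist (\<gamma> a) p \<le> r" "dist p p \<le> r" using k \<open>r > 0\<close> by (auto simp: a_def)
    have "\<gamma> (t 0) \<preceq> \<gamma> s"
      using mono[OF tI[of 0] \<open>s \<in> I\<close>] incseqD[OF t, of 0 k] s(2) by (simp add: a_def)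
    then show "\<gamma> s \<in> K" using \<open>\<gamma> s \<preceq> p\<close> by (auto simp: K_def J_plus_def J_minus_def)
  qed
  have "causal_curve l Ia \<gamma>"
    using curve_in_subset[OF curve Ia(3) _ Ia(1)] Ia(2) mono[OF subsetD[OF Ia(3)] subsetD[OF Ia(3)]]
    unfolding causal_curve_def by (metis empty_iff less_imp_le)
  then have length_C: "arclength dist Ia \<gamma> \<le> ereal C"
    using C in_\<Omega> by (metis image_subsetI)
  define W where "W s = real_of_ereal (arclength dist {a..s} \<gamma>)" for s
  have seg_Ia: "{a..s} \<subseteq> Ia" if "s \<in> Ia" for s
    using mem_is_interval_1_I[OF Ia(1) Ia(2) that] by auto
  have W: "arclength dist {a..s} \<gamma> = ereal (W s)" and W_C: "W s \<le> C" if "s \<in> Ia" for s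
  proof -
    have "0 \<le> arclength dist {a..s} \<gamma>" using that by (intro arclength_nonneg) (auto simp: Ia_def)
    moreover have "arclength dist {a..s} \<gamma> \<le> ereal C"
      using arclength_mono_set[OF seg_Ia[OF that]] length_C by (rule order_trans)
    ultimately show "arclength dist {a..s} \<gamma> = ereal (W s)" "W s \<le> C"
      by (cases "arclength dist {a..s} \<gamma>"; auto simp: W_def)+
  qed
  have W_dist: "W s + dist (\<gamma> s) (\<gamma> u) \<le> W u" if "s \<in> Ia" "u \<in> Ia" "s \<le> u" for s u
    using arclength_append[of a s u \<gamma>] that W by (simp add: Ia_def)
  have "curve_in UNIV dist Ia W"
  proof (rule curve_inI)
    fix s0 assume "s0 \<in> Ia"
    then have "s0 \<in> I" using Ia by blast
    obtain e L where "0 < e"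
      and L: "\<And>s u. \<lbrakk>s \<in> I; u \<in> I; \<bar>s - s0\<bar> < e; \<bar>u - s0\<bar> < e\<rbrakk> \<Longrightarrow> dist (\<gamma> s) (\<gamma> u) \<le> L * \<bar>s - u\<bar>"
      by (rule curve_inD[OF curve \<open>s0 \<in> I\<close>], rule that)
    have W_Lip: "dist (W s) (W u) \<le> L * \<bar>s - u\<bar>"
      if "s \<in> Ia" "u \<in> Ia" "\<bar>s - s0\<bar> < e" "\<bar>u - s0\<bar> < e" "s \<le> u" for s u
    proof -
      have "dist (\<gamma> v) (\<gamma> w) \<le> L * \<bar>v - w\<bar>" if "v \<in> {s..u}" "w \<in> {s..u}" for v w
      proof (rule L)
        show "v \<in> I" "w \<in> I"
          using that
            mem_is_interval_1_I[OF I subsetD[OF Ia(3) \<open>s \<in> Ia\<close>] subsetD[OF Ia(3) \<open>u \<in> Ia\<close>]]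
          by simp_all
      qed (use that \<open>\<bar>s - s0\<bar> < e\<close> \<open>\<bar>u - s0\<bar> < e\<close> in \<open>auto simp: abs_less_iff\<close>)
      then have "arclength dist {a..u} \<gamma> \<le> arclength dist {a..s} \<gamma> + ereal (L * (u - s))"
        using that by (intro arclength_lipschitz_extend) (auto simp: Ia_def)
      then have "W u \<le> W s + L * (u - s)" using W that by simp
      moreover have "W s \<le> W u" using W_dist[of s u] that zero_le_dist[of "\<gamma> s" "\<gamma> u"] by linarith
      ultimately show ?thesis using that by (simp add: dist_real_def)
    qed
    have "dist (W s) (W u) \<le> L * \<bar>s - u\<bar>"
      if "s \<in> Ia" "u \<in> Ia" "\<bar>s - s0\<bar> < e" "\<bar>u - s0\<bar> < e" for s u
      using W_Lip[of s u] W_Lip[of u s] that by (cases "s \<le> u") (auto simp: dist_real_def)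
    then show "\<exists>e>0. \<exists>C. \<forall>s\<in>Ia. \<forall>u\<in>Ia. \<bar>s - s0\<bar> < e \<longrightarrow> \<bar>u - s0\<bar> < e \<longrightarrow>
        dist (W s) (W u) \<le> C * \<bar>s - u\<bar>"
      using \<open>0 < e\<close> by blast
  qed (use Ia in auto)
  then have W_cont: "continuous_on Ia W" by (rule curve_in_continuous_on)

  \<comment> \<open>The old parameter is kept up to \<open>a\<close> and replaced by arclength
    beyond it. The two pieces agree at \<open>a\<close>, whatever the value
    \<open>W a\<close>.\<close>
  define \<phi> where "\<phi> s = min s a + W (max s a)" for s
  have max_Ia: "max s a \<in> Ia" if "s \<in> I" for s using that a by (auto simp: Ia_def max_def)
  have \<phi>_below: "\<phi> u - \<phi> s = u - s" if "u \<le> a" "s \<le> a" for s u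
    using that by (simp add: \<phi>_def max_absorb2 min_absorb1)
  have \<phi>_above: "dist (\<gamma> s) (\<gamma> u) \<le> \<phi> u - \<phi> s" if "s \<in> I" "u \<in> I" "a \<le> s" "s \<le> u" for s u
    using W_dist[of s u] that by (simp add: \<phi>_def Ia_def max_absorb1 min_absorb2)
  have \<phi>_less: "\<phi> s < \<phi> u" if "s \<in> I" "u \<in> I" "s < u" for s u
  proof -
    have pos: "\<phi> v < \<phi> w" if "v \<in> I" "w \<in> I" "a \<le> v" "v < w" for v w
    proof -
      have "\<gamma> v \<lless> \<gamma> w" using \<gamma> that by (auto simp: timelike_curve_def)
      then have "\<gamma> v \<noteq> \<gamma> w" using chron_irrefl by metis
      then have "0 < dist (\<gamma> v) (\<gamma> w)" by simp
      also have "\<dots> \<le> \<phi> w - \<phi> v" using \<phi>_above that by simp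
      finally show ?thesis by simp
    qed
    consider "u \<le> a" | "a \<le> s" | "s < a" "a < u" by linarith
    then show ?thesis
    proof cases
      case 1
      then show ?thesis using \<phi>_below[of u s] \<open>s < u\<close> by simp
    next
      case 2
      then show ?thesis using pos that by blast
    next
      case 3
      then show ?thesis using \<phi>_below[of a s] pos[of a u] a that by simp
    qed
  qed
  have \<phi>_le: "\<phi> s \<le> \<phi> u" if "s \<in> I" "u \<in> I" "s \<le> u" for s u
    using \<phi>_less[of s u] that by (cases "s = u") auto
  have \<phi>_mono: "strict_mono_on I \<phi>" using \<phi>_less by (simp add: strict_mono_on_def)
  have "continuous_on I (\<lambda>s. W (max s a))"
    by (rule continuous_on_compose2[OF W_cont]) (use max_Ia in \<open>auto intro!: continuous_intros\<close>)
  then have \<phi>_cont: "continuous_on I \<phi>"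
    unfolding \<phi>_def by (intro continuous_intros)
  define I' where "I' = \<phi> ` I"
  obtain \<psi> where hom: "homeomorphism I I' \<phi> \<psi>"
    using homeomorphism_into_1d[OF _ \<phi>_cont] I strict_mono_on_imp_inj_on[OF \<phi>_mono]
    by (auto simp: is_interval_path_connected_1 I'_def)
  have \<psi>\<phi>: "\<psi> (\<phi> s) = s" if "s \<in> I" for s using hom that by (simp add: homeomorphism_def)
  have \<psi>I: "\<psi> x \<in> I" and \<phi>\<psi>: "\<phi> (\<psi> x) = x" if "x \<in> I'" for x
    using hom that by (auto simp: homeomorphism_def)
  have \<psi>_le: "\<psi> x \<le> \<psi> y" if "x \<in> I'" "y \<in> I'" "x \<le> y" for x y
    using \<phi>_less[OF \<psi>I[OF that(2)] \<psi>I[OF that(1)]] \<phi>\<psi> that by force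
  have \<psi>_cont: "continuous_on I' \<psi>" using hom by (simp add: homeomorphism_def)
  have I': "is_interval I'"
    using connected_continuous_image[OF \<phi>_cont] I by (simp add: I'_def is_interval_connected_1)
  have bdd: "bdd_above I'"
  proof (rule bdd_aboveI)
    fix x assume "x \<in> I'"
    then obtain s where "s \<in> I" "x = \<phi> s" by (auto simp: I'_def)
    then show "x \<le> a + C" using W_C[OF max_Ia] by (simp add: \<phi>_def add_mono)
  qed
  \<comment> \<open>Finite because the arclength is at most \<open>C\<close>, and not attained
    because the parameters \<open>t k\<close> are cofinal in \<open>I\<close>. It becomes the
    parameter of \<open>p\<close>.\<close>
  define \<beta> where "\<beta> = Sup I'"
  have I'_ne: "I' \<noteq> {}" using a by (auto simp: I'_def)
  have less_\<beta>: "\<phi> s < \<beta>" if "s \<in> I" for s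
  proof -
    obtain k where "s < t k" using cofinal[OF \<open>s \<in> I\<close>] by blast
    then have "\<phi> s < \<phi> (t k)" using \<phi>_less that tI by blast
    also have "\<dots> \<le> \<beta>" unfolding \<beta>_def using tI by (intro cSup_upper bdd) (auto simp: I'_def)
    finally show ?thesis .
  qed
  then have I'_less: "x < \<beta>" if "x \<in> I'" for x using that by (auto simp: I'_def)
  \<comment> \<open>The Lipschitz bound of the arclength parameter passes to the limit along
    \<open>t k\<close>.\<close>
  have dist_p: "dist (\<gamma> s) p \<le> \<beta> - \<phi> s" if s: "s \<in> I" "a \<le> s" for s
  proof (rule LIMSEQ_le_const2)
    show "(\<lambda>k. dist (\<gamma> s) (\<gamma> (t k))) \<longlonglongrightarrow> dist (\<gamma> s) p" by (intro tendsto_intros lim)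
    have "dist (\<gamma> s) (\<gamma> (t k)) \<le> \<beta> - \<phi> s" if "s \<le> t k" for k
      using \<phi>_above[OF s(1) tI s(2) that] less_\<beta>[OF tI[of k]] by linarith
    then show "\<exists>N. \<forall>k\<ge>N. dist (\<gamma> s) (\<gamma> (t k)) \<le> \<beta> - \<phi> s"
      using ev[OF s(1)] by (auto simp: eventually_sequentially)
  qed
  define I'' where "I'' = insert \<beta> I'"
  have I'': "is_interval I''"
    unfolding is_interval_1
  proof (intro ballI allI impI)
    fix x y z assume "x \<in> I''" "y \<in> I''" "x \<le> z \<and> z \<le> y"
    then have xyz: "x \<in> I''" "y \<in> I''" "x \<le> z" "z \<le> y" by auto
    show "z \<in> I''"
    proof (cases "z < \<beta>")
      case True
      then obtain w where "w \<in> I'" "z < w" unfolding \<beta>_def using less_cSup_iff[OF I'_ne bdd] by blast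
      moreover have "x \<in> I'" using xyz True by (auto simp: I''_def)
      ultimately have "z \<in> I'" using xyz(3) by (intro mem_is_interval_1_I[OF I', of x w z]) auto
      then show ?thesis by (simp add: I''_def)
    next
      case False
      then have "z = \<beta>" using xyz(2,4) I'_less[of y] by (auto simp: I''_def)
      then show ?thesis by (simp add: I''_def)
    qed
  qed
  define \<gamma>' where "\<gamma>' x = (if x \<in> I' then \<gamma> (\<psi> x) else p)" for x
  have \<gamma>'\<beta>: "\<gamma>' \<beta> = p" using I'_less by (auto simp: \<gamma>'_def)
  have near_\<beta>: "dist (\<gamma>' x) (\<gamma>' y) \<le> 1 * \<bar>x - y\<bar>"
    if "x \<in> I''" "y \<in> I''" "\<bar>x - \<beta>\<bar> < \<beta> - \<phi> a" "\<bar>y - \<beta>\<bar> < \<beta> - \<phi> a" for x y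
    using that
  proof (induction x y rule: linorder_wlog)
    case (le x y)
    show ?case
    proof (cases "x = \<beta>")
      case True
      then show ?thesis using le I'_less[of y] by (auto simp: I''_def)
    next
      case False
      then have x: "x \<in> I'" using le by (auto simp: I''_def)
      have "\<phi> a < x" using le by linarith
      then have "a \<le> \<psi> x"
        using \<phi>_le[OF \<psi>I[OF x] a] \<phi>\<psi>[OF x] by linarith
      show ?thesis
      proof (cases "y = \<beta>")
        case True
        moreover have "\<gamma>' x = \<gamma> (\<psi> x)" using x by (simp add: \<gamma>'_def)
        ultimately show ?thesis
          using dist_p[OF \<psi>I[OF x] \<open>a \<le> \<psi> x\<close>] \<phi>\<psi>[OF x] le(1) by (simp add: \<gamma>'\<beta>)
      next
        case False
        then have y: "y \<in> I'" using le by (auto simp: I''_def)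
        show ?thesis
          using \<phi>_above[OF \<psi>I[OF x] \<psi>I[OF y] \<open>a \<le> \<psi> x\<close> \<psi>_le[OF x y le(1)]] \<phi>\<psi> x y le(1)
          by (simp add: \<gamma>'_def)
      qed
    qed
  next
    case (sym x y)
    then show ?case by (simp add: dist_commute abs_minus_commute)
  qed
  have near_I': "\<exists>e>0. \<exists>C. \<forall>x\<in>I''. \<forall>y\<in>I''. \<bar>x - x0\<bar> < e \<longrightarrow> \<bar>y - x0\<bar> < e \<longrightarrow>
      dist (\<gamma>' x) (\<gamma>' y) \<le> C * \<bar>x - y\<bar>" if x0: "x0 \<in> I'" for x0
  proof -
    define s0 where "s0 = \<psi> x0"
    have "s0 \<in> I" using \<psi>I x0 by (simp add: s0_def)
    obtain e L where "0 < e"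
      and L: "\<And>s u. \<lbrakk>s \<in> I; u \<in> I; \<bar>s - s0\<bar> < e; \<bar>u - s0\<bar> < e\<rbrakk> \<Longrightarrow> dist (\<gamma> s) (\<gamma> u) \<le> L * \<bar>s - u\<bar>"
      by (rule curve_inD[OF curve \<open>s0 \<in> I\<close>], rule that)
    obtain \<epsilon> where "\<epsilon> > 0" and \<epsilon>: "\<forall>x\<in>I'. dist x x0 < \<epsilon> \<longrightarrow> dist (\<psi> x) s0 < e"
      using \<psi>_cont x0 \<open>0 < e\<close> unfolding continuous_on_iff s0_def by meson
    \<comment> \<open>Serves both sides of \<open>a\<close>: \<open>\<bar>L\<bar>\<close> comes from
      the original parameter, 1 from the arclength parameter. An interval containing
      \<open>a\<close> is split there.\<close>
    define M where "M = max 1 \<bar>L\<bar>"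
    have below: "dist (\<gamma> s) (\<gamma> u) \<le> M * (\<phi> u - \<phi> s)"
      if "s \<in> I" "u \<in> I" "\<bar>s - s0\<bar> < e" "\<bar>u - s0\<bar> < e" "s \<le> u" "u \<le> a" for s u
    proof -
      have "dist (\<gamma> s) (\<gamma> u) \<le> L * \<bar>s - u\<bar>" using L that by blast
      also have "\<dots> \<le> M * \<bar>s - u\<bar>" by (intro mult_right_mono) (auto simp: M_def)
      finally show ?thesis using that \<phi>_below[of u s] by simp
    qed
    have above: "dist (\<gamma> s) (\<gamma> u) \<le> M * (\<phi> u - \<phi> s)"
      if "s \<in> I" "u \<in> I" "a \<le> s" "s \<le> u" for s u
    proof -
      have "\<phi> u - \<phi> s \<ge> 0" using \<phi>_le that by simp
      then have "1 * (\<phi> u - \<phi> s) \<le> M * (\<phi> u - \<phi> s)" by (intro mult_right_mono) (auto simp: M_def)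
      then show ?thesis using \<phi>_above[OF that] by simp
    qed
    have lipschitz: "dist (\<gamma> s) (\<gamma> u) \<le> M * (\<phi> u - \<phi> s)"
      if su: "s \<in> I" "u \<in> I" "\<bar>s - s0\<bar> < e" "\<bar>u - s0\<bar> < e" "s \<le> u" for s u
    proof -
      consider "u \<le> a" | "a \<le> s" | "s < a" "a < u" by linarith
      then show ?thesis
      proof cases
        case 1
        then show ?thesis using below su by blast
      next
        case 2
        then show ?thesis using above su by blast
      next
        case 3
        then have "\<bar>a - s0\<bar> < e" using su by linarith
        then have "dist (\<gamma> s) (\<gamma> a) \<le> M * (\<phi> a - \<phi> s)" using below[of s a] a su 3 by simp
        moreover have "dist (\<gamma> a) (\<gamma> u) \<le> M * (\<phi> u - \<phi> a)" using above[of a u] a su 3 by simp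
        ultimately show ?thesis
          using dist_triangle[of "\<gamma> s" "\<gamma> u" "\<gamma> a"] by (simp add: right_diff_distrib)
      qed
    qed
    \<comment> \<open>The radius \<open>\<beta> - x0\<close> keeps the added parameter
      \<open>\<beta>\<close> away.\<close>
    have main: "dist (\<gamma>' x) (\<gamma>' y) \<le> M * \<bar>x - y\<bar>"
      if "x \<in> I''" "y \<in> I''" "\<bar>x - x0\<bar> < min \<epsilon> (\<beta> - x0)" "\<bar>y - x0\<bar> < min \<epsilon> (\<beta> - x0)" for x y
      using that
    proof (induction x y rule: linorder_wlog)
      case (le x y)
      then have xy: "x \<in> I'" "y \<in> I'" by (auto simp: I''_def)
      have "\<bar>\<psi> x - s0\<bar> < e" "\<bar>\<psi> y - s0\<bar> < e"
        using \<epsilon>[rule_format, OF xy(1)] \<epsilon>[rule_format, OF xy(2)] le by (auto simp: dist_real_def)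
      then have "dist (\<gamma> (\<psi> x)) (\<gamma> (\<psi> y)) \<le> M * (\<phi> (\<psi> y) - \<phi> (\<psi> x))"
        using xy le(1) by (intro lipschitz \<psi>I \<psi>_le)
      then show ?case using xy le(1) by (simp add: \<gamma>'_def \<phi>\<psi>)
    next
      case (sym x y)
      then show ?case by (simp add: dist_commute abs_minus_commute)
    qed
    show ?thesis
      using \<open>\<epsilon> > 0\<close> I'_less[OF x0] main by (intro exI[of _ "min \<epsilon> (\<beta> - x0)"] conjI exI[of _ M]) auto
  qed
  have "causal_curve l I'' \<gamma>'"
    unfolding causal_curve_def
  proof (intro conjI ballI impI curve_inI)
    fix x assume "x \<in> I''"
    then consider "x \<in> I'" | "x = \<beta>" by (auto simp: I''_def)
    then show "\<exists>e>0. \<exists>C. \<forall>s\<in>I''. \<forall>u\<in>I''. \<bar>s - x\<bar> < e \<longrightarrow> \<bar>u - x\<bar> < e \<longrightarrow>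
        dist (\<gamma>' s) (\<gamma>' u) \<le> C * \<bar>s - u\<bar>"
    proof cases
      case 1
      then show ?thesis by (rule near_I')
    next
      case 2
      then show ?thesis
        using less_\<beta>[OF a] near_\<beta> by (intro exI[of _ "\<beta> - \<phi> a"] conjI exI[of _ 1]) auto
    qed
  next
    fix x y assume xy: "x \<in> I''" "y \<in> I''" "x < y"
    then have x: "x \<in> I'" using I'_less[of y] by (auto simp: I''_def)
    show "\<gamma>' x \<preceq> \<gamma>' y"
    proof (cases "y \<in> I'")
      case True
      then show ?thesis
        using mono[OF \<psi>I[OF x] \<psi>I[OF True]] \<psi>_le[OF x True] xy(3) x by (simp add: \<gamma>'_def)
    next
      case False
      then show ?thesis using le_p[OF \<psi>I[OF x]] x by (simp add: \<gamma>'_def)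
    qed
  qed (use I'' in \<open>auto simp: I''_def\<close>)
  moreover have "I' \<subseteq> I''" "\<beta> \<in> I''" "\<forall>x\<in>I'. x < \<beta>" using I'_less by (auto simp: I''_def)
  moreover have "\<forall>x\<in>I'. \<gamma>' x = \<gamma> (\<psi> x)" by (simp add: \<gamma>'_def)
  ultimately show ?thesis
    unfolding future_extendible_def using I' hom \<phi>_mono I'' by blast
qed

end

section \<open>Cauchy sets as boundaries of past sets\<close>

context lorentzian_space
begin

lemma cauchy_set_meets:
  assumes "A \<in> cauchy_sets l" "timelike_curve l I \<gamma>" "inextendible l I \<gamma>"
  obtains t where "t \<in> I" "\<gamma> t \<in> A"
  using assms unfolding cauchy_sets_def by blast

lemma cauchy_set_achronal:
  assumes "A \<in> cauchy_sets l" "x \<in> A" "y \<in> A"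
  shows "\<not> x \<lless> y"
proof
  assume "x \<lless> y"
  obtain \<gamma> where "timelike_curve l UNIV \<gamma>" "inextendible l UNIV \<gamma>" "\<gamma> 0 = x" "\<gamma> 1 = y"
    by (rule inextendible_timelike_curve_through[OF \<open>x \<lless> y\<close>], rule that)
  then have "\<exists>!t::real. t \<in> UNIV \<and> \<gamma> t \<in> A" "\<gamma> 0 \<in> A" "\<gamma> 1 \<in> A"
    using assms unfolding cauchy_sets_def by blast+
  then show False by (metis UNIV_I zero_neq_one)
qed

lemma cauchy_set_trichotomy:
  assumes "A \<in> cauchy_sets l"
  shows "x \<in> A \<or> (\<exists>a\<in>A. a \<lless> x) \<or> (\<exists>a\<in>A. x \<lless> a)"
proof -
  obtain y where "x \<lless> y" using ex_future by blast
  obtain \<gamma> where \<gamma>: "timelike_curve l UNIV \<gamma>" "inextendible l UNIV \<gamma>" "\<gamma> 0 = x" "\<gamma> 1 = y"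
    by (rule inextendible_timelike_curve_through[OF \<open>x \<lless> y\<close>], rule that)
  obtain t where "\<gamma> t \<in> A" by (rule cauchy_set_meets[OF assms \<gamma>(1,2)])
  moreover have "\<gamma> t \<lless> \<gamma> 0" if "t < 0" using \<gamma>(1) that by (auto simp: timelike_curve_def)
  moreover have "\<gamma> 0 \<lless> \<gamma> t" if "0 < t" using \<gamma>(1) that by (auto simp: timelike_curve_def)
  ultimately show ?thesis using \<gamma>(3) by (metis linorder_cases)
qed

lemma cauchy_set_nonempty: "A \<in> cauchy_sets l \<Longrightarrow> A \<noteq> {}"
  using cauchy_set_trichotomy by blast

lemma inextendible_no_max:
  assumes "timelike_curve l I \<gamma>" "inextendible l I \<gamma>" "s \<in> I"
  obtains t where "t \<in> I" "s < t"
  using future_extendible_if_max[OF causal_curve_if_timelike[OF assms(1)] assms(3)] assms(2)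
  unfolding inextendible_def by (meson not_le)

text \<open>The complement of the chronological future is closed for every \<open>A\<close>, by
  lower semicontinuity; \<open>past_iff\<close> identifies it for Cauchy sets.\<close>

definition past :: "'a set \<Rightarrow> 'a set" where
  "past A = {x. \<forall>a\<in>A. \<not> a \<lless> x}"

lemma past_iff:
  assumes "A \<in> cauchy_sets l"
  shows "x \<in> past A \<longleftrightarrow> x \<in> A \<or> (\<exists>a\<in>A. x \<lless> a)"
  using cauchy_set_trichotomy[OF assms, of x] cauchy_set_achronal[OF assms] chron_trans
  unfolding past_def by blast

lemma past_down: "\<lbrakk>x \<lless> y; y \<in> past A\<rbrakk> \<Longrightarrow> x \<in> past A"
  using chron_trans unfolding past_def by blast

lemma closed_d_le: "closed {x. \<forall>a\<in>A. d a x \<le> c}"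
proof -
  have "{x. \<forall>a\<in>A. d a x \<le> c} = - (\<Union>a\<in>A. {x. c < d a x})" by (auto simp: not_less)
  then show ?thesis using open_d_right by (auto simp: closed_def)
qed

lemma past_eq: "past A = {x. \<forall>a\<in>A. d a x \<le> 0}"
proof -
  have "\<not> a \<lless> x \<longleftrightarrow> d a x \<le> 0" for a x by (simp add: chron_iff not_less)
  then show ?thesis by (simp add: past_def)
qed

lemma closed_past: "closed (past A)"
  unfolding past_eq by (rule closed_d_le)

text \<open>The future boundary, given by the order instead of the topology, so that achronality is
  immediate.\<close>

definition edge :: "'a set \<Rightarrow> 'a set" where
  "edge E = {x\<in>E. \<forall>y\<in>E. \<not> x \<lless> y}"

lemma edge_past:
  assumes "A \<in> cauchy_sets l"
  shows "edge (past A) = A"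
  using cauchy_set_achronal[OF assms] past_iff[OF assms] chron_trans
  unfolding edge_def by blast

text \<open>Strict lower bounds on \<open>d\<close> are open conditions, so they survive a small
  step into the future, and such a step leaves \<open>E\<close>. At \<open>x'\<close> one of the
  conditions defining \<open>E\<close> must fail, which gives a strict inequality to work
  with.\<close>

lemma edge_push_up:
  assumes "x \<in> edge E" "c < d x y"
  obtains x' where "x \<lless> x'" "x' \<notin> E" "c < d x' y"
proof -
  obtain x' where "x \<lless> x'" "x' \<in> {x. c < d x y}"
    using chron_near[OF open_d_left] assms(2) by blast
  then show thesis using that assms(1) unfolding edge_def by blast
qed

text \<open>The curve crosses the edge at the last parameter \<open>T\<close> with
  \<open>\<gamma> T \<in> E\<close>. If some \<open>e \<in> E\<close> were later than
  \<open>\<gamma> T\<close>, it would still be later than the curve shortly after \<open>T\<close>,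
  which would then lie in \<open>E\<close>. Uniqueness is achronality of the edge.\<close>

lemma cauchy_set_edge:
  assumes "closed E" and down: "\<And>x y. \<lbrakk>x \<lless> y; y \<in> E\<rbrakk> \<Longrightarrow> x \<in> E"
    and meets: "\<And>I \<gamma>. \<lbrakk>timelike_curve l I \<gamma>; inextendible l I \<gamma>\<rbrakk> \<Longrightarrow> \<exists>t\<in>I. \<gamma> t \<in> E"
    and leaves: "\<And>I \<gamma>. \<lbrakk>timelike_curve l I \<gamma>; inextendible l I \<gamma>\<rbrakk> \<Longrightarrow> \<exists>t\<in>I. \<gamma> t \<notin> E"
  shows "edge E \<in> cauchy_sets l"
  unfolding cauchy_sets_def
proof (intro CollectI allI impI)
  fix I \<gamma> assume "timelike_curve l I \<gamma> \<and> inextendible l I \<gamma>"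
  then have \<gamma>: "timelike_curve l I \<gamma>" "inextendible l I \<gamma>" by auto
  then have chron: "\<gamma> s \<lless> \<gamma> t" if "s \<in> I" "t \<in> I" "s < t" for s t
    using that by (auto simp: timelike_curve_def)
  have I: "is_interval I" using \<gamma>(1) by (simp add: timelike_curve_def curve_in_def)
  obtain t0 t1 where t: "t0 \<in> I" "\<gamma> t0 \<in> E" "t1 \<in> I" "\<gamma> t1 \<notin> E"
    using meets[OF \<gamma>] leaves[OF \<gamma>] by blast
  then have "t0 < t1" using chron down by (metis linorder_cases)
  have sub: "{t0..t1} \<subseteq> I" using mem_is_interval_1_I[OF I t(1,3)] by auto
  have cont: "continuous_on {t0..t1} \<gamma>"
    using timelike_curve_continuous_on[OF \<gamma>(1)] sub by (rule continuous_on_subset)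
  define S where "S = {t0..t1} \<inter> \<gamma> -` E"
  have "closed S" unfolding S_def by (intro continuous_closed_preimage cont assms(1)) simp
  have S: "t0 \<in> S" "bdd_above S" using t \<open>t0 < t1\<close> by (auto simp: S_def intro: bdd_aboveI)
  define T where "T = Sup S"
  have "T \<in> S" unfolding T_def using S \<open>closed S\<close> by (intro closed_contains_Sup) auto
  then have T: "T \<in> {t0..t1}" "\<gamma> T \<in> E" by (auto simp: S_def)
  then have "T < t1" using t(4) by (cases "T = t1") auto
  have "\<gamma> T \<in> edge E"
  proof (rule ccontr)
    assume "\<gamma> T \<notin> edge E"
    then obtain e where e: "e \<in> E" "\<gamma> T \<lless> e" using T(2) by (auto simp: edge_def)
    obtain r where "r > 0" "ball (\<gamma> T) r \<subseteq> {x. 0 < d x e}"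
      using open_d_left[of 0 e] e(2) open_contains_ball chron_iff by (metis mem_Collect_eq)
    then obtain \<epsilon> where "\<epsilon> > 0" and \<epsilon>: "\<forall>s\<in>{t0..t1}. dist s T < \<epsilon> \<longrightarrow> dist (\<gamma> s) (\<gamma> T) < r"
      using cont T(1) unfolding continuous_on_iff by metis
    define s where "s = min t1 (T + \<epsilon> / 2)"
    have s: "s \<in> {t0..t1}" "T < s" "dist s T < \<epsilon>"
      using T(1) \<open>T < t1\<close> \<open>\<epsilon> > 0\<close> by (auto simp: s_def dist_real_def)
    have "\<gamma> s \<in> ball (\<gamma> T) r" using \<epsilon>[rule_format, OF s(1,3)] by (simp add: dist_commute)
    then have "\<gamma> s \<lless> e" using \<open>ball (\<gamma> T) r \<subseteq> {x. 0 < d x e}\<close> by (auto simp: chron_iff)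
    then have "s \<in> S" using down e(1) s(1) by (auto simp: S_def)
    then have "s \<le> T" unfolding T_def using S by (intro cSup_upper)
    then show False using s(2) by simp
  qed
  moreover have "T \<in> I" using T(1) sub by blast
  moreover have "\<not> s < t" if "s \<in> I" "t \<in> I" "\<gamma> s \<in> edge E" "\<gamma> t \<in> edge E" for s t
    using chron[OF that(1,2)] that(3,4) by (auto simp: edge_def)
  ultimately show "\<exists>!t. t \<in> I \<and> \<gamma> t \<in> edge E"
    by (meson linorder_neqE)
qed

section \<open>The distance between Cauchy sets\<close>

lemma d_le_d_J:
  assumes "x \<in> A" "y \<in> B"
  shows "d x y \<le> d_J l A B" "d y x \<le> d_J l A B"
proof -
  have "d x y + d y x \<le> d_J l A B"
    unfolding d_J_def using assms by (intro SUP_upper2[of "(x, y)"]) auto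
  moreover have "d x y \<le> d x y + d y x" "d y x \<le> d x y + d y x"
    by (simp_all add: add_increasing add_increasing2)
  ultimately show "d x y \<le> d_J l A B" "d y x \<le> d_J l A B" by (auto intro: order_trans)
qed

text \<open>At most one of \<open>d x y\<close> and \<open>d y x\<close> is positive, so a bound on
  each of them bounds their sum.\<close>

lemma d_J_least:
  assumes "\<And>x y. \<lbrakk>x \<in> A; y \<in> B\<rbrakk> \<Longrightarrow> d x y \<le> c" "\<And>x y. \<lbrakk>x \<in> A; y \<in> B\<rbrakk> \<Longrightarrow> d y x \<le> c"
  shows "d_J l A B \<le> c"
  unfolding d_J_def
proof (rule SUP_least, clarify)
  fix x y assume "x \<in> A" "y \<in> B"
  moreover have "d x y = 0 \<or> d y x = 0" using chron_asym not_chron_iff by blast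
  ultimately show "d x y + d y x \<le> c" using assms by force
qed

lemma d_J_commute: "d_J l A B = d_J l B A"
  by (intro antisym d_J_least d_le_d_J)

lemma d_J_nonneg:
  assumes "A \<in> cauchy_sets l" "B \<in> cauchy_sets l"
  shows "0 \<le> d_J l A B"
proof -
  obtain x y where "x \<in> A" "y \<in> B" using assms cauchy_set_nonempty by blast
  then show ?thesis using d_le_d_J(1) d_nonneg by (meson order_trans)
qed

lemma d_J_self:
  assumes "A \<in> cauchy_sets l"
  shows "d_J l A A = 0"
proof (rule antisym)
  show "d_J l A A \<le> 0"
    using cauchy_set_achronal[OF assms] by (intro d_J_least) (simp_all add: chron_iff not_less)
qed (use d_J_nonneg assms in blast)

text \<open>A point of \<open>A\<close> outside \<open>B\<close> would have positive distance to or
  from a point of \<open>B\<close>, by trichotomy.\<close>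

lemma d_J_eq_0_imp_subset:
  assumes "A \<in> cauchy_sets l" "B \<in> cauchy_sets l" "d_J l A B = 0"
  shows "A \<subseteq> B"
proof
  fix x assume "x \<in> A"
  then have "\<not> x \<lless> b" "\<not> b \<lless> x" if "b \<in> B" for b
    using d_le_d_J[of x A b B] that assms(3) by (auto simp: chron_iff)
  then show "x \<in> B" using cauchy_set_trichotomy[OF assms(2), of x] by blast
qed

end

section \<open>Finiteness and the triangle inequality\<close>

lemma lor_length_upper:
  fixes t :: "nat \<Rightarrow> real"
  assumes "t 0 = a" "t n = b" "\<forall>i<n. t i < t (Suc i)"
  shows "lor_length l a b \<gamma> \<le> (\<Sum>i<n. lor_dist l (\<gamma> (t i)) (\<gamma> (t (Suc i))))"
  unfolding lor_length_def by (rule Inf_lower) (use assms in blast)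

lemma lor_length_le_d: "a < b \<Longrightarrow> lor_length l a b \<gamma> \<le> lor_dist l (\<gamma> a) (\<gamma> b)"
  using lor_length_upper[of "\<lambda>i. if i = 0 then a else b" a 1 b l \<gamma>] by simp

lemma lor_length_le_two:
  assumes "a < t" "t < b"
  shows "lor_length l a b \<gamma> \<le> lor_dist l (\<gamma> a) (\<gamma> t) + lor_dist l (\<gamma> t) (\<gamma> b)"
  using lor_length_upper[of "\<lambda>i. if i = 0 then a else if i = 1 then t else b" a 2 b l \<gamma>] assms
  by (simp add: less_2_cases_iff numeral_2_eq_2)

lemma lor_length_approx:
  assumes "lor_length l a b \<gamma> < c"
  obtains n :: nat and t where "t 0 = a" "t n = b" "\<forall>i<n. t i < t (Suc i)"
    "(\<Sum>i<n. lor_dist l (\<gamma> (t i)) (\<gamma> (t (Suc i)))) < c"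
  using assms unfolding lor_length_def Inf_less_iff by blast

text \<open>Nearly optimal partitions of both parts join to one of the whole. Real bounds
  \<open>M\<close> and \<open>N\<close> leave room for an error \<open>e / 2\<close> each, also
  where the lengths are infinite a priori or \<open>- \<infinity>\<close> is not excluded.\<close>

lemma lor_length_concat:
  fixes M N :: real
  assumes "lor_length l a b \<gamma> \<le> ereal M" "lor_length l b c \<gamma> \<le> ereal N"
  shows "lor_length l a c \<gamma> \<le> ereal (M + N)"
proof (rule ereal_le_epsilon2)
  fix e :: real assume "e > 0"
  have "lor_length l a b \<gamma> < ereal (M + e / 2)"
    using assms(1) by (rule le_less_trans) (use \<open>e > 0\<close> in simp)
  then obtain n t where t: "t 0 = a" "t n = b" "\<forall>i<n. t i < t (Suc i)"
    "(\<Sum>i<n. lor_dist l (\<gamma> (t i)) (\<gamma> (t (Suc i)))) < ereal (M + e / 2)"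
    by (rule lor_length_approx)
  have "lor_length l b c \<gamma> < ereal (N + e / 2)"
    using assms(2) by (rule le_less_trans) (use \<open>e > 0\<close> in simp)
  then obtain m u where u: "u 0 = b" "u m = c" "\<forall>i<m. u i < u (Suc i)"
    "(\<Sum>i<m. lor_dist l (\<gamma> (u i)) (\<gamma> (u (Suc i)))) < ereal (N + e / 2)"
    by (rule lor_length_approx)
  define v where "v i = (if i \<le> n then t i else u (i - n))" for i
  have v_left: "v i = t i" if "i \<le> n" for i using that by (simp add: v_def)
  have v_right: "v (n + i) = u i" for i using t(2) u(1) by (simp add: v_def)
  have "v i < v (Suc i)" if "i < n + m" for i
  proof (cases "i < n")
    case True
    then show ?thesis using t(3) v_left by simp
  next
    case False
    then obtain j where "i = n + j" using le_Suc_ex not_less by blast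
    then show ?thesis using u(3) that v_right[of j] v_right[of "Suc j"] by simp
  qed
  then have "lor_length l a c \<gamma> \<le> (\<Sum>i<n + m. lor_dist l (\<gamma> (v i)) (\<gamma> (v (Suc i))))"
    using t(1) u(2) v_left[of 0] v_right[of m] by (intro lor_length_upper) auto
  also have "\<dots> = (\<Sum>i<n. lor_dist l (\<gamma> (v i)) (\<gamma> (v (Suc i)))) +
      (\<Sum>i<m. lor_dist l (\<gamma> (v (n + i))) (\<gamma> (v (n + Suc i))))"
    by (induction m) (simp_all add: add.assoc)
  also have "(\<Sum>i<n. lor_dist l (\<gamma> (v i)) (\<gamma> (v (Suc i)))) =
      (\<Sum>i<n. lor_dist l (\<gamma> (t i)) (\<gamma> (t (Suc i))))"
    by (intro sum.cong) (simp_all add: v_left)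
  also have "(\<Sum>i<m. lor_dist l (\<gamma> (v (n + i))) (\<gamma> (v (n + Suc i)))) =
      (\<Sum>i<m. lor_dist l (\<gamma> (u i)) (\<gamma> (u (Suc i))))"
    by (simp only: v_right)
  finally have "lor_length l a c \<gamma> \<le> ereal (M + e / 2) + ereal (N + e / 2)"
    using add_mono[OF less_imp_le[OF t(4)] less_imp_le[OF u(4)]] by (rule order_trans)
  then show "lor_length l a c \<gamma> \<le> ereal (M + N) + ereal e" by (simp add: algebra_simps)
qed

text \<open>Adds what bounds \<open>d\<close> from above: local bounds on length, the description of
  \<open>d\<close> by curves, and compactness of Cauchy sets, from which \<open>d_J_finite\<close>
  gets a compact diamond.\<close>

locale cauchy_compact_space = lorentzian_space +
  assumes locally_bounded_length: "\<exists>U M. open U \<and> x \<in> U \<and>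
        (\<forall>a b \<gamma>. a < b \<and> causal_curve l {a..b} \<gamma> \<and> \<gamma> ` {a..b} \<subseteq> U \<longrightarrow> lor_length l a b \<gamma> \<le> ereal M)"
    and d_eq_Sup_length: "chron_less l x y \<Longrightarrow>
        lor_dist l x y = Sup {lor_length l a b \<gamma> | a b \<gamma>. causal_curve_from_to l a b \<gamma> x y}"
    and compact_cauchy_set: "A \<in> cauchy_sets l \<Longrightarrow> compact A"
begin

text \<open>The formula for \<open>d\<close> as a supremum is available for chronologically related
  points; otherwise \<open>d\<close> is 0, which is why \<open>0 \<le> c\<close> is assumed.\<close>

lemma d_le_if_length_le:
  assumes "0 \<le> c"
    and "\<And>a b \<gamma>. \<lbrakk>a < b; causal_curve l {a..b} \<gamma>; \<gamma> a = x; \<gamma> b = y\<rbrakk> \<Longrightarrow> lor_length l a b \<gamma> \<le> c"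
  shows "d x y \<le> c"
proof (cases "x \<lless> y")
  case True
  show ?thesis
    unfolding d_eq_Sup_length[OF True]
    by (rule Sup_least) (use assms(2) in \<open>auto simp: causal_curve_from_to_def\<close>)
next
  case False
  then show ?thesis using assms(1) by (simp add: not_chron_iff)
qed

text \<open>Each ball is used up once. Until its last visit to the ball about \<open>p\<close> the
  curve may leave the ball, but order convexity keeps it in \<open>U p\<close>; afterwards the
  remaining balls cover it, and induction on \<open>F\<close> applies.\<close>

lemma bounded_length_if_covered:
  fixes U :: "'a \<Rightarrow> 'a set" and M r :: "'a \<Rightarrow> real"
  assumes U: "\<And>p a b \<gamma>. \<lbrakk>a < b; causal_curve l {a..b} \<gamma>; \<gamma> ` {a..b} \<subseteq> U p\<rbrakk> \<Longrightarrow>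
      lor_length l a b \<gamma> \<le> ereal (M p)"
    and M: "\<And>p. 0 \<le> M p"
    and convex: "\<And>p x y z. \<lbrakk>x \<preceq> y; y \<preceq> z; dist x p \<le> r p; dist z p \<le> r p; y \<in> K\<rbrakk> \<Longrightarrow> y \<in> U p"
    and "finite F"
  shows "\<lbrakk>a < b; causal_curve l {a..b} \<gamma>; \<gamma> ` {a..b} \<subseteq> K; \<gamma> ` {a..b} \<subseteq> (\<Union>p\<in>F. ball p (r p))\<rbrakk> \<Longrightarrow>
    lor_length l a b \<gamma> \<le> ereal (\<Sum>p\<in>F. M p)"
  using \<open>finite F\<close>
proof (induction F arbitrary: a rule: finite_psubset_induct)
  case (psubset F a)
  have cont: "continuous_on {a..b} \<gamma>"
    using psubset.prems(2) by (simp add: causal_curve_def curve_in_continuous_on)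
  have "\<gamma> a \<in> (\<Union>p\<in>F. ball p (r p))"
    using subsetD[OF psubset.prems(4), of "\<gamma> a"] psubset.prems(1) by simp
  then obtain p where p: "p \<in> F" "dist (\<gamma> a) p < r p" by (auto simp: dist_commute)
  \<comment> \<open>The closed ball makes the last visit attained, whereas the cover consists of
    open balls.\<close>
  define S where "S = {a..b} \<inter> \<gamma> -` cball p (r p)"
  have "closed S" unfolding S_def by (intro continuous_closed_preimage cont) auto
  have S: "a \<in> S" "bdd_above S"
    using p psubset.prems(1) by (auto simp: S_def dist_commute intro: bdd_aboveI)
  define s where "s = Sup S"
  have "s \<in> S" unfolding s_def using S \<open>closed S\<close> by (intro closed_contains_Sup) auto
  then have s: "s \<in> {a..b}" "dist (\<gamma> s) p \<le> r p" by (auto simp: S_def dist_commute)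
  have "\<gamma> t \<in> U p" if "t \<in> {a..s}" for t
  proof (rule convex)
    show "\<gamma> a \<preceq> \<gamma> t" "\<gamma> t \<preceq> \<gamma> s"
      using that s(1) by (auto intro!: causal_curve_mono[OF psubset.prems(2)])
    show "\<gamma> t \<in> K" using that s(1) psubset.prems(3) by auto
  qed (use p s in auto)
  then have first: "lor_length l a s \<gamma> \<le> ereal (M p)" if "a < s"
  proof (intro U[OF that])
    show "causal_curve l {a..s} \<gamma>"
      using psubset.prems(2) s(1) that curve_in_subset[of UNIV dist "{a..b}" \<gamma> "{a..s}"]
      by (auto simp: causal_curve_def is_interval_cc)
  qed auto
  have sum: "(\<Sum>p\<in>F. M p) = M p + (\<Sum>p\<in>F - {p}. M p)"
    using psubset.hyps p(1) by (simp add: sum.remove)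
  have rest: "0 \<le> (\<Sum>p\<in>F - {p}. M p)" using M by (intro sum_nonneg) auto
  show ?case
  proof (cases "s = b")
    case True
    then have "lor_length l a b \<gamma> \<le> ereal (M p)" using first psubset.prems(1) by simp
    then show ?thesis using rest unfolding sum by (rule_tac order_trans) auto
  next
    case False
    then have "s < b" using s(1) by simp
    have after: "\<gamma> t \<notin> ball p (r p)" if "t \<in> {s..b}" for t
    proof
      assume "\<gamma> t \<in> ball p (r p)"
      then have "dist (\<gamma> t) p < r p" by (simp add: dist_commute)
      have "t \<in> {a..b}" using that s(1) by auto
      show False
      proof (cases "s < t")
        case True
        have "t \<in> S" using \<open>t \<in> {a..b}\<close> \<open>dist (\<gamma> t) p < r p\<close> by (auto simp: S_def dist_commute)
        then have "t \<le> s" unfolding s_def using S by (intro cSup_upper)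
        then show False using True by simp
      next
        case False
        then have "t = s" using that by simp
        \<comment> \<open>Were \<open>\<gamma> s\<close> in the open ball, the curve would stay
          there a little longer because \<open>s < b\<close>, against the choice of
          \<open>s\<close>.\<close>
        have "r p - dist (\<gamma> s) p > 0" using \<open>dist (\<gamma> t) p < r p\<close> \<open>t = s\<close> by simp
        then obtain \<epsilon> where "\<epsilon> > 0"
          and \<epsilon>: "\<forall>u\<in>{a..b}. dist u s < \<epsilon> \<longrightarrow> dist (\<gamma> u) (\<gamma> s) < r p - dist (\<gamma> s) p"
          using cont s(1) unfolding continuous_on_iff by meson
        define u where "u = min b (s + \<epsilon> / 2)"
        have u: "u \<in> {a..b}" "s < u" "dist u s < \<epsilon>"
          using s(1) \<open>s < b\<close> \<open>\<epsilon> > 0\<close> by (auto simp: u_def dist_real_def)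
        have "dist (\<gamma> u) p < r p"
          using \<epsilon>[rule_format, OF u(1,3)] dist_triangle[of "\<gamma> u" p "\<gamma> s"] by linarith
        then have "u \<in> S" using u(1) by (auto simp: S_def dist_commute)
        then have "u \<le> s" unfolding s_def using S by (intro cSup_upper)
        then show False using u(2) by simp
      qed
    qed
    have "a < s" using after[of a] s(1) p(2) \<open>s < b\<close> by (cases "s = a") (auto simp: dist_commute)
    have "lor_length l s b \<gamma> \<le> ereal (\<Sum>p\<in>F - {p}. M p)"
    proof (rule psubset.IH)
      show "F - {p} \<subset> F" using p(1) by blast
      show "causal_curve l {s..b} \<gamma>"
        using psubset.prems(2) s(1) curve_in_subset[of UNIV dist "{a..b}" \<gamma> "{s..b}"]
        by (auto simp: causal_curve_def is_interval_cc)
      have sub: "\<gamma> ` {s..b} \<subseteq> \<gamma> ` {a..b}" using s(1) by auto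
      then show "\<gamma> ` {s..b} \<subseteq> K" using psubset.prems(3) by blast
      show "\<gamma> ` {s..b} \<subseteq> (\<Union>p\<in>F - {p}. ball p (r p))"
      proof (rule image_subsetI)
        fix t assume t: "t \<in> {s..b}"
        then have "\<gamma> t \<in> (\<Union>p\<in>F. ball p (r p))" using sub psubset.prems(4) by blast
        then show "\<gamma> t \<in> (\<Union>p\<in>F - {p}. ball p (r p))" using after[OF t] by blast
      qed
    qed fact
    then show ?thesis using lor_length_concat[OF first[OF \<open>a < s\<close>]] unfolding sum by blast
  qed
qed

lemma bounded_length_in_compact:
  assumes "compact K"
  obtains M :: real where "0 \<le> M"
    "\<And>a b \<gamma>. \<lbrakk>a < b; causal_curve l {a..b} \<gamma>; \<gamma> ` {a..b} \<subseteq> K\<rbrakk> \<Longrightarrow> lor_length l a b \<gamma> \<le> ereal M"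
proof -
  have "\<exists>U M r. 0 < r \<and> 0 \<le> M \<and>
      (\<forall>a b \<gamma>. a < b \<longrightarrow> causal_curve l {a..b} \<gamma> \<longrightarrow> \<gamma> ` {a..b} \<subseteq> U \<longrightarrow>
        lor_length l a b \<gamma> \<le> ereal M) \<and>
      (\<forall>x y z. x \<preceq> y \<longrightarrow> y \<preceq> z \<longrightarrow> dist x p \<le> r \<longrightarrow> dist z p \<le> r \<longrightarrow> y \<in> K \<longrightarrow> y \<in> U)" for p
  proof -
    obtain U M where U: "open U" "p \<in> U" and
      M: "\<forall>a b \<gamma>. a < b \<and> causal_curve l {a..b} \<gamma> \<and> \<gamma> ` {a..b} \<subseteq> U \<longrightarrow> lor_length l a b \<gamma> \<le> ereal M"
      using locally_bounded_length[of p] by (elim exE conjE)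
    obtain r where r: "r > 0"
      "\<And>x y z. \<lbrakk>x \<preceq> y; y \<preceq> z; dist x p \<le> r; dist z p \<le> r; y \<in> K\<rbrakk> \<Longrightarrow> y \<in> U"
      by (rule locally_order_convex[OF assms U], rule that)
    have "lor_length l a b \<gamma> \<le> ereal (max 0 M)"
      if "a < b" "causal_curve l {a..b} \<gamma>" "\<gamma> ` {a..b} \<subseteq> U" for a b \<gamma>
    proof -
      have "lor_length l a b \<gamma> \<le> ereal M" using M that by blast
      also have "\<dots> \<le> ereal (max 0 M)" by simp
      finally show ?thesis .
    qed
    then show ?thesis
      using r by (intro exI[of _ U] exI[of _ "max 0 M"] exI[of _ r]) auto
  qed
  then obtain U M r where r: "\<And>p. 0 < r p" and M: "\<And>p. 0 \<le> M p"
    and U: "\<And>p a b \<gamma>. \<lbrakk>a < b; causal_curve l {a..b} \<gamma>; \<gamma> ` {a..b} \<subseteq> U p\<rbrakk> \<Longrightarrow>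
      lor_length l a b \<gamma> \<le> ereal (M p)"
    and convex: "\<And>p x y z. \<lbrakk>x \<preceq> y; y \<preceq> z; dist x p \<le> r p; dist z p \<le> r p; y \<in> K\<rbrakk> \<Longrightarrow> y \<in> U p"
    by metis
  have cover: "K \<subseteq> (\<Union>p\<in>K. ball p (r p))"
  proof
    fix p assume "p \<in> K"
    then show "p \<in> (\<Union>p\<in>K. ball p (r p))" using r[of p] by (intro UN_I[of p]) auto
  qed
  obtain F where F: "finite F" "K \<subseteq> (\<Union>p\<in>F. ball p (r p))"
    by (rule compactE_image[where C=K and f="\<lambda>p. ball p (r p)", OF assms _ cover]) auto
  have "lor_length l a b \<gamma> \<le> ereal (\<Sum>p\<in>F. M p)"
    if "a < b" "causal_curve l {a..b} \<gamma>" "\<gamma> ` {a..b} \<subseteq> K" for a b \<gamma>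
  proof (rule bounded_length_if_covered[where U=U and M=M and r=r and K=K, OF U M convex F(1) that])
    show "\<gamma> ` {a..b} \<subseteq> (\<Union>p\<in>F. ball p (r p))" using that(3) F(2) by (rule order_trans)
  qed
  moreover have "0 \<le> (\<Sum>p\<in>F. M p)" using M by (intro sum_nonneg) auto
  ultimately show thesis using that by blast
qed

lemma d_J_finite:
  assumes A: "A \<in> cauchy_sets l" and B: "B \<in> cauchy_sets l"
  obtains M :: real where "d_J l A B = ereal M"
proof -
  \<comment> \<open>The diamond of the union contains the causal curves from \<open>A\<close> to
    \<open>B\<close> as well as those from \<open>B\<close> to \<open>A\<close>.\<close>
  define K where "K = J_plus l (A \<union> B) \<inter> J_minus l (A \<union> B)"
  have "compact K"
    unfolding K_def using compact_cauchy_set A B by (intro compact_diamond compact_Un)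
  obtain M where M: "0 \<le> M"
    "\<And>a b \<gamma>. \<lbrakk>a < b; causal_curve l {a..b} \<gamma>; \<gamma> ` {a..b} \<subseteq> K\<rbrakk> \<Longrightarrow> lor_length l a b \<gamma> \<le> ereal M"
    by (rule bounded_length_in_compact[OF \<open>compact K\<close>], rule that)
  have "d x y \<le> ereal M" if "x \<in> A \<union> B" "y \<in> A \<union> B" for x y
  proof (rule d_le_if_length_le)
    fix a b \<gamma> assume \<gamma>: "a < b" "causal_curve l {a..b} \<gamma>" "\<gamma> a = x" "\<gamma> b = y"
    have "\<gamma> t \<in> K" if "t \<in> {a..b}" for t
    proof -
      have "\<gamma> a \<preceq> \<gamma> t" "\<gamma> t \<preceq> \<gamma> b"
        using that by (auto intro!: causal_curve_mono[OF \<gamma>(2)])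
      then show ?thesis
        using \<open>x \<in> A \<union> B\<close> \<open>y \<in> A \<union> B\<close> \<gamma>(3,4) unfolding K_def J_plus_def J_minus_def by blast
    qed
    then show "lor_length l a b \<gamma> \<le> ereal M" using \<gamma>(1,2) by (intro M(2)) auto
  qed (use M(1) in simp)
  then have "d_J l A B \<le> ereal M" by (intro d_J_least) auto
  then show thesis using that d_J_nonneg[OF A B] by (cases "d_J l A B") auto
qed

text \<open>A causal curve between points on different sides of a Cauchy set crosses it, because the
  complements of its chronological future and past are closed.\<close>

lemma d_le_across_cauchy_set:
  assumes B: "B \<in> cauchy_sets l" and x: "\<forall>b\<in>B. \<not> b \<lless> x" and z: "\<forall>b\<in>B. \<not> z \<lless> b"
    and c: "\<And>y. y \<in> B \<Longrightarrow> d x y + d y z \<le> c"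
  shows "d x z \<le> c"
proof (rule d_le_if_length_le)
  obtain b where "b \<in> B" using cauchy_set_nonempty[OF B] by blast
  then show "0 \<le> c" using c[of b] by (meson add_nonneg_nonneg d_nonneg order_trans)
  fix a b \<gamma> assume \<gamma>: "a < b" "causal_curve l {a..b} \<gamma>" "\<gamma> a = x" "\<gamma> b = z"
  have cont: "continuous_on {a..b} \<gamma>"
    using \<gamma>(2) by (simp add: causal_curve_def curve_in_continuous_on)
  define P where "P = past B"
  define Q where "Q = {x. \<forall>b\<in>B. \<not> x \<lless> b}"
  have "closed P" unfolding P_def by (rule closed_past)
  have "Q = - (\<Union>b\<in>B. {x. 0 < d x b})" by (auto simp: Q_def chron_iff)
  then have "closed Q" using open_d_left by (auto simp: closed_def)
  have "P \<union> Q = UNIV"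
    using cauchy_set_trichotomy[OF B] cauchy_set_achronal[OF B] chron_trans
    unfolding P_def Q_def past_def by blast
  have "P \<inter> Q \<subseteq> B"
    using cauchy_set_trichotomy[OF B] unfolding P_def Q_def past_def by blast
  have "connected {a..b}" by simp
  have "{a..b} \<inter> \<gamma> -` P \<inter> ({a..b} \<inter> \<gamma> -` Q) \<noteq> {}"
  proof
    assume empty: "{a..b} \<inter> \<gamma> -` P \<inter> ({a..b} \<inter> \<gamma> -` Q) = {}"
    have "closed ({a..b} \<inter> \<gamma> -` P)" "closed ({a..b} \<inter> \<gamma> -` Q)"
      by (intro continuous_closed_preimage cont \<open>closed P\<close> \<open>closed Q\<close>; simp)+
    moreover have "{a..b} \<subseteq> ({a..b} \<inter> \<gamma> -` P) \<union> ({a..b} \<inter> \<gamma> -` Q)"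
      using \<open>P \<union> Q = UNIV\<close> by blast
    moreover have "a \<in> {a..b} \<inter> \<gamma> -` P" "b \<in> {a..b} \<inter> \<gamma> -` Q"
      using \<gamma> x z by (auto simp: P_def Q_def past_def)
    ultimately show False
      using \<open>connected {a..b}\<close> empty unfolding connected_closed by blast
  qed
  then obtain t where t: "t \<in> {a..b}" "\<gamma> t \<in> B" using \<open>P \<inter> Q \<subseteq> B\<close> by blast
  have "lor_length l a b \<gamma> \<le> d x (\<gamma> t) + d (\<gamma> t) z"
  proof (cases "a < t \<and> t < b")
    case True
    then show ?thesis using lor_length_le_two[of a t b l \<gamma>] \<gamma>(3,4) by simp
  next
    \<comment> \<open>A crossing at an endpoint yields no partition with two steps, but then one of
      the summands is \<open>d x z\<close> itself.\<close>
    case False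
    then have "\<gamma> t = x \<or> \<gamma> t = z" using t(1) \<gamma>(3,4) by (metis atLeastAtMost_iff order_le_less)
    then have "d x z \<le> d x (\<gamma> t) + d (\<gamma> t) z"
      by (auto simp: add_increasing add_increasing2)
    then show ?thesis using lor_length_le_d[OF \<gamma>(1), of l \<gamma>] \<gamma>(3,4) by simp
  qed
  also have "\<dots> \<le> c" using c t(2) by blast
  finally show "lor_length l a b \<gamma> \<le> c" .
qed

text \<open>A curve from \<open>x\<close> to \<open>z\<close> misses \<open>B\<close> if both points
  lie strictly on one side of it. Then some \<open>b\<close> lies before \<open>x\<close> or after
  \<open>z\<close>, and monotonicity of \<open>d\<close> bounds \<open>d x z\<close> by one of the
  two summands.\<close>

lemma d_le_sum_d_J:
  assumes B: "B \<in> cauchy_sets l" and "x \<in> A" "z \<in> C"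
    and AC: "A \<in> cauchy_sets l" "C \<in> cauchy_sets l"
  shows "d x z \<le> d_J l A B + d_J l B C"
proof (cases "x \<lless> z")
  case False
  then show ?thesis using d_J_nonneg AC B by (simp add: not_chron_iff)
next
  case True
  have nonneg: "0 \<le> d_J l A B" "0 \<le> d_J l B C" using d_J_nonneg AC B by auto
  consider b where "b \<in> B" "b \<lless> x" | b where "b \<in> B" "z \<lless> b" |
    "\<forall>b\<in>B. \<not> b \<lless> x" "\<forall>b\<in>B. \<not> z \<lless> b" by blast
  then show ?thesis
  proof cases
    case 1
    have "d x z \<le> d b z" using d_mono_left chron_imp_causal 1(2) True by blast
    also have "\<dots> \<le> d_J l B C" using d_le_d_J 1(1) \<open>z \<in> C\<close> by blast
    also have "\<dots> \<le> d_J l A B + d_J l B C" using nonneg by (simp add: add_increasing)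
    finally show ?thesis .
  next
    case 2
    have "d x z \<le> d x b" using d_mono_right chron_imp_causal 2(2) True by blast
    also have "\<dots> \<le> d_J l A B" using d_le_d_J 2(1) \<open>x \<in> A\<close> by blast
    also have "\<dots> \<le> d_J l A B + d_J l B C" using nonneg by (simp add: add_increasing2)
    finally show ?thesis .
  next
    case 3
    show ?thesis
      by (rule d_le_across_cauchy_set[OF B 3])
        (intro add_mono d_le_d_J(1) \<open>x \<in> A\<close> \<open>z \<in> C\<close>)
  qed
qed

lemma d_J_triangle:
  assumes "A \<in> cauchy_sets l" "B \<in> cauchy_sets l" "C \<in> cauchy_sets l"
  shows "d_J l A C \<le> d_J l A B + d_J l B C"
proof (rule d_J_least)
  fix x z assume "x \<in> A" "z \<in> C"
  then show "d x z \<le> d_J l A B + d_J l B C" using d_le_sum_d_J assms by blast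
  have "d z x \<le> d_J l C B + d_J l B A" using d_le_sum_d_J assms \<open>x \<in> A\<close> \<open>z \<in> C\<close> by blast
  then show "d z x \<le> d_J l A B + d_J l B C" by (simp add: d_J_commute add.commute)
qed

definition dJ :: "'a set \<Rightarrow> 'a set \<Rightarrow> real" where
  "dJ A B = real_of_ereal (d_J l A B)"

lemma d_J_eq_dJ: "\<lbrakk>A \<in> cauchy_sets l; B \<in> cauchy_sets l\<rbrakk> \<Longrightarrow> d_J l A B = ereal (dJ A B)"
  using d_J_finite unfolding dJ_def by (metis real_of_ereal.simps(1))

lemma Metric_space_dJ: "Metric_space (cauchy_sets l) dJ"
proof
  \<comment> \<open>\<open>Metric_space\<close> demands this also outside the carrier. For an empty
    set the supremum is \<open>- \<infinity>\<close>, which \<open>real_of_ereal\<close> sends to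
    0.\<close>
  show "0 \<le> dJ A B" for A B
  proof (cases "A = {} \<or> B = {}")
    case True
    then show ?thesis by (auto simp: dJ_def d_J_def bot_ereal_def)
  next
    case False
    then obtain x y where "x \<in> A" "y \<in> B" by blast
    then have "0 \<le> d_J l A B" using d_le_d_J(1) d_nonneg by (meson order_trans)
    then show ?thesis by (simp add: dJ_def real_of_ereal_pos)
  qed
  show "dJ A B = dJ B A" for A B by (simp add: dJ_def d_J_commute)
  show "(dJ A B = 0) = (A = B)" if "A \<in> cauchy_sets l" "B \<in> cauchy_sets l" for A B
  proof
    assume "dJ A B = 0"
    then have "d_J l A B = 0" "d_J l B A = 0"
      using d_J_eq_dJ that by (simp_all add: zero_ereal_def d_J_commute)
    then show "A = B" using d_J_eq_0_imp_subset that by blast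
  next
    assume "A = B"
    then show "dJ A B = 0" using d_J_self that by (simp add: dJ_def)
  qed
  show "dJ A C \<le> dJ A B + dJ B C"
    if "A \<in> cauchy_sets l" "B \<in> cauchy_sets l" "C \<in> cauchy_sets l" for A B C
    using d_J_triangle[OF that] d_J_eq_dJ that by simp
qed

end

section \<open>Geodesics\<close>

context lorentzian_space
begin

text \<open>No relation between \<open>a\<close> and \<open>x\<close> is assumed, since otherwise
  the left side is 0.\<close>

lemma d_mono_right': "x \<preceq> y \<Longrightarrow> d a x \<le> d a y"
  using d_mono_right chron_imp_causal not_chron_iff d_nonneg by metis

text \<open>Nonnegativity of \<open>c\<close> and \<open>e\<close> makes the two distances positive,
  so that the points are chronologically related and the reverse triangle inequality
  applies.\<close>

lemma d_add_less:
  fixes c e :: real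
  assumes "0 \<le> c" "0 \<le> e" "ereal c < d a x" "ereal e < d x y"
  shows "ereal (c + e) < d a y"
proof -
  have "a \<lless> x" "x \<lless> y"
    using assms by (auto simp: chron_iff intro: le_less_trans[rotated])
  then have "d a x + d x y \<le> d a y" by (intro d_triangle chron_imp_causal)
  moreover have "ereal c + ereal e < d a x + d x y" using assms(3,4) by (rule ereal_add_strict_mono2)
  ultimately show ?thesis by simp
qed

lemma past_down_causal: "\<lbrakk>x \<preceq> y; y \<in> past A\<rbrakk> \<Longrightarrow> x \<in> past A"
  using chron_causal_trans unfolding past_def by blast

text \<open>At the earlier of its meetings with \<open>A\<close> and \<open>B\<close> an
  inextendible timelike curve lies in both past sets, and strictly after the later one it lies in
  neither.\<close>

lemma cauchy_set_edge_between:
  assumes AB: "A \<in> cauchy_sets l" "B \<in> cauchy_sets l" and E: "closed E"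
    "\<And>x y. \<lbrakk>x \<lless> y; y \<in> E\<rbrakk> \<Longrightarrow> x \<in> E" "past A \<inter> past B \<subseteq> E" "E \<subseteq> past A \<union> past B"
  shows "edge E \<in> cauchy_sets l"
proof (rule cauchy_set_edge[OF E(1,2)])
  fix I \<gamma> assume \<gamma>: "timelike_curve l I \<gamma>" "inextendible l I \<gamma>"
  obtain a where a: "a \<in> I" "\<gamma> a \<in> A" by (rule cauchy_set_meets[OF AB(1) \<gamma>])
  obtain b where b: "b \<in> I" "\<gamma> b \<in> B" by (rule cauchy_set_meets[OF AB(2) \<gamma>])
  have "min a b \<in> I" using a b by (simp add: min_def)
  then have "\<gamma> (min a b) \<preceq> \<gamma> a" "\<gamma> (min a b) \<preceq> \<gamma> b"
    using a b by (auto intro!: timelike_curve_mono[OF \<gamma>(1)])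
  moreover have "\<gamma> a \<in> past A" "\<gamma> b \<in> past B" using past_iff AB a b by blast+
  ultimately have "\<gamma> (min a b) \<in> past A \<inter> past B" using past_down_causal by blast
  then show "\<exists>t\<in>I. \<gamma> t \<in> E" using E(3) \<open>min a b \<in> I\<close> by blast
  have "max a b \<in> I" using a b by (simp add: max_def)
  then obtain t where t: "t \<in> I" "max a b < t" by (rule inextendible_no_max[OF \<gamma>])
  then have "\<gamma> a \<lless> \<gamma> t" "\<gamma> b \<lless> \<gamma> t" using \<gamma>(1) a b by (auto simp: timelike_curve_def)
  then have "\<gamma> t \<notin> past A \<union> past B" using a b by (auto simp: past_def)
  then show "\<exists>t\<in>I. \<gamma> t \<notin> E" using E(4) t(1) by blast
qed (use E(2) in blast)

text \<open>For \<open>D = d_J A B\<close>, the boundaries of these past sets, \<open>0 \<le> s \<le> D\<close>, form a geodesic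
  from \<open>A\<close> to \<open>B\<close>. When neither set lies in the past of the other, both bounds are needed.\<close>

definition between :: "'a set \<Rightarrow> 'a set \<Rightarrow> real \<Rightarrow> real \<Rightarrow> 'a set" where
  "between A B D s = {x \<in> past A \<union> past B.
     (\<forall>a\<in>A. d a x \<le> ereal s) \<and> (\<forall>b\<in>B. d b x \<le> ereal (D - s))}"

lemma between_down: "\<lbrakk>x \<lless> y; y \<in> between A B D s\<rbrakk> \<Longrightarrow> x \<in> between A B D s"
  using past_down[of x y] order_trans[OF d_mono_right'[OF chron_imp_causal]]
  unfolding between_def by blast

lemma edge_between_cauchy:
  assumes "A \<in> cauchy_sets l" "B \<in> cauchy_sets l" "0 \<le> s" "s \<le> D"
  shows "edge (between A B D s) \<in> cauchy_sets l"
proof (rule cauchy_set_edge_between[OF assms(1,2) _ between_down])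
  have "between A B D s = (past A \<union> past B) \<inter> {x. \<forall>a\<in>A. d a x \<le> ereal s} \<inter>
      {x. \<forall>b\<in>B. d b x \<le> ereal (D - s)}"
    by (auto simp: between_def)
  then show "closed (between A B D s)"
    by (simp add: closed_Int closed_Un closed_past closed_d_le)
  have "d a x \<le> ereal c" if "d a x \<le> 0" "0 \<le> c" for a x c
    using that by (meson ereal_less_eq(5) order_trans)
  then show "past A \<inter> past B \<subseteq> between A B D s"
    using assms(3,4) by (auto simp: between_def past_eq)
  show "between A B D s \<subseteq> past A \<union> past B" by (auto simp: between_def)
qed

text \<open>If an edge point preceded a point of the other edge by more than \<open>t - s\<close>,
  pushing it out of its past set would break the bound from \<open>A\<close> or from
  \<open>B\<close>. Adding the excess over \<open>t - s\<close> then breaks the corresponding bound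
  at the later point. In either time order one of the two cases is sharp, and the other has slack
  \<open>2 * (t - s)\<close>.\<close>

lemma between_dist:
  assumes "0 \<le> s" "s \<le> t" "t \<le> D"
  shows "d_J l (edge (between A B D s)) (edge (between A B D t)) \<le> ereal (t - s)"
proof -
  \<comment> \<open>The point \<open>x'\<close> is still in \<open>past A \<union> past B\<close>,
    being before \<open>y\<close>, so it must be one of the numerical bounds that fails.\<close>
  have exceeds: "(\<exists>a\<in>A. ereal u < d a x') \<or> (\<exists>b\<in>B. ereal (D - u) < d b x')"
    if "x' \<notin> between A B D u" "ereal (t - s) < d x' y" "y \<in> between A B D v" for x' y u v
  proof -
    have "0 < d x' y" using that(2) assms(2) by (auto intro: le_less_trans[rotated])
    then have "x' \<in> past A \<union> past B"
      using that(3) past_down[of x' y] by (auto simp: between_def chron_iff)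
    then show ?thesis using that(1) by (auto simp: between_def not_le)
  qed
  show ?thesis
  proof (rule d_J_least; rule ccontr)
    fix x y assume "x \<in> edge (between A B D s)" "y \<in> edge (between A B D t)"
    then have x: "x \<in> between A B D s" and y: "y \<in> between A B D t" by (auto simp: edge_def)
    assume "\<not> d x y \<le> ereal (t - s)"
    then have "ereal (t - s) < d x y" by simp
    then obtain x' where x': "x' \<notin> between A B D s" "ereal (t - s) < d x' y"
      by (rule edge_push_up[OF \<open>x \<in> edge (between A B D s)\<close>])
    from exceeds[OF x' y] show False
    proof (elim disjE bexE)
      fix a assume a: "a \<in> A" "ereal s < d a x'"
      have "ereal (s + (t - s)) < d a y" by (rule d_add_less[OF _ _ a(2) x'(2)]) (use assms in auto)
      moreover have "d a y \<le> ereal t" using y a(1) by (simp add: between_def)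
      ultimately show False by simp
    next
      fix b assume b: "b \<in> B" "ereal (D - s) < d b x'"
      have "ereal ((D - s) + (t - s)) < d b y"
        by (rule d_add_less[OF _ _ b(2) x'(2)]) (use assms in auto)
      also have "d b y \<le> ereal (D - t)" using y b(1) by (simp add: between_def)
      finally show False using assms by simp
    qed
  next
    fix x y assume "x \<in> edge (between A B D s)" "y \<in> edge (between A B D t)"
    then have x: "x \<in> between A B D s" and y: "y \<in> between A B D t" by (auto simp: edge_def)
    assume "\<not> d y x \<le> ereal (t - s)"
    then have "ereal (t - s) < d y x" by simp
    then obtain y' where y': "y' \<notin> between A B D t" "ereal (t - s) < d y' x"
      by (rule edge_push_up[OF \<open>y \<in> edge (between A B D t)\<close>])
    from exceeds[OF y' x] show False
    proof (elim disjE bexE)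
      fix a assume a: "a \<in> A" "ereal t < d a y'"
      have "ereal (t + (t - s)) < d a x" by (rule d_add_less[OF _ _ a(2) y'(2)]) (use assms in auto)
      also have "d a x \<le> ereal s" using x a(1) by (simp add: between_def)
      finally show False using assms by simp
    next
      fix b assume b: "b \<in> B" "ereal (D - t) < d b y'"
      have "ereal ((D - t) + (t - s)) < d b x"
        by (rule d_add_less[OF _ _ b(2) y'(2)]) (use assms in auto)
      also have "d b x \<le> ereal (D - s)" using x b(1) by (simp add: between_def)
      finally show False by simp
    qed
  qed
qed

lemma past_bound:
  assumes A: "A \<in> cauchy_sets l" and "x \<in> past A" "b \<in> B"
  shows "d b x \<le> d_J l A B"
proof -
  obtain a where "a \<in> A" "x \<preceq> a"
    using assms(2) past_iff[OF A] chron_imp_causal causal_refl by blast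
  then show ?thesis using d_mono_right'[of x a b] d_le_d_J(2)[of a A b B] assms(3) by simp
qed

text \<open>For \<open>s = 0\<close> the bound from \<open>A\<close> is membership in
  \<open>past A\<close>, and the bound from \<open>B\<close> holds there by
  \<open>past_bound\<close>.\<close>

lemma between_start:
  assumes "A \<in> cauchy_sets l" "d_J l A B = ereal D"
  shows "between A B D 0 = past A"
proof -
  have "d b x \<le> ereal D" if "x \<in> past A" "b \<in> B" for b x
    using past_bound[OF assms(1) that] assms(2) by simp
  moreover have "x \<in> past A \<longleftrightarrow> (\<forall>a\<in>A. d a x \<le> ereal 0)" for x
    by (simp add: past_eq zero_ereal_def)
  ultimately show ?thesis by (auto simp: between_def)
qed

lemma between_end:
  assumes "B \<in> cauchy_sets l" "d_J l A B = ereal D"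
  shows "between A B D D = past B"
proof -
  have "d a x \<le> ereal D" if "x \<in> past B" "a \<in> A" for a x
    using past_bound[OF assms(1) that] assms(2) by (simp add: d_J_commute)
  moreover have "x \<in> past B \<longleftrightarrow> (\<forall>b\<in>B. d b x \<le> ereal (D - D))" for x
    by (simp add: past_eq zero_ereal_def)
  ultimately show ?thesis unfolding between_def by blast
qed

end

context cauchy_compact_space
begin

lemma geodesic_dJ: "geodesic_metric (cauchy_sets l) dJ"
  unfolding geodesic_metric_def
proof (intro ballI)
  interpret MS: Metric_space "cauchy_sets l" dJ by (rule Metric_space_dJ)
  fix A B assume A: "A \<in> cauchy_sets l" and B: "B \<in> cauchy_sets l"
  define D where "D = dJ A B"
  have D: "d_J l A B = ereal D" using d_J_eq_dJ[OF A B] by (simp add: D_def)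
  have "0 \<le> D" by (simp add: D_def)
  define \<gamma> where "\<gamma> s = edge (between A B D s)" for s
  have \<gamma>: "\<gamma> s \<in> cauchy_sets l" if "s \<in> {0..D}" for s
    using edge_between_cauchy[OF A B] that by (simp add: \<gamma>_def)
  have ends: "\<gamma> 0 = A" "\<gamma> D = B"
    using between_start[OF A D] between_end[OF B D] edge_past A B by (simp_all add: \<gamma>_def)
  have lipschitz: "dJ (\<gamma> s) (\<gamma> t) \<le> t - s" if "s \<in> {0..D}" "t \<in> {0..D}" "s \<le> t" for s t
    using between_dist[of s t D A B] that d_J_eq_dJ[OF \<gamma> \<gamma>, OF that(1,2)] by (simp add: \<gamma>_def)
  have "curve_in (cauchy_sets l) dJ {0..D} \<gamma>"
  proof (rule curve_inI)
    have "dJ (\<gamma> s) (\<gamma> u) \<le> 1 * \<bar>s - u\<bar>" if "s \<in> {0..D}" "u \<in> {0..D}" for s u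
      using lipschitz[of s u] lipschitz[of u s] MS.commute[of "\<gamma> s" "\<gamma> u"] that
      by (cases "s \<le> u") auto
    then show "\<exists>e>0. \<exists>C. \<forall>s\<in>{0..D}. \<forall>u\<in>{0..D}. \<bar>s - t\<bar> < e \<longrightarrow> \<bar>u - t\<bar> < e \<longrightarrow>
        dJ (\<gamma> s) (\<gamma> u) \<le> C * \<bar>s - u\<bar>" for t
      by (intro exI[of _ 1] conjI) auto
  qed (use \<gamma> \<open>0 \<le> D\<close> in \<open>auto simp: is_interval_cc\<close>)
  moreover have "arclength dJ {0..D} \<gamma> = ereal D"
  proof (rule antisym)
    show "arclength dJ {0..D} \<gamma> \<le> ereal D"
    proof (rule arclength_least)
      fix n :: nat and u :: "nat \<Rightarrow> real"
      assume u: "\<forall>i\<le>n. u i \<in> {0..D}" "\<forall>i<n. u i < u (Suc i)"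
      have "(\<Sum>i<n. dJ (\<gamma> (u i)) (\<gamma> (u (Suc i)))) \<le> (\<Sum>i<n. u (Suc i) - u i)"
        by (intro sum_mono lipschitz) (use u in \<open>auto simp: less_imp_le\<close>)
      also have "\<dots> = u n - u 0" by (rule sum_lessThan_telescope)
      also have "\<dots> \<le> D" using u(1)[rule_format, of n] u(1)[rule_format, of 0] by simp
      finally show "ereal (\<Sum>i<n. dJ (\<gamma> (u i)) (\<gamma> (u (Suc i)))) \<le> ereal D" by simp
    qed
    show "ereal D \<le> arclength dJ {0..D} \<gamma>"
    \<comment> \<open>For \<open>D = 0\<close> the interval is a point and there is no strict
      partition from 0 to \<open>D\<close>.\<close>
    proof (cases "D = 0")
      case True
      then show ?thesis using arclength_nonneg[of "{0..D}" dJ \<gamma>] by (simp add: zero_ereal_def)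
    next
      case False
      define u :: "nat \<Rightarrow> real" where "u i = (if i = 0 then 0 else D)" for i
      have "ereal (\<Sum>i<1. dJ (\<gamma> (u i)) (\<gamma> (u (Suc i)))) \<le> arclength dJ {0..D} \<gamma>"
        by (rule arclength_upper) (use False \<open>0 \<le> D\<close> in \<open>auto simp: u_def\<close>)
      then show ?thesis using ends by (simp add: u_def D_def)
    qed
  qed
  ultimately show "\<exists>a b \<gamma>. a \<le> b \<and> curve_in (cauchy_sets l) dJ {a..b} \<gamma> \<and> \<gamma> a = A \<and> \<gamma> b = B \<and>
      arclength dJ {a..b} \<gamma> = ereal (dJ A B)"
    using \<open>0 \<le> D\<close> ends unfolding D_def by blast
qed

end

section \<open>Completeness\<close>

context lorentzian_space
begin

text \<open>Otherwise the points \<open>\<gamma> (t n)\<close> contain a chronological chain running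
  to the end of the curve. It satisfies the Cauchy condition, so it converges by completeness, and
  the curve could be extended to its limit.\<close>

lemma eventually_bounded_above:
  fixes t :: "nat \<Rightarrow> real"
  assumes complete: "timelike_cauchy_complete l"
    and \<gamma>: "timelike_curve l I \<gamma>" "\<not> future_extendible l I \<gamma>" and t: "\<And>n. t n \<in> I"
    and cauchy: "\<And>\<epsilon>::real. 0 < \<epsilon> \<Longrightarrow> \<exists>N. \<forall>n\<ge>N. \<forall>m\<ge>N. d (\<gamma> (t n)) (\<gamma> (t m)) \<le> ereal \<epsilon>"
  shows "\<exists>T\<in>I. \<exists>N. \<forall>n\<ge>N. t n \<le> T"
proof (rule ccontr)
  assume "\<not> ?thesis"
  then have unbounded: "\<exists>n\<ge>N. T < t n" if "T \<in> I" for T N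
    using that by (meson not_le)
  \<comment> \<open>The three conditions make \<open>r\<close> a subsequence, the points a
    chronological chain, and the chosen parameters cofinal in \<open>I\<close>.\<close>
  have "\<exists>r. \<forall>k. r k < r (Suc k) \<and> t (r k) < t (r (Suc k)) \<and> t k < t (r (Suc k))"
  proof -
    have "\<exists>m. n < m \<and> t n < t m \<and> t k < t m" for n k
    proof -
      have "max (t n) (t k) \<in> I" using t by (simp add: max_def)
      then obtain m where "m \<ge> Suc n" "max (t n) (t k) < t m" using unbounded by blast
      then show ?thesis by (intro exI[of _ m]) auto
    qed
    then obtain g where g: "\<And>n k. n < g n k \<and> t n < t (g n k) \<and> t k < t (g n k)"
      by metis
    define r where "r = rec_nat 0 (\<lambda>k n. g n k)"
    have "r (Suc k) = g (r k) k" for k by (simp add: r_def)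
    then show ?thesis using g by (intro exI[of _ r]) simp
  qed
  then obtain r :: "nat \<Rightarrow> nat" where r: "\<And>k. r k < r (Suc k)"
    "\<And>k. t (r k) < t (r (Suc k))" "\<And>k. t k < t (r (Suc k))" by blast
  define x where "x k = \<gamma> (t (r k))" for k
  have "strict_mono r" using r(1) by (simp add: strict_mono_Suc_iff)
  have chain: "x k \<lless> x (Suc k)" for k
    using \<gamma>(1) t r(2) by (auto simp: x_def timelike_curve_def)
  have "(\<lambda>j. SUP k. d (x j) (x (j + k))) \<longlonglongrightarrow> 0"
  proof (rule order_tendstoI)
    fix a :: ereal assume "a < 0"
    have "a < (SUP k. d (x j) (x (j + k)))" for j
      using \<open>a < 0\<close> d_nonneg by (intro less_le_trans[OF _ SUP_upper2[of 0]]) (auto intro: less_le_trans)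
    then show "eventually (\<lambda>j. a < (SUP k. d (x j) (x (j + k)))) sequentially" by simp
  next
    fix a :: ereal assume "0 < a"
    then obtain \<epsilon> where \<epsilon>: "0 < ereal \<epsilon>" "ereal \<epsilon> < a" using ereal_dense2 by blast
    then obtain N where N: "\<And>n m. \<lbrakk>N \<le> n; N \<le> m\<rbrakk> \<Longrightarrow> d (\<gamma> (t n)) (\<gamma> (t m)) \<le> ereal \<epsilon>"
      using cauchy[of \<epsilon>] by auto
    have "(SUP k. d (x j) (x (j + k))) < a" if "N \<le> j" for j
    proof -
      have "N \<le> r (j + k)" for k
        using seq_suble[OF \<open>strict_mono r\<close>, of "j + k"] that by linarith
      from this[of 0] this have "(SUP k. d (x j) (x (j + k))) \<le> ereal \<epsilon>"
        unfolding x_def by (intro SUP_least N) simp_all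
      then show ?thesis using \<epsilon>(2) by (rule le_less_trans)
    qed
    then show "eventually (\<lambda>j. (SUP k. d (x j) (x (j + k))) < a) sequentially"
      by (rule eventually_sequentiallyI)
  qed
  then have "convergent x" using complete chain unfolding timelike_cauchy_complete_def by blast
  then obtain p where "x \<longlonglongrightarrow> p" by (auto simp: convergent_def)
  then have "(\<lambda>k. \<gamma> (t (r k))) \<longlonglongrightarrow> p" by (simp add: x_def[abs_def])
  then have "future_extendible l I \<gamma>"
  proof (rule future_extendible_if_convergent[OF \<gamma>(1), rotated -1])
    show "t (r k) \<in> I" for k by (rule t)
    show "incseq (\<lambda>k. t (r k))" using r(2) by (intro incseq_SucI less_imp_le)
    fix s assume "s \<in> I"
    then obtain n where "s < t n" using unbounded by blast
    then show "\<exists>k. s < t (r k)" using r(3) by (meson less_trans)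
  qed
  then show False using \<gamma>(2) by blast
qed

text \<open>The Cauchy hypothesis is symmetric in \<open>n\<close> and \<open>m\<close>, hence
  unaffected by time reversal.\<close>

lemma eventually_bounded_below:
  fixes t :: "nat \<Rightarrow> real"
  assumes complete: "timelike_cauchy_complete l"
    and \<gamma>: "timelike_curve l I \<gamma>" "\<not> past_extendible l I \<gamma>" and t: "\<And>n. t n \<in> I"
    and cauchy: "\<And>\<epsilon>::real. 0 < \<epsilon> \<Longrightarrow> \<exists>N. \<forall>n\<ge>N. \<forall>m\<ge>N. d (\<gamma> (t n)) (\<gamma> (t m)) \<le> ereal \<epsilon>"
  shows "\<exists>T\<in>I. \<exists>N. \<forall>n\<ge>N. T \<le> t n"
proof -
  interpret dual: lorentzian_space "\<lambda>x y. l y x" by (rule dual)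
  have dual_d: "dual.d u v = d v u" for u v by (simp add: lor_dist_def)
  have "timelike_cauchy_complete (\<lambda>x y. l y x)"
    using complete unfolding timelike_cauchy_complete_def chron_less_def lor_dist_def by blast
  moreover have "\<not> future_extendible (\<lambda>x y. l y x) (uminus ` I) (\<lambda>t. \<gamma> (- t))"
    using future_extendible_reflect[of "\<lambda>x y. l y x" "uminus ` I" "\<lambda>t. \<gamma> (- t)"] \<gamma>(2)
    by (auto simp: image_image)
  moreover have "\<exists>N. \<forall>n\<ge>N. \<forall>m\<ge>N. dual.d (\<gamma> (- (- t n))) (\<gamma> (- (- t m))) \<le> ereal \<epsilon>"
    if "0 < \<epsilon>" for \<epsilon>
    using cauchy[OF that] unfolding dual_d minus_minus by blast
  ultimately have "\<exists>T\<in>uminus ` I. \<exists>N. \<forall>n\<ge>N. - t n \<le> T"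
    by (intro dual.eventually_bounded_above[OF _ timelike_curve_reflect[OF \<gamma>(1)]])
      (use t in auto)
  then obtain T N where "T \<in> I" "\<forall>n\<ge>N. - t n \<le> - T" by auto
  then have "\<forall>n\<ge>N. T \<le> t n" by simp
  then show ?thesis using \<open>T \<in> I\<close> by blast
qed

end

context cauchy_compact_space
begin

lemma mcomplete_dJ:
  assumes complete: "timelike_cauchy_complete l"
  shows "Metric_space.mcomplete (cauchy_sets l) dJ"
proof -
  interpret MS: Metric_space "cauchy_sets l" dJ by (rule Metric_space_dJ)
  show ?thesis
    unfolding MS.mcomplete_def
  proof (intro allI impI)
    fix \<sigma> assume "MS.MCauchy \<sigma>"
    then have \<sigma>: "\<sigma> n \<in> cauchy_sets l" for n by (auto simp: MS.MCauchy_def)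
    \<comment> \<open>Taken in \<open>ereal\<close>, so that the supremum exists without a prior
      bound.\<close>
    define \<delta> where "\<delta> n = (SUP m\<in>{n..}. d_J l (\<sigma> n) (\<sigma> m))" for n
    have d_J_le: "d_J l (\<sigma> n) (\<sigma> m) \<le> \<delta> n" if "n \<le> m" for n m
      unfolding \<delta>_def using that by (intro SUP_upper) simp
    have \<delta>_nonneg: "0 \<le> \<delta> n" for n
      using d_J_le[of n n] d_J_nonneg[OF \<sigma> \<sigma>] by (rule order_trans[rotated]) simp
    have \<delta>_small: "\<exists>N. \<forall>n\<ge>N. \<delta> n \<le> ereal \<epsilon>" if "0 < \<epsilon>" for \<epsilon>
    proof -
      have "\<forall>\<epsilon>>0. \<exists>N. \<forall>n m. N \<le> n \<longrightarrow> N \<le> m \<longrightarrow> dJ (\<sigma> n) (\<sigma> m) < \<epsilon>"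
        using \<open>MS.MCauchy \<sigma>\<close> unfolding MS.MCauchy_def by (rule conjunct2)
      then obtain N where N: "\<forall>n m. N \<le> n \<longrightarrow> N \<le> m \<longrightarrow> dJ (\<sigma> n) (\<sigma> m) < \<epsilon>"
        using \<open>0 < \<epsilon>\<close> by meson
      have "\<delta> n \<le> ereal \<epsilon>" if "N \<le> n" for n
        unfolding \<delta>_def
      proof (rule SUP_least)
        fix m assume "m \<in> {n..}"
        then have "dJ (\<sigma> n) (\<sigma> m) < \<epsilon>" using N that by simp
        then show "d_J l (\<sigma> n) (\<sigma> m) \<le> ereal \<epsilon>" using d_J_eq_dJ[OF \<sigma> \<sigma>] by simp
      qed
      then show ?thesis by blast
    qed
    define E where "E = {x. \<forall>n. \<forall>a\<in>\<sigma> n. d a x \<le> \<delta> n}"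
    have "edge E \<in> cauchy_sets l"
    proof (rule cauchy_set_edge)
      have "E = (\<Inter>n. {x. \<forall>a\<in>\<sigma> n. d a x \<le> \<delta> n})" by (auto simp: E_def)
      then show "closed E" using closed_d_le by auto
      show "x \<in> E" if "x \<lless> y" "y \<in> E" for x y
        using that(2) order_trans[OF d_mono_right'[OF chron_imp_causal[OF that(1)]]]
        unfolding E_def by blast
    next
      fix I \<gamma> assume \<gamma>: "timelike_curve l I \<gamma>" "inextendible l I \<gamma>"
      have "\<exists>t. t \<in> I \<and> \<gamma> t \<in> \<sigma> n" for n using cauchy_set_meets[OF \<sigma> \<gamma>, of n] by blast
      then obtain t where t: "\<And>n. t n \<in> I" "\<And>n. \<gamma> (t n) \<in> \<sigma> n" by metis
      have cauchy: "\<exists>N. \<forall>n\<ge>N. \<forall>m\<ge>N. d (\<gamma> (t n)) (\<gamma> (t m)) \<le> ereal \<epsilon>" if "0 < \<epsilon>" for \<epsilon>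
      proof -
        obtain N where N: "\<And>n. N \<le> n \<Longrightarrow> \<delta> n \<le> ereal \<epsilon>" using \<delta>_small[OF \<open>0 < \<epsilon>\<close>] by blast
        have "d (\<gamma> (t n)) (\<gamma> (t m)) \<le> ereal \<epsilon>" if "N \<le> n" "N \<le> m" for n m
        proof (cases "n \<le> m")
          case True
          then show ?thesis
            using d_le_d_J(1)[OF t(2) t(2), of n m] d_J_le[OF True] N[OF that(1)] by order
        next
          case False
          then have "m \<le> n" by simp
          then show ?thesis
            using d_le_d_J(2)[OF t(2) t(2), of n m] d_J_le[OF \<open>m \<le> n\<close>] N[OF that(2)] by order
        qed
        then show ?thesis by blast
      qed
      show "\<exists>s\<in>I. \<gamma> s \<in> E"
      proof -
        obtain T N where T: "T \<in> I" "\<And>n. N \<le> n \<Longrightarrow> T \<le> t n"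
          using eventually_bounded_below[OF complete \<gamma>(1) _ t(1) cauchy] \<gamma>(2)
          unfolding inextendible_def by blast
        have "d a (\<gamma> T) \<le> \<delta> n" if "a \<in> \<sigma> n" for n a
        proof -
          \<comment> \<open>From \<open>m \<ge> N\<close> the point \<open>\<gamma> T\<close>
            precedes \<open>\<gamma> (t m)\<close>, and from \<open>m \<ge> n\<close> the distance
            to \<open>\<sigma> m\<close> is bounded by \<open>\<delta> n\<close>.\<close>
          define m where "m = max n N"
          have "\<gamma> T \<preceq> \<gamma> (t m)"
            using T(2)[of m] by (intro timelike_curve_mono[OF \<gamma>(1) T(1) t(1)]) (simp add: m_def)
          then have "d a (\<gamma> T) \<le> d a (\<gamma> (t m))" by (rule d_mono_right')
          also have "\<dots> \<le> d_J l (\<sigma> n) (\<sigma> m)" using that t(2) by (rule d_le_d_J)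
          also have "\<dots> \<le> \<delta> n" by (rule d_J_le) (simp add: m_def)
          finally show ?thesis .
        qed
        then show ?thesis using T(1) by (auto simp: E_def)
      qed
      show "\<exists>s\<in>I. \<gamma> s \<notin> E"
      proof -
        obtain T N where T: "T \<in> I" "\<And>n. N \<le> n \<Longrightarrow> t n \<le> T"
          using eventually_bounded_above[OF complete \<gamma>(1) _ t(1) cauchy] \<gamma>(2)
          unfolding inextendible_def by blast
        \<comment> \<open>The distance from \<open>\<gamma> T\<close> to \<open>\<gamma> T'\<close>
          is positive and fixed, whereas \<open>\<delta> n\<close> tends to 0. As
          \<open>\<gamma> (t n)\<close> precedes \<open>\<gamma> T\<close>, the bound for a late
          \<open>n\<close> fails at \<open>\<gamma> T'\<close>.\<close>
        obtain T' where T': "T' \<in> I" "T < T'" by (rule inextendible_no_max[OF \<gamma> T(1)])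
        then have "\<gamma> T \<lless> \<gamma> T'" using \<gamma>(1) T(1) by (auto simp: timelike_curve_def)
        then obtain \<epsilon> where \<epsilon>: "0 < ereal \<epsilon>" "ereal \<epsilon> < d (\<gamma> T) (\<gamma> T')"
          unfolding chron_iff using ereal_dense2 by blast
        then obtain N' where N': "\<And>n. N' \<le> n \<Longrightarrow> \<delta> n \<le> ereal \<epsilon>"
          using \<delta>_small[of \<epsilon>] by auto
        define n where "n = max N N'"
        have "\<delta> n \<le> ereal \<epsilon>" by (rule N') (simp add: n_def)
        also have "\<dots> < d (\<gamma> T) (\<gamma> T')" by (rule \<epsilon>(2))
        also have "\<dots> \<le> d (\<gamma> (t n)) (\<gamma> T')"
        proof (rule d_mono_left)
          show "\<gamma> (t n) \<preceq> \<gamma> T"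
            using T(2)[of n] by (intro timelike_curve_mono[OF \<gamma>(1) t(1) T(1)]) (simp add: n_def)
          show "\<gamma> T \<preceq> \<gamma> T'" using \<open>\<gamma> T \<lless> \<gamma> T'\<close> by (rule chron_imp_causal)
        qed
        finally have "\<gamma> T' \<notin> E" using t(2)[of n] by (auto simp: E_def not_le)
        then show ?thesis using T'(1) by blast
      qed
    qed
    have limit: "d_J l (\<sigma> n) (edge E) \<le> \<delta> n" for n
    proof (rule d_J_least)
      fix x y assume x: "x \<in> \<sigma> n" and y: "y \<in> edge E"
      then show "d x y \<le> \<delta> n" by (auto simp: edge_def E_def)
      show "d y x \<le> \<delta> n"
      proof (rule ccontr)
        assume "\<not> d y x \<le> \<delta> n"
        then have "\<delta> n < d y x" by simp
        \<comment> \<open>Outside \<open>E\<close> the bound for some \<open>m\<close> fails, so a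
          chain from \<open>\<sigma> m\<close> through \<open>y'\<close> to \<open>x\<close> exceeds
          both \<open>\<delta> m\<close> and \<open>\<delta> n\<close>. One of these two bounds the
          distance of \<open>\<sigma> m\<close> and \<open>\<sigma> n\<close>, whichever index is
          smaller.\<close>
        then obtain y' where y': "y' \<notin> E" "\<delta> n < d y' x" by (rule edge_push_up[OF y])
        then obtain m a where a: "a \<in> \<sigma> m" "\<delta> m < d a y'" by (auto simp: E_def not_le)
        have "a \<lless> y'" "y' \<lless> x"
          using a(2) y'(2) \<delta>_nonneg by (auto simp: chron_iff intro: le_less_trans)
        then have "\<delta> n < d a x" "\<delta> m < d a x"
          using a(2) y'(2) d_mono_left[of a y' x] d_mono_right[of a y' x] chron_imp_causal
          by (auto intro: less_le_trans)
        moreover have "d a x \<le> d_J l (\<sigma> m) (\<sigma> n)" using a(1) x by (rule d_le_d_J)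
        moreover have "d_J l (\<sigma> m) (\<sigma> n) \<le> \<delta> m \<or> d_J l (\<sigma> m) (\<sigma> n) \<le> \<delta> n"
          using d_J_le[of m n] d_J_le[of n m] d_J_commute[of "\<sigma> m" "\<sigma> n"] by (cases "m \<le> n") auto
        ultimately show False by (auto simp: not_le[symmetric] intro: order_trans)
      qed
    qed
    have "limitin MS.mtopology \<sigma> (edge E) sequentially"
      unfolding MS.limit_metric_sequentially
    proof (intro conjI allI impI)
      fix \<epsilon> :: real assume "0 < \<epsilon>"
      then obtain N where N: "\<And>n. N \<le> n \<Longrightarrow> \<delta> n \<le> ereal (\<epsilon> / 2)"
        using \<delta>_small[of "\<epsilon> / 2"] by auto
      have "dJ (\<sigma> n) (edge E) < \<epsilon>" if "N \<le> n" for n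
      proof -
        have "ereal (dJ (\<sigma> n) (edge E)) \<le> ereal (\<epsilon> / 2)"
          using limit[of n] N[OF that] d_J_eq_dJ[OF \<sigma> \<open>edge E \<in> cauchy_sets l\<close>, of n] by order
        then show ?thesis using \<open>0 < \<epsilon>\<close> by simp
      qed
      then show "\<exists>N. \<forall>n\<ge>N. \<sigma> n \<in> cauchy_sets l \<and> dJ (\<sigma> n) (edge E) < \<epsilon>" using \<sigma> by blast
    qed fact
    then show "\<exists>C. limitin MS.mtopology \<sigma> C sequentially" by blast
  qed
qed

end

section \<open>Globally hyperbolic length spaces\<close>

lemma localizing_nbhdE:
  fixes l :: "'a::metric_space \<Rightarrow> 'a \<Rightarrow> ereal"
  assumes "localizing_nbhd l \<Omega>"
  obtains \<omega> :: "'a \<Rightarrow> 'a \<Rightarrow> real" and l' where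
    "continuous_on (\<Omega> \<times> \<Omega>) (\<lambda>(p, q). \<omega> p q)"
    "\<forall>p\<in>\<Omega>. \<forall>q\<in>\<Omega>. 0 \<le> \<omega> p q"
    "KS_pre_length_space_on \<Omega> l'"
    "\<forall>p\<in>\<Omega>. \<forall>q\<in>\<Omega>. (causal_le l' p q \<longleftrightarrow> causal_le l p q) \<and>
       (chron_less l' p q \<longleftrightarrow> chron_less l p q) \<and> lor_dist l' p q = ereal (\<omega> p q)"
    "\<forall>p\<in>\<Omega>. \<forall>q\<in>\<Omega>. causal_le l p q \<and> p \<noteq> q \<longrightarrow>
       (\<exists>a b \<gamma>. causal_curve_from_to l a b \<gamma> p q \<and> \<gamma> ` {a..b} \<subseteq> \<Omega> \<and>
          (\<forall>a' b' \<gamma>'. causal_curve_from_to l a' b' \<gamma>' p q \<and> \<gamma>' ` {a'..b'} \<subseteq> \<Omega> \<longrightarrow>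
             lor_length l a' b' \<gamma>' \<le> lor_length l a b \<gamma>) \<and>
          lor_length l a b \<gamma> = ereal (\<omega> p q) \<and> ereal (\<omega> p q) \<le> lor_dist l p q)"
  using assms unfolding localizing_nbhd_def by (elim conjE exE) (rule that)

lemma localizing_nbhd_ex_chron:
  assumes "localizing_nbhd l \<Omega>" "x \<in> \<Omega>"
  shows "\<exists>y. chron_less l x y" "\<exists>y. chron_less l y x"
proof -
  have "\<forall>y\<in>\<Omega>. I_plus l y \<inter> \<Omega> \<noteq> {} \<and> I_minus l y \<inter> \<Omega> \<noteq> {}"
    using assms(1) unfolding localizing_nbhd_def by (elim conjE)
  then have "I_plus l x \<noteq> {}" "I_minus l x \<noteq> {}" using assms(2) by blast+
  then show "\<exists>y. chron_less l x y" "\<exists>y. chron_less l y x"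
    by (simp_all add: I_plus_def I_minus_def)
qed

lemma localizing_nbhd_bounded_arclength:
  assumes "localizing_nbhd l \<Omega>"
  shows "\<exists>C. \<forall>I \<gamma>. causal_curve l I \<gamma> \<and> \<gamma> ` I \<subseteq> \<Omega> \<longrightarrow> arclength dist I \<gamma> \<le> ereal C"
proof -
  have "\<exists>C>0. \<forall>I \<gamma>. causal_curve l I \<gamma> \<and> \<gamma> ` I \<subseteq> \<Omega> \<longrightarrow> arclength dist I \<gamma> \<le> ereal C"
    using assms unfolding localizing_nbhd_def by (elim conjE)
  then show ?thesis by blast
qed

text \<open>The reverse triangle inequality alone allows the value \<infinity> on the diagonal. The
  local function \<open>\<omega>\<close> is real valued, and a finite positive value would have to
  be at least twice itself.\<close>

lemma localizing_nbhd_chron_irrefl: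
  fixes l :: "'a::metric_space \<Rightarrow> 'a \<Rightarrow> ereal"
  assumes "localizing_nbhd l \<Omega>" "x \<in> \<Omega>"
  shows "\<not> chron_less l x x"
proof
  assume "chron_less l x x"
  obtain \<omega> :: "'a \<Rightarrow> 'a \<Rightarrow> real" and l' where l': "KS_pre_length_space_on \<Omega> l'"
    "\<forall>p\<in>\<Omega>. \<forall>q\<in>\<Omega>. (causal_le l' p q \<longleftrightarrow> causal_le l p q) \<and>
       (chron_less l' p q \<longleftrightarrow> chron_less l p q) \<and> lor_dist l' p q = ereal (\<omega> p q)"
    by (rule localizing_nbhdE[OF assms(1)])
  then have "chron_less l' x x" "lor_dist l' x x = ereal (\<omega> x x)"
    using \<open>chron_less l x x\<close> assms(2) by auto
  then have "0 < \<omega> x x" by (simp add: chron_less_def)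
  then have "l' x x = ereal (\<omega> x x)" using \<open>lor_dist l' x x = ereal (\<omega> x x)\<close> by (auto simp: lor_dist_def max_def split: if_splits)
  moreover have "add_sep (l' x x) (l' x x) \<le> l' x x"
    using l'(1) assms(2) unfolding KS_pre_length_space_on_def time_separation_on_def by blast
  ultimately show False using \<open>0 < \<omega> x x\<close> by (simp add: add_sep_def)
qed

text \<open>A causal curve in \<open>\<Omega>\<close> with distinct endpoints is at most as long as
  the maximal one, whose length \<open>\<omega>\<close> is continuous and hence bounded near
  \<open>(x, x)\<close>.\<close>

lemma localizing_nbhd_bounded_length:
  fixes l :: "'a::metric_space \<Rightarrow> 'a \<Rightarrow> ereal"
  assumes \<Omega>: "localizing_nbhd l \<Omega>" "open \<Omega>" "x \<in> \<Omega>"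
    and antisym: "\<And>x y. causal_le l x y \<Longrightarrow> causal_le l y x \<Longrightarrow> x = y"
    and irrefl: "\<And>x. \<not> chron_less l x x"
  shows "\<exists>U M. open U \<and> x \<in> U \<and> (\<forall>a b \<gamma>. a < b \<and> causal_curve l {a..b} \<gamma> \<and> \<gamma> ` {a..b} \<subseteq> U \<longrightarrow>
    lor_length l a b \<gamma> \<le> ereal M)"
proof -
  obtain \<omega> :: "'a \<Rightarrow> 'a \<Rightarrow> real" where cont: "continuous_on (\<Omega> \<times> \<Omega>) (\<lambda>(p, q). \<omega> p q)"
    and nonneg: "\<forall>p\<in>\<Omega>. \<forall>q\<in>\<Omega>. 0 \<le> \<omega> p q"
    and maximal: "\<forall>p\<in>\<Omega>. \<forall>q\<in>\<Omega>. causal_le l p q \<and> p \<noteq> q \<longrightarrow>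
       (\<exists>a b \<gamma>. causal_curve_from_to l a b \<gamma> p q \<and> \<gamma> ` {a..b} \<subseteq> \<Omega> \<and>
          (\<forall>a' b' \<gamma>'. causal_curve_from_to l a' b' \<gamma>' p q \<and> \<gamma>' ` {a'..b'} \<subseteq> \<Omega> \<longrightarrow>
             lor_length l a' b' \<gamma>' \<le> lor_length l a b \<gamma>) \<and>
          lor_length l a b \<gamma> = ereal (\<omega> p q) \<and> ereal (\<omega> p q) \<le> lor_dist l p q)"
    by (rule localizing_nbhdE[OF \<Omega>(1)])
  have "continuous_on (\<Omega> \<times> \<Omega>) (\<lambda>z. \<omega> (fst z) (snd z))"
    using cont by (simp add: case_prod_unfold)
  then obtain e where "e > 0" and
    e: "\<forall>z\<in>\<Omega> \<times> \<Omega>. dist z (x, x) < e \<longrightarrow> dist (\<omega> (fst z) (snd z)) (\<omega> x x) < 1"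
    using \<Omega>(3) unfolding continuous_on_iff
    by (elim ballE[of _ _ "(x, x)"] allE[of _ 1]) auto
  obtain r where "r > 0" "ball x r \<subseteq> \<Omega>" using \<Omega>(2,3) open_contains_ball by blast
  \<comment> \<open>Half of \<open>e\<close> for each component keeps pairs from \<open>U\<close>
    within \<open>e\<close> of \<open>(x, x)\<close>.\<close>
  define U where "U = ball x (min r (e / 2))"
  have "U \<subseteq> \<Omega>" using \<open>ball x r \<subseteq> \<Omega>\<close> by (auto simp: U_def)
  have \<omega>_le: "\<omega> p q \<le> \<omega> x x + 1" if "p \<in> U" "q \<in> U" for p q
  proof -
    have "dist (p, q) (x, x) \<le> dist p x + dist q x"
      by (simp add: dist_Pair_Pair sqrt_sum_squares_le_sum)
    also have "\<dots> < e" using that by (auto simp: U_def dist_commute)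
    finally have "dist (\<omega> p q) (\<omega> x x) < 1"
      using e[rule_format, of "(p, q)"] that \<open>U \<subseteq> \<Omega>\<close> by auto
    then show ?thesis by (simp add: dist_real_def)
  qed
  have "lor_length l a b \<gamma> \<le> ereal (\<omega> x x + 1)"
    if "a < b" "causal_curve l {a..b} \<gamma>" "\<gamma> ` {a..b} \<subseteq> U" for a b \<gamma>
  proof -
    have ab: "\<gamma> a \<in> U" "\<gamma> b \<in> U" using that(1,3) by auto
    have causal: "causal_le l (\<gamma> a) (\<gamma> b)" using that by (auto simp: causal_curve_def)
    show ?thesis
    proof (cases "\<gamma> a = \<gamma> b")
      \<comment> \<open>For equal endpoints no maximal curve is provided; the trivial partition
        bounds the length by the distance of the point from itself, which is 0.\<close>
      case True
      have "lor_length l a b \<gamma> \<le> lor_dist l (\<gamma> a) (\<gamma> b)" using that(1) by (rule lor_length_le_d)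
      also have "\<dots> \<le> 0" using irrefl[of "\<gamma> a"] True by (simp add: chron_less_def not_less)
      also have "\<dots> \<le> ereal (\<omega> x x + 1)" using nonneg \<Omega>(3) by simp
      finally show ?thesis .
    next
      case False
      have "lor_length l a b \<gamma> \<le> ereal (\<omega> (\<gamma> a) (\<gamma> b))"
      proof -
        have "\<gamma> a \<in> \<Omega>" "\<gamma> b \<in> \<Omega>" "\<gamma> ` {a..b} \<subseteq> \<Omega>"
          using ab that(3) \<open>U \<subseteq> \<Omega>\<close> by blast+
        from maximal[rule_format, OF this(1,2) conjI[OF causal False]] obtain a' b' \<gamma>' where
          *: "\<forall>a'' b'' \<gamma>''. causal_curve_from_to l a'' b'' \<gamma>'' (\<gamma> a) (\<gamma> b) \<and> \<gamma>'' ` {a''..b''} \<subseteq> \<Omega> \<longrightarrow>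
             lor_length l a'' b'' \<gamma>'' \<le> lor_length l a' b' \<gamma>'"
          "lor_length l a' b' \<gamma>' = ereal (\<omega> (\<gamma> a) (\<gamma> b))"
          by (elim exE conjE)
        have "causal_curve_from_to l a b \<gamma> (\<gamma> a) (\<gamma> b)"
          using that(1,2) by (simp add: causal_curve_from_to_def)
        then show ?thesis using *(1)[rule_format, of a b \<gamma>] \<open>\<gamma> ` {a..b} \<subseteq> \<Omega>\<close> *(2) by simp
      qed
      also have "\<dots> \<le> ereal (\<omega> x x + 1)" using \<omega>_le[OF ab] by simp
      finally show ?thesis .
    qed
  qed
  then show ?thesis
    using \<open>r > 0\<close> \<open>e > 0\<close> by (intro exI[of _ U] exI[of _ "\<omega> x x + 1"]) (auto simp: U_def)
qed

lemma cauchy_compact_space_if_length_space: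
  fixes l :: "'a::metric_space \<Rightarrow> 'a \<Rightarrow> ereal"
  assumes length: "KS_length_space l" and hyperbolic: "globally_hyperbolic l"
    and compact: "spatially_compact l"
  shows "cauchy_compact_space l"
proof -
  have nbhd: "\<exists>\<Omega>. open \<Omega> \<and> x \<in> \<Omega> \<and> localizing_nbhd l \<Omega>" for x
    using length unfolding KS_length_space_def by blast
  have irrefl: "\<not> chron_less l x x" for x
    using nbhd[of x] localizing_nbhd_chron_irrefl by blast
  show ?thesis
  proof
    show "time_separation_on UNIV l" "open {(x, y). c < lor_dist l x y}" for c
      using length by (auto simp: KS_length_space_def KS_pre_length_space_on_def)
    show "\<not> chron_less l x x" for x by (rule irrefl)
    show "\<exists>y. chron_less l x y" "\<exists>y. chron_less l y x" for x
      using nbhd[of x] localizing_nbhd_ex_chron by blast+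
    show "\<exists>a b \<gamma>. timelike_curve_from_to l a b \<gamma> x y" if "chron_less l x y" for x y
      using length that unfolding KS_length_space_def causally_path_connected_def by blast
    show "globally_hyperbolic l" by (rule hyperbolic)
    show "\<exists>\<Omega> C. open \<Omega> \<and> x \<in> \<Omega> \<and>
        (\<forall>I \<gamma>. causal_curve l I \<gamma> \<and> \<gamma> ` I \<subseteq> \<Omega> \<longrightarrow> arclength dist I \<gamma> \<le> ereal C)" for x
    proof -
      obtain \<Omega> where \<Omega>: "open \<Omega>" "x \<in> \<Omega>" "localizing_nbhd l \<Omega>" using nbhd by blast
      from localizing_nbhd_bounded_arclength[OF \<Omega>(3)] \<Omega>(1,2) show ?thesis
        by (elim exE) (intro exI conjI)
    qed
    show "\<exists>U M. open U \<and> x \<in> U \<and> (\<forall>a b \<gamma>. a < b \<and> causal_curve l {a..b} \<gamma> \<and> \<gamma> ` {a..b} \<subseteq> U \<longrightarrow>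
        lor_length l a b \<gamma> \<le> ereal M)" for x
    proof -
      obtain \<Omega> where "open \<Omega>" "x \<in> \<Omega>" "localizing_nbhd l \<Omega>" using nbhd by blast
      moreover have "x = y" if "causal_le l x y" "causal_le l y x" for x y
        using hyperbolic that by (auto simp: globally_hyperbolic_def)
      ultimately show ?thesis
        using irrefl by (intro localizing_nbhd_bounded_length[of l \<Omega>])
    qed
    show "lor_dist l x y = Sup {lor_length l a b \<gamma> | a b \<gamma>. causal_curve_from_to l a b \<gamma> x y}"
      if "chron_less l x y" for x y
      using length that unfolding KS_length_space_def by blast
    show "compact A" if "A \<in> cauchy_sets l" for A
      using compact that by (auto simp: spatially_compact_def)
  qed
qed

text \<open>\<open>real_of_ereal\<close> sends infinite values to 0, so finiteness of
  \<open>d_J\<close> is a conjunct of its own.\<close>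

theorem corollary5p20:
  fixes l :: "'a::metric_space \<Rightarrow> 'a \<Rightarrow> ereal"
  assumes "KS_length_space l"
    and "globally_hyperbolic l"
    and "spatially_compact l"
    and "timelike_cauchy_complete l"
  shows "(\<forall>A\<in>cauchy_sets l. \<forall>B\<in>cauchy_sets l. \<bar>d_J l A B\<bar> \<noteq> \<infinity>) \<and>
    Metric_space (cauchy_sets l) (\<lambda>A B. real_of_ereal (d_J l A B)) \<and>
    Metric_space.mcomplete (cauchy_sets l) (\<lambda>A B. real_of_ereal (d_J l A B)) \<and>
    geodesic_metric (cauchy_sets l) (\<lambda>A B. real_of_ereal (d_J l A B))"
proof -
  interpret cauchy_compact_space l
    using assms by (intro cauchy_compact_space_if_length_space)
  have dJ: "(\<lambda>A B. real_of_ereal (d_J l A B)) = dJ" by (simp add: dJ_def fun_eq_iff)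
  show ?thesis
    unfolding dJ
    using d_J_eq_dJ Metric_space_dJ mcomplete_dJ[OF assms(4)] geodesic_dJ by simp
qed

end
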